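(* Let $f:[0,1]\to[0,1]$ be a countably Markov and mixing interval map, with Markov partition $\mathcal X$ and set of partition intervals $\mathcal I$, whose associated Markov shift $\Sigma_M$ has a fair measure $\mathrm{Markov}(\pi,P)$. Then $f$ has a unique Lebesgue fair model, and it is the piecewise affine map $g:[0,1]\to[0,1]$ defined as follows. For each pair $i,j\in\mathcal X$ with $i\cap f^{-1}(j)\ne\emptyset$: if $i,j\in\mathcal I$, then $g$ maps $(x,x')$ affinely onto $(y,y')$ with the same orientation (increasing or decreasing) as $f|_i$; and if $j=\{c\}$ is a singleton, then $g$ maps $x$ to $y$; where $$x=\sum_{(k,l)\in W_{ij}}\pi_kp_{kl},\qquad x'=x+\pi_ip_{ij},\qquad y=\sum_{l\in W_j}\pi_l,\qquad y'=y+\pi_j,$$ $$W_{ij}=\{(k,l)\in\mathcal I\times\mathcal I:\ \emptyset\ne k\cap f^{-1}(l)\text{ lies to the left of } i\cap f^{-1}(j)\},$$ $$W_j=\{l\in\mathcal I:\ l\text{ lies to the left of } j\}.$$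
   Context: Countably Markov and mixing: a map $f:[0,1]\to[0,1]$ is called countably Markov and mixing if there is a countable partition $\mathcal X$ of $[0,1]$ such that: - $\mathcal X$ consists of open intervals $(a,b)$ and singletons $\{x\}$; write $\mathcal I$ for the set of open intervals belonging to $\mathcal X$ (partition intervals) and $C=\{x:\{x\}\in\mathcal X\}$ (partition points); - for each $i\in\mathcal I$ the restriction $f|_i$ is continuous and strictly monotone; - for each pair $i,j\in\mathcal I$ either $f(i)\supset j$ or $f(i)\cap j=\emptyset$; - $f(C)\subset C$; - $f$ is mixing: for each pair $U,V$ of nonempty open subsets of $[0,1]$ there is $N\ge0$ such that $f^n(U)\cap V\ne\emptyset$ for all $n\ge N$. ($f$ is not assumed continuous.) Transition matrix: $M=(m_{ij})_{i,j\in\mathcal I}$ with $m_{ij}=1$ if $f(i)\supset j$ and $m_{ij}=0$ if $f(i)\cap j=\emptyset$; it is irreducible. $\Sigma_M$ is the associated one-sided Markov shift. That $\Sigma_M$ has a fair measure $\mathrm{Markov}(\pi,P)$ means: all column sums $c_j=\sum_im_{ij}$ are finite and the stochastic matrix $Q=(q_{ji})$, $q_{ji}=m_{ij}/c_j$, is positive recurrent; $\pi$ is then the unique vector with $\pi Q=\pi$, $\pi_i\ge0$, $\sum_{i\in\mathcal I}\pi_i=1$ (its entries are strictly positive), and $P=(p_{ij})$ is the stochastic matrix given by $\pi_ip_{ij}=\pi_jq_{ji}$. Fair measure: let $h:[0,1]\to[0,1]$ be a map with a countable Borel partition $\mathcal Z$ of $[0,1]$ such that each $h|_Z:Z\to h(Z)$,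 $Z\in\mathcal Z$, is a Borel isomorphism onto a Borel set and the common refinement $\mathcal A$ of the partitions $\{h(Z),[0,1]\setminus h(Z)\}$, $Z\in\mathcal Z$, is countable. For $B$ contained in an element of $\mathcal A$ let $p(B)=\{Z\in\mathcal Z:B\subset h(Z)\}$ and $c(B)=\#p(B)$. An $h$-invariant Borel probability measure $\mu$ is fair if every Borel set $B$ contained in an element of $\mathcal A$ satisfies $\mu(Z\cap h^{-1}(B))=\mu(B)/c(B)$ for all $Z\in p(B)$ (with $\mu(B)/\infty=0$). This does not depend on the choice of $\mathcal Z$. An interval map is Lebesgue fair if Lebesgue measure is fair for it. A Lebesgue fair model for $f$ is a Lebesgue fair map $g$ conjugate to $f$ by a monotone increasing homeomorphism $\phi:[0,1]\to[0,1]$, $g\circ\phi=\phi\circ f$. *)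

theory Defs
  imports "HOL-Probability.Probability" "HOL-Library.Disjoint_Sets"
begin

text \<open>
  A map of the unit interval into itself is a function \<open>f :: real \<Rightarrow> real\<close> of which only the values
  on \<open>{0..1}\<close> matter.
\<close>

section \<open>Countably Markov and mixing interval maps\<close>

definition partition_intervals :: "real set set \<Rightarrow> real set set" where
  "partition_intervals X = {i \<in> X. \<exists>a b. a < b \<and> i = {a<..<b}}"

definition partition_points :: "real set set \<Rightarrow> real set" where
  "partition_points X = {x. {x} \<in> X}"

definition mixing_map :: "(real \<Rightarrow> real) \<Rightarrow> bool" where
  "mixing_map f \<longleftrightarrow>
     (\<forall>U V. openin (top_of_set {0..1}) U \<longrightarrow> openin (top_of_set {0..1}) V \<longrightarrow> U \<noteq> {} \<longrightarrow> V \<noteq> {} \<longrightarrow>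
        (\<exists>N. \<forall>n\<ge>N. (f ^^ n) ` U \<inter> V \<noteq> {}))"

definition countably_Markov_mixing :: "(real \<Rightarrow> real) \<Rightarrow> real set set \<Rightarrow> bool" where
  "countably_Markov_mixing f X \<longleftrightarrow>
     f \<in> {0..1} \<rightarrow> {0..1} \<and>
     countable X \<and> partition_on {0..1} X \<and>
     (\<forall>A\<in>X. (\<exists>a b. a < b \<and> A = {a<..<b}) \<or> (\<exists>x. A = {x})) \<and>
     (\<forall>i\<in>partition_intervals X. continuous_on i f \<and> (strict_mono_on i f \<or> strict_antimono_on i f)) \<and>
     (\<forall>i\<in>partition_intervals X. \<forall>j\<in>partition_intervals X. j \<subseteq> f ` i \<or> f ` i \<inter> j = {}) \<and>
     f ` partition_points X \<subseteq> partition_points X \<and>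
     mixing_map f"

definition transition_matrix :: "(real \<Rightarrow> real) \<Rightarrow> real set \<Rightarrow> real set \<Rightarrow> real" where
  "transition_matrix f i j = (if j \<subseteq> f ` i then 1 else 0)"


section \<open>Fair Markov measures\<close>

text \<open>Matrices indexed by a set \<open>S\<close> are functions; only the entries with both indices in \<open>S\<close> matter.\<close>

definition stochastic_matrix :: "'a set \<Rightarrow> ('a \<Rightarrow> 'a \<Rightarrow> real) \<Rightarrow> bool" where
  "stochastic_matrix S Q \<longleftrightarrow> (\<forall>i\<in>S. (\<forall>j\<in>S. Q i j \<ge> 0) \<and> ((\<lambda>j. Q i j) has_sum 1) S)"

text \<open>
  \<open>first_passage S Q n i j\<close> is the probability that the chain with transition matrix \<open>Q\<close> started at
  \<open>i\<close> visits \<open>j\<close> at time \<open>n + 1\<close> and at none of the times \<open>1, \<dots>, n\<close>.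
\<close>
primrec first_passage :: "'a set \<Rightarrow> ('a \<Rightarrow> 'a \<Rightarrow> real) \<Rightarrow> nat \<Rightarrow> 'a \<Rightarrow> 'a \<Rightarrow> real" where
  "first_passage S Q 0 i j = Q i j"
| "first_passage S Q (Suc n) i j = (\<Sum>\<^sub>\<infinity>k\<in>S - {j}. Q i k * first_passage S Q n k j)"

text \<open>Every state is almost surely revisited, and the expected return time is finite.\<close>
definition positive_recurrent :: "'a set \<Rightarrow> ('a \<Rightarrow> 'a \<Rightarrow> real) \<Rightarrow> bool" where
  "positive_recurrent S Q \<longleftrightarrow>
     (\<forall>i\<in>S. (\<lambda>n. first_passage S Q n i i) sums 1 \<and>
            summable (\<lambda>n. real (Suc n) * first_passage S Q n i i))"

definition stationary_distribution :: "'a set \<Rightarrow> ('a \<Rightarrow> 'a \<Rightarrow> real) \<Rightarrow> ('a \<Rightarrow> real) \<Rightarrow> bool" where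
  "stationary_distribution S Q \<pi> \<longleftrightarrow>
     (\<forall>i\<in>S. \<pi> i \<ge> 0) \<and> (\<pi> has_sum 1) S \<and>
     (\<forall>i\<in>S. ((\<lambda>j. \<pi> j * Q j i) has_sum \<pi> i) S)"

definition column_sum :: "'a set \<Rightarrow> ('a \<Rightarrow> 'a \<Rightarrow> real) \<Rightarrow> 'a \<Rightarrow> real" where
  "column_sum S M j = (\<Sum>\<^sub>\<infinity>i\<in>S. M i j)"

definition backward_matrix :: "'a set \<Rightarrow> ('a \<Rightarrow> 'a \<Rightarrow> real) \<Rightarrow> 'a \<Rightarrow> 'a \<Rightarrow> real" where
  "backward_matrix S M j i = M i j / column_sum S M j"

text \<open>
  \<open>Markov(\<pi>, P)\<close> is a fair measure of the one-sided Markov shift with \<open>0\<close>-\<open>1\<close> transition matrix \<open>M\<close>.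
  Summability of the columns says that all column sums are finite.
\<close>
definition fair_Markov_measure ::
    "'a set \<Rightarrow> ('a \<Rightarrow> 'a \<Rightarrow> real) \<Rightarrow> ('a \<Rightarrow> real) \<Rightarrow> ('a \<Rightarrow> 'a \<Rightarrow> real) \<Rightarrow> bool" where
  "fair_Markov_measure S M \<pi> P \<longleftrightarrow>
     (\<forall>j\<in>S. (\<lambda>i. M i j) summable_on S) \<and>
     stochastic_matrix S (backward_matrix S M) \<and>
     positive_recurrent S (backward_matrix S M) \<and>
     stationary_distribution S (backward_matrix S M) \<pi> \<and>
     stochastic_matrix S P \<and>
     (\<forall>i\<in>S. \<forall>j\<in>S. \<pi> i * P i j = \<pi> j * backward_matrix S M j i)"


section \<open>Fair measures for interval maps\<close>

definition borel_isomorphism_on :: "(real \<Rightarrow> real) \<Rightarrow> real set \<Rightarrow> bool" where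
  "borel_isomorphism_on h Z \<longleftrightarrow>
     inj_on h Z \<and>
     h \<in> restrict_space borel Z \<rightarrow>\<^sub>M restrict_space borel (h ` Z) \<and>
     the_inv_into Z h \<in> restrict_space borel (h ` Z) \<rightarrow>\<^sub>M restrict_space borel Z"

definition image_refinement :: "(real \<Rightarrow> real) \<Rightarrow> real set set \<Rightarrow> real set set" where
  "image_refinement h \<Z> = common_refinement ((\<lambda>Z. {h ` Z, {0..1} - h ` Z}) ` \<Z>)"

definition injectivity_partition :: "(real \<Rightarrow> real) \<Rightarrow> real set set \<Rightarrow> bool" where
  "injectivity_partition h \<Z> \<longleftrightarrow>
     countable \<Z> \<and> partition_on {0..1} \<Z> \<and>
     (\<forall>Z\<in>\<Z>. Z \<in> sets borel \<and> h ` Z \<in> sets borel \<and> borel_isomorphism_on h Z) \<and>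
     countable (image_refinement h \<Z>)"

definition covering_elements :: "(real \<Rightarrow> real) \<Rightarrow> real set set \<Rightarrow> real set \<Rightarrow> real set set" where
  "covering_elements h \<Z> B = {Z \<in> \<Z>. B \<subseteq> h ` Z}"

text \<open>
  Fairness does not depend on the partition \<open>\<Z>\<close>, so it suffices to ask for one that witnesses it.
  Measurability of \<open>h\<close> as a map from \<open>\<mu>\<close> to \<open>\<mu>\<close> includes that \<open>h\<close> maps \<open>{0..1}\<close> into itself.
\<close>
definition fair_measure :: "(real \<Rightarrow> real) \<Rightarrow> real measure \<Rightarrow> bool" where
  "fair_measure h \<mu> \<longleftrightarrow>
     sets \<mu> = sets (restrict_space borel {0..1}) \<and> prob_space \<mu> \<and>
     h \<in> \<mu> \<rightarrow>\<^sub>M \<mu> \<and> distr \<mu> \<mu> h = \<mu> \<and>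
     (\<exists>\<Z>. injectivity_partition h \<Z> \<and>
        (\<forall>A\<in>image_refinement h \<Z>. \<forall>B\<in>sets borel. B \<subseteq> A \<longrightarrow>
           (\<forall>Z\<in>covering_elements h \<Z> B.
              measure \<mu> (Z \<inter> h -` B) =
                (if finite (covering_elements h \<Z> B)
                 then measure \<mu> B / real (card (covering_elements h \<Z> B)) else 0))))"

definition Lebesgue_fair :: "(real \<Rightarrow> real) \<Rightarrow> bool" where
  "Lebesgue_fair h \<longleftrightarrow> fair_measure h (restrict_space lborel {0..1})"

definition Lebesgue_fair_model :: "(real \<Rightarrow> real) \<Rightarrow> (real \<Rightarrow> real) \<Rightarrow> bool" where
  "Lebesgue_fair_model f g \<longleftrightarrow>
     g \<in> {0..1} \<rightarrow> {0..1} \<and> Lebesgue_fair g \<and>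
     (\<exists>\<phi> \<psi>. homeomorphism {0..1} {0..1} \<phi> \<psi> \<and> strict_mono_on {0..1} \<phi> \<and>
            (\<forall>t\<in>{0..1}. g (\<phi> t) = \<phi> (f t)))"


section \<open>The piecewise affine map\<close>

definition lies_left_of :: "real set \<Rightarrow> real set \<Rightarrow> bool" where
  "lies_left_of A B \<longleftrightarrow> (\<forall>a\<in>A. \<forall>b\<in>B. a < b)"

definition W_pair :: "(real \<Rightarrow> real) \<Rightarrow> real set set \<Rightarrow> real set \<Rightarrow> real set \<Rightarrow> (real set \<times> real set) set" where
  "W_pair f X i j =
     {(k, l). k \<in> partition_intervals X \<and> l \<in> partition_intervals X \<and>
              k \<inter> f -` l \<noteq> {} \<and> lies_left_of (k \<inter> f -` l) (i \<inter> f -` j)}"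

definition W_single :: "real set set \<Rightarrow> real set \<Rightarrow> real set set" where
  "W_single X j = {l \<in> partition_intervals X. lies_left_of l j}"

definition affine_onto :: "(real \<Rightarrow> real) \<Rightarrow> real \<Rightarrow> real \<Rightarrow> real \<Rightarrow> real \<Rightarrow> bool" where
  "affine_onto g x x' y y' \<longleftrightarrow>
     (\<exists>a b. \<forall>t\<in>{x<..<x'}. g t = a * t + b) \<and> g ` {x<..<x'} = {y<..<y'}"

definition piecewise_affine_map ::
    "(real \<Rightarrow> real) \<Rightarrow> real set set \<Rightarrow> (real set \<Rightarrow> real) \<Rightarrow> (real set \<Rightarrow> real set \<Rightarrow> real) \<Rightarrow>
     (real \<Rightarrow> real) \<Rightarrow> bool" where
  "piecewise_affine_map f X \<pi> P g \<longleftrightarrow>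
     g \<in> {0..1} \<rightarrow> {0..1} \<and>
     (\<forall>i\<in>X. \<forall>j\<in>X. i \<inter> f -` j \<noteq> {} \<longrightarrow>
       (let x = (\<Sum>\<^sub>\<infinity>(k, l)\<in>W_pair f X i j. \<pi> k * P k l);
            x' = x + \<pi> i * P i j;
            y = (\<Sum>\<^sub>\<infinity>l\<in>W_single X j. \<pi> l);
            y' = y + \<pi> j
        in (i \<in> partition_intervals X \<and> j \<in> partition_intervals X \<longrightarrow>
              x < x' \<and> y < y' \<and> affine_onto g x x' y y' \<and>
              (strict_mono_on i f \<longrightarrow> strict_mono_on {x<..<x'} g) \<and>
              (strict_antimono_on i f \<longrightarrow> strict_antimono_on {x<..<x'} g)) \<and>
           ((\<exists>c. j = {c}) \<longrightarrow> g x = y)))"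

end

theory Submission
  imports Defs
begin

text \<open>
  An increasing homeomorphism \<open>\<phi>\<close> conjugates \<open>f\<close> to a Lebesgue fair map if and only if it is the
  distribution function of a fair measure for \<open>f\<close>. The proof constructs this distribution function from
  a functional equation and shows that every conjugacy solves the same equation.

  Let \<open>c\<^sub>j\<close> be the number of partition intervals whose image contains \<open>j\<close>. The conjugacy has to map the
  partition interval \<open>j\<close> onto the interval \<open>J j\<close> of length \<open>\<pi> j\<close> that starts at the total mass of the
  partition intervals left of \<open>j\<close>. Fairness says that the measure of an injective piece \<open>E\<close> is obtained
  by integrating \<open>1 / c\<close> over \<open>f ` E\<close> with respect to the measure. If \<open>K\<close> is the function with \<open>K 0 = 0\<close> and slope \<open>1 / c\<^sub>j\<close> on \<open>J j\<close>,
  this yields, on a partition interval \<open>i = {a<..<b}\<close> on which \<open>f\<close> increases,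
  \<open>\<phi> t = \<phi> a + K (\<phi> (f t)) - K (\<phi> (Inf (f ` i)))\<close>, and a mirrored equation where \<open>f\<close> decreases; these
  are the maps \<open>branch i\<close>. On partition points \<open>\<phi>\<close> is known.

  Iterating the equation from the two step functions that bound every solution gives lower and upper
  bounds \<open>bound n\<close>, whose difference at \<open>t\<close> is the mass of the partition interval reached after \<open>n\<close>
  steps, divided by the product of the numbers \<open>c\<close> met on the way, and \<open>0\<close> once the orbit has met a
  partition point. This difference tends to \<open>0\<close> uniformly
  (\<open>gap_uniform\<close>): if all the numbers \<open>c\<close> along a long path ending in an interval \<open>V\<close> were \<open>1\<close>, then only
  one interval would lead to \<open>V\<close> in that many steps, against mixing. So there is exactly one solution
  (\<open>fixed_point_unique\<close>). It is strictly increasing because under a mixing map any two points are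
  eventually separated by the partition (\<open>orbits_separate\<close>), and it has no jumps because its values are
  dense (\<open>bound_dense\<close>); hence it is a homeomorphism.

  The conjugate map \<open>g = \<phi> \<circ> f \<circ> \<phi>\<^sup>-\<^sup>1\<close> has slope \<open>c\<^sub>j\<close> or \<open>- c\<^sub>j\<close> on \<open>\<phi> ` (i \<inter> f -` j)\<close>, which makes it Lebesgue
  fair (\<open>g_Lebesgue_fair\<close>). Its affine pieces are where they should be, since the pieces left of a
  given one exhaust the space below it up to countably many points (\<open>W_pair_sum\<close>).

  Conversely, let \<open>\<theta>\<close> conjugate \<open>f\<close> to any Lebesgue fair map. The lengths of the intervals \<open>\<theta> ` j\<close> form
  a stationary distribution of the backward chain, which is irreducible by mixing, so they equal \<open>\<pi> j\<close>
  (\<open>stationary_distribution_unique\<close>). Then \<open>\<theta>\<close> solves the functional equation, and \<open>\<theta> = \<phi>\<close>.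
\<close>

section \<open>Countable additivity as an unordered sum\<close>

lemma has_sum_measure_UN:
  assumes "countable I" "disjoint_family_on A I" "\<And>i. i \<in> I \<Longrightarrow> A i \<in> sets M"
    and fin: "emeasure M (\<Union>i\<in>I. A i) \<noteq> \<infinity>"
  shows "((\<lambda>i. measure M (A i)) has_sum measure M (\<Union>i\<in>I. A i)) I"
proof (cases "finite I")
  case True
  have "emeasure M (A i) \<noteq> \<infinity>" if "i \<in> I" for i
  proof -
    have "emeasure M (A i) \<le> emeasure M (\<Union>i\<in>I. A i)"
      using that assms by (intro emeasure_mono sets.countable_UN') auto
    then show ?thesis
      using fin by (auto simp: top_unique)
  qed
  then have "measure M (\<Union>i\<in>I. A i) = (\<Sum>i\<in>I. measure M (A i))"
    using True assms by (intro measure_finite_Union) auto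
  then show ?thesis
    using True by (simp add: has_sum_finite_iff)
next
  case False
  define e where "e = from_nat_into I"
  have e: "bij_betw e UNIV I"
    unfolding e_def using bij_betw_from_nat_into[OF assms(1) False] .
  then have U: "(\<Union>i\<in>I. A i) = (\<Union>n. A (e n))"
    unfolding bij_betw_def by auto
  have "(\<lambda>n. measure M (A (e n))) sums measure M (\<Union>n. A (e n))"
  proof (rule measure_UNION)
    show "range (\<lambda>n. A (e n)) \<subseteq> sets M"
      using e assms(3) by (auto simp: bij_betw_def)
    show "disjoint_family (\<lambda>n. A (e n))"
      using e assms(2) unfolding disjoint_family_on_def bij_betw_def inj_on_def by blast
    show "emeasure M (\<Union>n. A (e n)) \<noteq> \<infinity>"
      using fin U by simp
  qed
  then have "((\<lambda>n. measure M (A (e n))) has_sum measure M (\<Union>n. A (e n))) UNIV"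
    by (rule sums_nonneg_imp_has_sum) simp
  then show ?thesis
    unfolding U has_sum_reindex_bij_betw[OF e, symmetric] .
qed

lemma has_sum_measure_cover_null:
  fixes E :: "real set"
  assumes "countable I" "disjoint_family_on A I" "\<And>i. i \<in> I \<Longrightarrow> A i \<in> sets borel"
    and "E \<in> sets borel" "emeasure lborel E \<noteq> \<infinity>"
    and E: "E - (\<Union>i\<in>I. A i) \<in> null_sets lborel"
  shows "((\<lambda>i. measure lborel (E \<inter> A i)) has_sum measure lborel E) I"
proof -
  let ?U = "\<Union>i\<in>I. E \<inter> A i"
  have U: "?U \<in> sets borel"
    using assms by (intro sets.countable_UN') auto
  have "?U \<subseteq> E" "E = ?U \<union> (E - (\<Union>i\<in>I. A i))"
    by auto
  then have eq: "measure lborel E = measure lborel ?U"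
    using measure_Un_null_set[OF _ E, of ?U] U by simp
  have "emeasure lborel ?U \<le> emeasure lborel E"
    using assms by (intro emeasure_mono) auto
  then have "emeasure lborel ?U \<noteq> \<infinity>"
    using assms(5) by (auto simp: top_unique)
  moreover have "disjoint_family_on (\<lambda>i. E \<inter> A i) I"
    using assms(2) by (auto simp: disjoint_family_on_def)
  ultimately show ?thesis
    unfolding eq using assms by (intro has_sum_measure_UN) auto
qed

text \<open>
  Countable sets are null, so pieces that miss only countably many points of \<open>E\<close> still carry all of its
  length. Partition points and their preimages are discarded in this way throughout.
\<close>
lemma has_sum_measure_cover:
  fixes E :: "real set"
  assumes "countable I" "disjoint_family_on A I" "\<And>i. i \<in> I \<Longrightarrow> A i \<in> sets borel"
    and "E \<in> sets borel" "emeasure lborel E \<noteq> \<infinity>" "countable (E - (\<Union>i\<in>I. A i))"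
  shows "((\<lambda>i. measure lborel (E \<inter> A i)) has_sum measure lborel E) I"
  using assms countable_imp_null_set_lborel by (intro has_sum_measure_cover_null)

lemma emeasure_lborel_subset_unit_finite:
  fixes E :: "real set"
  assumes "E \<subseteq> {0..1}"
  shows "emeasure lborel E \<noteq> \<infinity>"
proof -
  have "emeasure lborel E \<le> emeasure lborel {0..1::real}"
    using assms by (intro emeasure_mono) auto
  then show ?thesis
    by (auto simp: top_unique)
qed

lemma summable_on_one_imp_finite:
  assumes "(\<lambda>i. if Q i then 1 else 0 :: real) summable_on S"
  shows "finite {i \<in> S. Q i}"
proof -
  have "(\<lambda>i. 1 :: real) summable_on {i \<in> S. Q i}"
    using assms by (rule summable_on_cong_neutral[THEN iffD1, rotated -1]) auto
  then show ?thesis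
    using infsum_diverge_constant[of "{i \<in> S. Q i}" "1 :: real"] by fastforce
qed

lemma has_sum_diff_real:
  fixes u v :: "'a \<Rightarrow> real"
  assumes "(u has_sum s) S" "(v has_sum t) S"
  shows "((\<lambda>i. u i - v i) has_sum s - t) S"
  using has_sum_add[OF assms(1), of "\<lambda>i. - v i" "- t"] assms(2) by (simp add: has_sum_uminus)

section \<open>Uniqueness of stationary distributions\<close>

lemma has_sum_eq_of_le:
  fixes u v :: "'a \<Rightarrow> real"
  assumes "(u has_sum s) S" "(v has_sum s) S" "\<And>i. i \<in> S \<Longrightarrow> u i \<le> v i" "i \<in> S"
  shows "u i = v i"
proof -
  have "((\<lambda>i. v i - u i) has_sum (s - s)) S"
    by (rule has_sum_diff_real[OF assms(2,1)])
  then have "v i - u i = 0"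
    using assms by (intro nonneg_has_sum_le_0D[where A = S and f = "\<lambda>i. v i - u i"]) auto
  then show ?thesis by simp
qed

lemma has_sum_le_term:
  fixes u :: "'a \<Rightarrow> real"
  assumes "(u has_sum s) S" "\<And>i. i \<in> S \<Longrightarrow> u i \<ge> 0" "i \<in> S"
  shows "u i \<le> s"
  using finite_sum_le_has_sum[OF assms(1), of "{i}"] assms by auto

text \<open>
  Stationarity at \<open>k\<close> bounds \<open>d l * Q l k\<close> by \<open>d k\<close>, so a zero spreads along the edges of the chain, and
  by irreducibility it reaches every state.
\<close>
lemma stationary_zero:
  fixes Q :: "'a \<Rightarrow> 'a \<Rightarrow> real"
  assumes Q: "\<And>i j. i \<in> S \<Longrightarrow> j \<in> S \<Longrightarrow> Q i j \<ge> 0"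
    and irr: "\<And>i j. i \<in> S \<Longrightarrow> j \<in> S \<Longrightarrow> (i, j) \<in> {(i, j). i \<in> S \<and> j \<in> S \<and> Q j i > 0}\<^sup>*"
    and d: "\<And>i. i \<in> S \<Longrightarrow> d i \<ge> 0" "\<And>i. i \<in> S \<Longrightarrow> ((\<lambda>j. d j * Q j i) has_sum d i) S"
    and "i \<in> S" "d i = 0" "j \<in> S"
  shows "d j = 0"
proof -
  have "(i, j) \<in> {(i, j). i \<in> S \<and> j \<in> S \<and> Q j i > 0}\<^sup>*"
    using assms by blast
  then show ?thesis
  proof (induction rule: rtrancl_induct)
    case base
    then show ?case by fact
  next
    case (step k l)
    then have "d l * Q l k \<le> d k"
      using d Q by (intro has_sum_le_term[OF d(2)]) auto
    with step d(1)[of l] show ?case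
      by (auto simp: mult_le_0_iff)
  qed
qed

lemma stationary_distribution_positive:
  assumes Q: "stochastic_matrix S Q"
    and irr: "\<And>i j. i \<in> S \<Longrightarrow> j \<in> S \<Longrightarrow> (i, j) \<in> {(i, j). i \<in> S \<and> j \<in> S \<and> Q j i > 0}\<^sup>*"
    and \<nu>: "stationary_distribution S Q \<nu>" and "i \<in> S"
  shows "\<nu> i > 0"
proof (rule ccontr)
  assume "\<not> \<nu> i > 0"
  then have "\<nu> i = 0"
    using \<nu> \<open>i \<in> S\<close> by (force simp: stationary_distribution_def)
  then have "\<nu> j = 0" if "j \<in> S" for j
    using Q \<nu> that \<open>i \<in> S\<close>
    by (intro stationary_zero[of S Q \<nu> i j] irr)
       (auto simp: stochastic_matrix_def stationary_distribution_def)
  then have "(\<nu> has_sum 0) S"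
    by (simp cong: has_sum_cong)
  then show False
    using \<nu> has_sum_unique[of \<nu> S 0 1] by (auto simp: stationary_distribution_def)
qed

text \<open>
  The entrywise minimum of two stationary distributions is superstationary, and since \<open>Q\<close> preserves
  the total mass it is stationary. The excess of the first distribution over the minimum is then
  stationary as well, so it is either zero or positive everywhere. In both cases one distribution
  dominates the other, and equal total mass makes them equal.
\<close>
lemma stationary_distribution_unique:
  assumes Q: "stochastic_matrix S Q"
    and irr: "\<And>i j. i \<in> S \<Longrightarrow> j \<in> S \<Longrightarrow> (i, j) \<in> {(i, j). i \<in> S \<and> j \<in> S \<and> Q j i > 0}\<^sup>*"
    and \<pi>: "stationary_distribution S Q \<pi>" and \<nu>: "stationary_distribution S Q \<nu>"
    and "i \<in> S"
  shows "\<pi> i = \<nu> i"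
proof -
  define m where "m i = min (\<pi> i) (\<nu> i)" for i
  have m0: "m i \<ge> 0" and m\<pi>: "m i \<le> \<pi> i" and m\<nu>: "m i \<le> \<nu> i" if "i \<in> S" for i
    using \<pi> \<nu> that by (auto simp: m_def stationary_distribution_def)
  have Qpos: "Q i j \<ge> 0" if "i \<in> S" "j \<in> S" for i j
    using Q that by (auto simp: stochastic_matrix_def)
  have \<pi>s: "((\<lambda>j. \<pi> j * Q j i) has_sum \<pi> i) S" and \<nu>s: "((\<lambda>j. \<nu> j * Q j i) has_sum \<nu> i) S" if "i \<in> S" for i
    using \<pi> \<nu> that by (auto simp: stationary_distribution_def)
  have \<pi>1: "(\<pi> has_sum 1) S" and \<nu>1: "(\<nu> has_sum 1) S"
    using \<pi> \<nu> by (auto simp: stationary_distribution_def)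
  define r where "r i = (\<Sum>\<^sub>\<infinity>j\<in>S. m j * Q j i)" for i
  have r: "((\<lambda>j. m j * Q j i) has_sum r i) S" if "i \<in> S" for i
    unfolding r_def using that m0 m\<pi> Qpos
    by (intro has_sum_infsum summable_on_comparison_test[OF has_sum_imp_summable[OF \<pi>s[OF that]]])
       (use that m0 m\<pi> Qpos in \<open>auto intro!: mult_right_mono\<close>)
  have r_le: "r i \<le> m i" if "i \<in> S" for i
  proof -
    have "r i \<le> \<pi> i"
      using that m\<pi> Qpos by (intro has_sum_mono[OF r[OF that] \<pi>s[OF that]]) (auto intro: mult_right_mono)
    moreover have "r i \<le> \<nu> i"
      using that m\<nu> Qpos by (intro has_sum_mono[OF r[OF that] \<nu>s[OF that]]) (auto intro: mult_right_mono)
    ultimately show ?thesis by (simp add: m_def)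
  qed
  have r0: "r i \<ge> 0" if "i \<in> S" for i
    using that m0 Qpos by (intro has_sum_nonneg[OF r[OF that]]) auto
  obtain s where m: "(m has_sum s) S"
    using summable_on_comparison_test[OF has_sum_imp_summable[OF \<pi>1], of m] m0 m\<pi>
    by (auto simp: summable_on_def)
  have Q1: "((\<lambda>i. m j * Q j i) has_sum m j) S" if "j \<in> S" for j
    using has_sum_cmult_right[of "Q j" S 1 "m j"] Q that by (auto simp: stochastic_matrix_def)
  have rows: "((\<lambda>(j, i). m j * Q j i) has_sum s) (S \<times> S)"
  proof (rule has_sum_SigmaI[OF _ m])
    show "(\<lambda>(j, i). m j * Q j i) summable_on S \<times> S"
      using Q1 m m0 Qpos
      by (intro summable_on_SigmaI[where g = m]) (auto intro: has_sum_imp_summable)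
  qed (use Q1 in auto)
  then have "((\<lambda>(i, j). m j * Q j i) has_sum s) (S \<times> S)"
    using has_sum_swap[where f = "\<lambda>(j, i). m j * Q j i" and A = S and B = S] by simp
  then have rs: "(r has_sum s) S"
    by (rule has_sum_SigmaD[where B = "\<lambda>_. S"]) (use r in auto)
  have rm: "r i = m i" if "i \<in> S" for i
    using has_sum_eq_of_le[OF rs m r_le that] .
  define d where "d i = \<pi> i - m i" for i
  have d: "((\<lambda>j. d j * Q j i) has_sum d i) S" if "i \<in> S" for i
    using has_sum_diff_real[OF \<pi>s[OF that] r[OF that]] rm[OF that]
    by (simp add: d_def left_diff_distrib)
  have d0: "d i \<ge> 0" if "i \<in> S" for i
    using m\<pi> that by (simp add: d_def)
  show ?thesis
  proof (cases "\<exists>k\<in>S. d k = 0")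
    case True
    then have "d j = 0" if "j \<in> S" for j
      using stationary_zero[OF Qpos irr d0 d] that by blast
    then have "\<pi> j \<le> \<nu> j" if "j \<in> S" for j
      using that m\<nu>[OF that] by (force simp: d_def)
    then show ?thesis
      using has_sum_eq_of_le[OF \<pi>1 \<nu>1 _ \<open>i \<in> S\<close>] by simp
  next
    case False
    then have "\<nu> j \<le> \<pi> j" if "j \<in> S" for j
      using that by (cases "\<pi> j \<le> \<nu> j") (auto simp: d_def m_def)
    then show ?thesis
      using has_sum_eq_of_le[OF \<nu>1 \<pi>1 _ \<open>i \<in> S\<close>] by simp
  qed
qed

section \<open>Real functions\<close>

text \<open>
  A jump of a monotone function would leave a gap in its range.
\<close>
lemma continuous_on_mono_dense_image:
  fixes F :: "real \<Rightarrow> real"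
  assumes mono: "mono_on {0..1} F" and range: "F ` {0..1} \<subseteq> {0..1}"
    and dense: "\<And>v e. v \<in> {0..1} \<Longrightarrow> e > 0 \<Longrightarrow> \<exists>s\<in>{0..1}. \<bar>F s - v\<bar> \<le> e"
  shows "continuous_on {0..1} F"
  unfolding continuous_on_iff
proof (intro ballI allI impI)
  fix t e :: real assume t: "t \<in> {0..1}" and e: "e > 0"
  have Ft: "F t \<in> {0..1}" using range t by blast
  have "\<exists>d>0. \<forall>x\<in>{0..1}. t - d < x \<longrightarrow> F t - e < F x"
  proof (cases "F t - e/2 < 0")
    case True
    then show ?thesis
      using range e by (intro exI[of _ 1]) (fastforce simp: image_subset_iff)
  next
    case False
    then obtain s where s: "s \<in> {0..1}" "\<bar>F s - (F t - e/2)\<bar> \<le> e/4"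
      using dense[of "F t - e/2" "e/4"] e Ft by auto
    then have "F s < F t" "F t - e < F s" using e by (auto simp: abs_if split: if_splits)
    then have "s < t"
      using mono s(1) t by (meson leD mono_onD not_le)
    then show ?thesis
      using \<open>F t - e < F s\<close> mono s(1)
      by (intro exI[of _ "t - s"] conjI ballI impI) (auto intro: less_le_trans[OF _ mono_onD])
  qed
  then obtain d1 where d1: "d1 > 0" "\<And>x. x \<in> {0..1} \<Longrightarrow> t - d1 < x \<Longrightarrow> F t - e < F x" by auto
  have "\<exists>d>0. \<forall>x\<in>{0..1}. x < t + d \<longrightarrow> F x < F t + e"
  proof (cases "F t + e/2 > 1")
    case True
    then show ?thesis
      using range e by (intro exI[of _ 1]) (fastforce simp: image_subset_iff)
  next
    case False
    then obtain s where s: "s \<in> {0..1}" "\<bar>F s - (F t + e/2)\<bar> \<le> e/4"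
      using dense[of "F t + e/2" "e/4"] e Ft by auto
    then have "F t < F s" "F s < F t + e" using e by (auto simp: abs_if split: if_splits)
    then have "t < s"
      using mono s(1) t by (meson leD mono_onD not_le)
    then show ?thesis
      using \<open>F s < F t + e\<close> mono s(1)
      by (intro exI[of _ "s - t"] conjI ballI impI) (auto intro: le_less_trans[OF mono_onD[of _ _ _ s]])
  qed
  then obtain d2 where d2: "d2 > 0" "\<And>x. x \<in> {0..1} \<Longrightarrow> x < t + d2 \<Longrightarrow> F x < F t + e" by auto
  show "\<exists>d>0. \<forall>x\<in>{0..1}. dist x t < d \<longrightarrow> dist (F x) (F t) < e"
  proof (intro exI conjI ballI impI)
    show "min d1 d2 > 0" using d1 d2 by simp
    fix x assume "x \<in> {0..1}" "dist x t < min d1 d2"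
    then show "dist (F x) (F t) < e"
      using d1(2)[of x] d2(2)[of x] by (auto simp: dist_real_def abs_less_iff)
  qed
qed

text \<open>
  The image is an interval by continuity, and by strict monotonicity it contains neither its infimum
  nor its supremum.
\<close>
lemma open_interval_image:
  fixes F :: "real \<Rightarrow> real"
  assumes "continuous_on {a<..<b} F" "strict_mono_on {a<..<b} F \<or> strict_antimono_on {a<..<b} F"
    and "a < b" "bounded (F ` {a<..<b})"
  shows "F ` {a<..<b} = {Inf (F ` {a<..<b})<..<Sup (F ` {a<..<b})}"
proof -
  let ?S = "F ` {a<..<b}"
  have ne: "?S \<noteq> {}" and bdd: "bdd_above ?S" "bdd_below ?S"
    using assms(3,4) bounded_imp_bdd_above bounded_imp_bdd_below by auto
  have less: "\<exists>z\<in>?S. z < y" and greater: "\<exists>z\<in>?S. y < z" if "y \<in> ?S" for y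
  proof -
    obtain x where x: "y = F x" "a < x" "x < b" using \<open>y \<in> ?S\<close> by auto
    obtain p q where pq: "a < p" "p < x" "x < q" "q < b"
      using dense x by meson
    then have "F p < F x \<and> F x < F q \<or> F q < F x \<and> F x < F p"
      using assms(2) x by (auto simp: monotone_on_def)
    then show "\<exists>z\<in>?S. z < y" "\<exists>z\<in>?S. y < z"
      using pq x by (metis greaterThanLessThan_iff imageI order.strict_trans)+
  qed
  have "is_interval ?S"
    using assms(1) by (intro is_interval_connected_1[THEN iffD2] connected_continuous_image) auto
  show ?thesis
  proof (rule set_eqI, rule iffI)
    fix y assume y: "y \<in> ?S"
    then show "y \<in> {Inf ?S<..<Sup ?S}"
      using less[OF y] greater[OF y] bdd
      by (auto intro: le_less_trans[OF cInf_lower] less_le_trans[OF _ cSup_upper])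
  next
    fix y assume "y \<in> {Inf ?S<..<Sup ?S}"
    then obtain u v where "u \<in> ?S" "u < y" "v \<in> ?S" "y < v"
      using less_cSup_iff[OF ne bdd(1)] cInf_less_iff[OF ne bdd(2)] by auto
    then show "y \<in> ?S"
      using \<open>is_interval ?S\<close> unfolding is_interval_1 by (meson less_imp_le)
  qed
qed

section \<open>Geometry of the Markov partition\<close>

locale fair_Markov_map =
  fixes f :: "real \<Rightarrow> real" and X :: "real set set"
    and \<pi> :: "real set \<Rightarrow> real" and P :: "real set \<Rightarrow> real set \<Rightarrow> real"
  assumes Markov: "countably_Markov_mixing f X"
    and fair: "fair_Markov_measure (partition_intervals X) (transition_matrix f) \<pi> P"
begin

abbreviation \<I> :: "real set set" where "\<I> \<equiv> partition_intervals X"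
abbreviation C :: "real set" where "C \<equiv> partition_points X"

lemma Markov_conditions:
  shows "f \<in> {0..1} \<rightarrow> {0..1}" "countable X" "partition_on {0..1} X"
    "\<forall>A\<in>X. (\<exists>a b. a < b \<and> A = {a<..<b}) \<or> (\<exists>x. A = {x})"
    "\<forall>i\<in>\<I>. continuous_on i f \<and> (strict_mono_on i f \<or> strict_antimono_on i f)"
    "\<forall>i\<in>\<I>. \<forall>j\<in>\<I>. j \<subseteq> f ` i \<or> f ` i \<inter> j = {}"
    "f ` C \<subseteq> C" "mixing_map f"
  using Markov unfolding countably_Markov_mixing_def by - (elim conjE, assumption)+

lemma f_unit: "t \<in> {0..1} \<Longrightarrow> f t \<in> {0..1}"
  using Markov_conditions(1) by blast

lemma funpow_unit: "t \<in> {0..1} \<Longrightarrow> (f ^^ n) t \<in> {0..1}"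
proof (induction n)
  case (Suc n)
  then show ?case using f_unit[of "(f ^^ n) t"] by simp
qed simp

lemma f_C: "c \<in> C \<Longrightarrow> f c \<in> C"
  using Markov_conditions(7) by blast

lemma funpow_C: "c \<in> C \<Longrightarrow> (f ^^ n) c \<in> C"
  by (induction n) (use f_C in auto)

lemma mixing: "mixing_map f"
  using Markov_conditions(8) by blast

lemma partition_X: "partition_on {0..1} X"
  using Markov_conditions(3) by blast

lemma countable_X: "countable X"
  using Markov_conditions(2) by blast

lemma countable_\<I>: "countable \<I>"
  by (rule countable_subset[OF _ countable_X]) (auto simp: partition_intervals_def)

lemma countable_C: "countable C"
proof -
  have "(\<lambda>x. {x}) ` C \<subseteq> X"
    by (auto simp: partition_points_def)
  then have "countable ((\<lambda>x. {x}) ` C)"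
    by (rule countable_subset[OF _ countable_X])
  then show ?thesis
    by (rule countable_image_inj_on) simp
qed

lemma \<I>_X: "i \<in> \<I> \<Longrightarrow> i \<in> X"
  by (simp add: partition_intervals_def)

lemma C_X: "c \<in> C \<longleftrightarrow> {c} \<in> X"
  by (simp add: partition_points_def)

lemma X_cases: "A \<in> X \<Longrightarrow> A \<in> \<I> \<or> (\<exists>c\<in>C. A = {c})"
  using Markov_conditions(4) unfolding partition_intervals_def partition_points_def by blast

lemma X_unique: "A \<in> X \<Longrightarrow> B \<in> X \<Longrightarrow> x \<in> A \<Longrightarrow> x \<in> B \<Longrightarrow> A = B"
  using partition_onD2[OF partition_X] by (auto simp: disjoint_def)

lemma \<I>_unique: "i \<in> \<I> \<Longrightarrow> j \<in> \<I> \<Longrightarrow> x \<in> i \<Longrightarrow> x \<in> j \<Longrightarrow> i = j"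
  using X_unique \<I>_X by blast

lemma \<I>_unit: "i \<in> \<I> \<Longrightarrow> t \<in> i \<Longrightarrow> t \<in> {0..1}"
  using partition_onD1[OF partition_X] \<I>_X by blast

lemma C_unit: "c \<in> C \<Longrightarrow> c \<in> {0..1}"
  using partition_onD1[OF partition_X] C_X by blast

lemma not_singleton_interval: "a < b \<Longrightarrow> {a<..<b} \<noteq> {c :: real}"
  using infinite_Ioo[of a b] by fastforce

lemma \<I>_not_C: "i \<in> \<I> \<Longrightarrow> t \<in> i \<Longrightarrow> t \<notin> C"
proof
  assume "i \<in> \<I>" "t \<in> i" "t \<in> C"
  then have "i = {t}"
    using X_unique[of i "{t}" t] \<I>_X C_X by blast
  then show False
    using \<open>i \<in> \<I>\<close> not_singleton_interval unfolding partition_intervals_def by blast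
qed

lemma unit_cases: "t \<in> {0..1} \<Longrightarrow> t \<in> C \<or> (\<exists>i\<in>\<I>. t \<in> i)"
  using partition_onD1[OF partition_X] X_cases by blast

lemma \<I>_endpoints:
  assumes "i \<in> \<I>"
  obtains a b where "i = {a<..<b}" "a < b" "a \<in> C" "b \<in> C"
proof -
  obtain a b where ab: "i = {a<..<b}" "a < b"
    using assms by (auto simp: partition_intervals_def)
  have "closure i \<subseteq> {0..1}"
    using \<I>_unit[OF assms] by (intro closure_minimal) auto
  then have 01: "a \<in> {0..1}" "b \<in> {0..1}"
    using ab by auto
  have aux: "x \<in> C" if x: "x \<in> {0..1}" "x \<in> closure i" "x \<notin> i" for x
  proof (rule ccontr)
    assume "x \<notin> C"
    then obtain j where j: "j \<in> \<I>" "x \<in> j"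
      using unit_cases x(1) by blast
    then have "open j"
      by (auto simp: partition_intervals_def)
    then have "j \<inter> i \<noteq> {}"
      using j x(2) by (auto simp: closure_iff_nhds_not_empty)
    then show False
      using \<I>_unique[OF j(1) assms] j(2) x(3) by blast
  qed
  show thesis
    using ab 01 aux[of a] aux[of b] by (intro that[of a b]) auto
qed

lemma \<I>_convex: "i \<in> \<I> \<Longrightarrow> a \<in> i \<Longrightarrow> b \<in> i \<Longrightarrow> a \<le> x \<Longrightarrow> x \<le> b \<Longrightarrow> x \<in> i"
  by (auto simp: partition_intervals_def)

lemma \<I>_segment: "i \<in> \<I> \<Longrightarrow> a \<in> i \<Longrightarrow> b \<in> i \<Longrightarrow> x \<in> closed_segment a b \<Longrightarrow> x \<in> i"
  using \<I>_convex[of i a b x] \<I>_convex[of i b a x]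
  by (cases "a \<le> b") (auto simp: closed_segment_eq_real_ivl)

lemma \<I>_open: "i \<in> \<I> \<Longrightarrow> open i"
  by (auto simp: partition_intervals_def)

lemma \<I>_nonempty: "i \<in> \<I> \<Longrightarrow> \<exists>x. x \<in> i"
  by (auto simp: partition_intervals_def intro: dense)

lemma zero_C: "0 \<in> C" and one_C: "1 \<in> C"
proof -
  have "t \<in> C" if t: "t = 0 \<or> t = 1" for t
  proof (rule ccontr)
    assume "t \<notin> C"
    then obtain i where i: "i \<in> \<I>" "t \<in> i"
      using unit_cases[of t] t by auto
    then obtain a b where "i = {a<..<b}" "a \<in> C" "b \<in> C"
      using \<I>_endpoints by metis
    then show False
      using i(2) t C_unit[of a] C_unit[of b] by auto
  qed
  then show "0 \<in> C" "1 \<in> C" by auto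
qed

lemma \<I>_exists: "\<exists>i. i \<in> \<I>"
proof (rule ccontr)
  assume "\<nexists>i. i \<in> \<I>"
  then have "{0..1} \<subseteq> C"
    using unit_cases by auto
  then have "countable {0..1::real}"
    using countable_C countable_subset by blast
  then show False
    using uncountable_closed_interval[of 0 "1::real"] by simp
qed

definition increasing :: "real set \<Rightarrow> bool" where
  "increasing i \<longleftrightarrow> strict_mono_on i f"

lemma f_cont: "i \<in> \<I> \<Longrightarrow> continuous_on i f"
  and f_mono_cases: "i \<in> \<I> \<Longrightarrow> strict_mono_on i f \<or> strict_antimono_on i f"
  using Markov_conditions(5) by blast+

lemma increasing_less: "i \<in> \<I> \<Longrightarrow> increasing i \<Longrightarrow> s \<in> i \<Longrightarrow> t \<in> i \<Longrightarrow> f s < f t \<longleftrightarrow> s < t"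
  unfolding increasing_def by (rule strict_mono_on_less)

lemma not_increasing_less:
  assumes "i \<in> \<I>" "\<not> increasing i" "s \<in> i" "t \<in> i"
  shows "f s < f t \<longleftrightarrow> t < s"
proof -
  have "strict_antimono_on i f"
    using f_mono_cases[OF assms(1)] assms(2) unfolding increasing_def by blast
  then have "\<And>x y. x \<in> i \<Longrightarrow> y \<in> i \<Longrightarrow> x < y \<Longrightarrow> f y < f x"
    by (simp add: monotone_on_def)
  from this[of s t] this[of t s] show ?thesis
    using assms(3,4) by (cases s t rule: linorder_cases) auto
qed

lemma f_inj:
  assumes "i \<in> \<I>"
  shows "inj_on f i"
proof (rule inj_onI, rule ccontr)
  fix s t assume st: "s \<in> i" "t \<in> i" "f s = f t" "s \<noteq> t"
  have "f s < f t \<or> f t < f s"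
    using increasing_less[OF assms _ st(1,2)] increasing_less[OF assms _ st(2,1)]
      not_increasing_less[OF assms _ st(1,2)] not_increasing_less[OF assms _ st(2,1)] st(4)
    by (meson linorder_neqE)
  then show False
    using st(3) by simp
qed

definition lo :: "real set \<Rightarrow> real" where "lo i = Inf (f ` i)"
definition hi :: "real set \<Rightarrow> real" where "hi i = Sup (f ` i)"

lemma image_Markov: "i \<in> \<I> \<Longrightarrow> l \<in> \<I> \<Longrightarrow> x \<in> l \<Longrightarrow> x \<in> f ` i \<Longrightarrow> l \<subseteq> f ` i"
  using Markov_conditions(6)[THEN bspec, THEN bspec, of i l] by blast

lemma image_interval:
  assumes "i \<in> \<I>"
  shows "f ` i = {lo i<..<hi i}"
proof -
  obtain a b where ab: "i = {a<..<b}" "a < b"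
    using assms by (auto simp: partition_intervals_def)
  have "f ` i \<subseteq> {0..1}"
    using f_unit \<I>_unit[OF assms] by blast
  then have "bounded (f ` i)"
    by (rule bounded_subset[OF bounded_closed_interval])
  then show ?thesis
    using f_cont[OF assms] f_mono_cases[OF assms] ab(2)
    unfolding lo_def hi_def ab(1) by (intro open_interval_image)
qed

lemma lo_less_hi: "i \<in> \<I> \<Longrightarrow> lo i < hi i"
proof -
  assume i: "i \<in> \<I>"
  obtain x where "x \<in> i"
    using \<I>_nonempty[OF i] by blast
  then have "f x \<in> {lo i<..<hi i}"
    using image_interval[OF i] by blast
  then show ?thesis by simp
qed

text \<open>
  An end of \<open>f ` i\<close> inside a partition interval \<open>j\<close> would make \<open>j\<close> meet \<open>f ` i\<close>, hence lie in it by the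
  Markov property; but the open interval \<open>f ` i\<close> omits its ends.
\<close>
lemma lo_C: "i \<in> \<I> \<Longrightarrow> lo i \<in> C" and hi_C: "i \<in> \<I> \<Longrightarrow> hi i \<in> C"
proof -
  have *: "x \<in> C" if i: "i \<in> \<I>" and x: "x = lo i \<or> x = hi i" for x
  proof (rule ccontr)
    assume "x \<notin> C"
    have "f ` i \<subseteq> {0..1}"
      using f_unit \<I>_unit[OF i] by blast
    then have "closure (f ` i) \<subseteq> {0..1}"
      by (intro closure_minimal) auto
    moreover have cl: "x \<in> closure (f ` i)"
      using x image_interval[OF i] lo_less_hi[OF i] by auto
    ultimately obtain j where j: "j \<in> \<I>" "x \<in> j"
      using unit_cases \<open>x \<notin> C\<close> by blast
    then have "j \<inter> f ` i \<noteq> {}"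
      using cl \<I>_open[OF j(1)] by (auto simp: closure_iff_nhds_not_empty)
    then have "x \<in> f ` i"
      using image_Markov[OF i j(1)] j(2) by blast
    then show False
      using x image_interval[OF i] by auto
  qed
  show "i \<in> \<I> \<Longrightarrow> lo i \<in> C" "i \<in> \<I> \<Longrightarrow> hi i \<in> C"
    by (rule *; simp)+
qed

definition cell :: "real \<Rightarrow> real set" where
  "cell t = (THE i. i \<in> \<I> \<and> t \<in> i)"

lemma cell_eq: "i \<in> \<I> \<Longrightarrow> t \<in> i \<Longrightarrow> cell t = i"
  unfolding cell_def by (rule the_equality) (simp, meson \<I>_unique)

lemma cell_\<I>: "t \<in> {0..1} \<Longrightarrow> t \<notin> C \<Longrightarrow> cell t \<in> \<I>"
  and in_cell: "t \<in> {0..1} \<Longrightarrow> t \<notin> C \<Longrightarrow> t \<in> cell t"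
  using unit_cases cell_eq by metis+

lemma countable_preimage:
  assumes "countable A"
  shows "countable {t \<in> {0..1}. f t \<in> A}"
proof -
  have "countable (i \<inter> f -` A)" if "i \<in> \<I>" for i
  proof -
    have "countable (f ` (i \<inter> f -` A))"
      by (rule countable_subset[OF _ assms]) auto
    moreover have "inj_on f (i \<inter> f -` A)"
      using f_inj[OF that] by (rule inj_on_subset) auto
    ultimately show ?thesis
      by (rule countable_image_inj_on)
  qed
  then have "countable (C \<union> (\<Union>i\<in>\<I>. i \<inter> f -` A))"
    using countable_C countable_\<I> by blast
  then show ?thesis
    by (rule countable_subset[rotated]) (use unit_cases in blast)
qed

lemma countable_preimage_C: "countable {t \<in> {0..1}. (f ^^ n) t \<in> C}"
proof (induction n)
  case 0
  show ?case using countable_C by (rule countable_subset[rotated]) auto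
next
  case (Suc n)
  have "{t \<in> {0..1}. (f ^^ Suc n) t \<in> C} = {t \<in> {0..1}. f t \<in> {t \<in> {0..1}. (f ^^ n) t \<in> C}}"
    using f_unit by (auto simp: funpow_Suc_right simp del: funpow.simps)
  then show ?case
    using countable_preimage[OF Suc] by simp
qed

section \<open>Consequences of mixing\<close>

text \<open>
  If there were only one partition interval, then it would be \<open>{0<..<1}\<close>, and \<open>f\<close> would be a monotone
  map of it into itself. The increasing map \<open>f \<circ> f\<close> would leave one of the two halves invariant.
\<close>
lemma two_intervals: "\<exists>i\<in>\<I>. \<exists>j\<in>\<I>. i \<noteq> j"
proof (rule ccontr)
  assume "\<not> ?thesis"
  then obtain i where I: "\<I> = {i}"
    using \<I>_exists by blast
  then have i: "i \<in> \<I>" by simp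
  then obtain a b where ab: "i = {a<..<b}" "a < b" "a \<in> C" "b \<in> C"
    by (rule \<I>_endpoints)
  have small: "\<not> {u<..<v} \<subseteq> C" if "u < v" for u v
    using countable_C that uncountable_open_interval countable_subset by metis
  have out: "t \<in> C" if "t \<in> {0..1}" "t \<le> a \<or> b \<le> t" for t
    using unit_cases[OF that(1)] that(2) I ab(1) by auto
  have "{0..a} \<subseteq> C" "{b..1} \<subseteq> C"
    using out C_unit[OF ab(3)] C_unit[OF ab(4)] by auto
  then have "a = 0" "b = 1"
    using small[of 0 a] small[of b 1] C_unit[OF ab(3)] C_unit[OF ab(4)] by fastforce+
  then have i01: "i = {0<..<1}"
    using ab by simp
  have into: "f t \<in> i" if "t \<in> i" for t
  proof -
    have "f t \<in> {lo i<..<hi i}"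
      using image_interval[OF i] that by blast
    then show ?thesis
      using C_unit[OF lo_C[OF i]] C_unit[OF hi_C[OF i]] i01 by auto
  qed
  define h where "h = f ^^ 2"
  have h: "h t = f (f t)" for t
    by (simp add: h_def numeral_2_eq_2)
  have h_into: "h t \<in> i" if "t \<in> i" for t
    using into that by (simp add: h)
  have h_less: "h s < h t" if "s \<in> i" "t \<in> i" "s < t" for s t
    using that into increasing_less[OF i] not_increasing_less[OF i]
    by (cases "increasing i") (auto simp: h)
  have hn: "f ^^ (2 * n) = h ^^ n" for n
    by (simp add: h_def funpow_mult mult.commute)
  let ?L = "{0<..<1/2::real}" and ?R = "{1/2<..<1::real}"
  have op: "openin (top_of_set {0..1}) ?L" "openin (top_of_set {0..1}) ?R" "?L \<noteq> {}" "?R \<noteq> {}"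
    by (auto intro!: open_subset)
  have False if UV: "openin (top_of_set {0..1}) U" "openin (top_of_set {0..1}) V" "U \<noteq> {}" "V \<noteq> {}" "U \<inter> V = {}"
    and inv: "h ` U \<subseteq> U" for U V
  proof -
    have "(h ^^ n) ` U \<subseteq> U" for n
      using inv by (induction n) auto
    then have "(f ^^ (2 * n)) ` U \<inter> V = {}" for n
      using UV(5) hn by fastforce
    moreover obtain N where "\<forall>n\<ge>N. (f ^^ n) ` U \<inter> V \<noteq> {}"
      using mixing UV unfolding mixing_map_def by blast
    ultimately show False
      by (metis le_add2 mult_2)
  qed
  note * = this
  show False
  proof (cases "h (1/2) \<le> 1/2")
    case True
    have "h ` ?L \<subseteq> ?L"
    proof (rule image_subsetI)
      fix x assume "x \<in> ?L"
      then show "h x \<in> ?L"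
        using True h_less[of x "1/2"] h_into[of x] i01 by auto
    qed
    then show False
      using *[of ?L ?R] op by auto
  next
    case False
    have "h ` ?R \<subseteq> ?R"
    proof (rule image_subsetI)
      fix x assume "x \<in> ?R"
      then show "h x \<in> ?R"
        using False h_less[of "1/2" x] h_into[of x] i01 by auto
    qed
    then show False
      using *[of ?R ?L] op by auto
  qed
qed

lemma \<I>_openin: "i \<in> \<I> \<Longrightarrow> openin (top_of_set {0..1}) i"
  using \<I>_open \<I>_unit by (intro open_subset) auto

lemma mixing_interval:
  assumes "openin (top_of_set {0..1}) U" "U \<noteq> {}" "j \<in> \<I>"
  shows "\<exists>N. \<forall>n\<ge>N. \<exists>x\<in>U. (f ^^ n) x \<in> j"
proof -
  obtain N where "\<forall>n\<ge>N. (f ^^ n) ` U \<inter> j \<noteq> {}"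
    using mixing assms \<I>_openin[OF assms(3)] \<I>_nonempty[OF assms(3)] unfolding mixing_map_def by blast
  then show ?thesis
    by (intro exI[of _ N]) blast
qed

text \<open>
  Two points whose orbits always lie in a common partition interval bound an interval on which every
  iterate is monotone with values in one partition interval. Mixing excludes this, as every large
  iterate has to meet two partition intervals.
\<close>
lemma orbits_separate:
  assumes "s \<in> {0..1}" "t \<in> {0..1}" "s < t"
  shows "\<exists>k. \<forall>i\<in>\<I>. \<not> ((f ^^ k) s \<in> i \<and> (f ^^ k) t \<in> i)"
proof (rule ccontr)
  assume "\<not> ?thesis"
  then obtain c where c: "\<And>k. c k \<in> \<I> \<and> (f ^^ k) s \<in> c k \<and> (f ^^ k) t \<in> c k"
    by metis
  have btw: "(f ^^ k) x \<in> closed_segment ((f ^^ k) s) ((f ^^ k) t)" if x: "x \<in> {s..t}" for x k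
  proof (induction k)
    case 0
    then show ?case using x assms by (simp add: closed_segment_eq_real_ivl)
  next
    case (Suc k)
    let ?x = "(f ^^ k) x" and ?s = "(f ^^ k) s" and ?t = "(f ^^ k) t"
    have xc: "?x \<in> c k"
      using Suc c[of k] \<I>_segment by blast
    have le: "f u \<le> f v \<longleftrightarrow> (if increasing (c k) then u \<le> v else v \<le> u)" if "u \<in> c k" "v \<in> c k" for u v
      using that c[of k] increasing_less[of "c k" v u] not_increasing_less[of "c k" v u] by auto
    show ?case
    proof (cases "increasing (c k)")
      case True
      then show ?thesis
        using Suc le[OF xc, of ?s] le[OF xc, of ?t] le[OF _ xc, of ?s] le[OF _ xc, of ?t] c[of k]
        unfolding closed_segment_eq_real_ivl by (cases "?s \<le> ?t"; cases "f ?s \<le> f ?t") auto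
    next
      case False
      then show ?thesis
        using Suc le[OF xc, of ?s] le[OF xc, of ?t] le[OF _ xc, of ?s] le[OF _ xc, of ?t] c[of k]
        unfolding closed_segment_eq_real_ivl by (cases "?s \<le> ?t"; cases "f ?s \<le> f ?t") auto
    qed
  qed
  have in_c: "(f ^^ k) x \<in> c k" if "x \<in> {s..t}" for x k
    using btw[OF that, of k] c[of k] \<I>_segment by blast
  let ?U = "{s<..<t}"
  have U: "openin (top_of_set {0..1}) ?U" "?U \<noteq> {}"
    using assms by (auto intro!: open_subset)
  obtain i j where ij: "i \<in> \<I>" "j \<in> \<I>" "i \<noteq> j"
    using two_intervals by blast
  obtain N1 N2 where N: "\<forall>n\<ge>N1. \<exists>x\<in>?U. (f ^^ n) x \<in> i" "\<forall>n\<ge>N2. \<exists>x\<in>?U. (f ^^ n) x \<in> j"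
    using mixing_interval[OF U] ij by meson
  obtain x y where xy: "x \<in> ?U" "(f ^^ (N1 + N2)) x \<in> i" "y \<in> ?U" "(f ^^ (N1 + N2)) y \<in> j"
    using N by (meson le_add1 le_add2)
  have "(f ^^ (N1 + N2)) x \<in> c (N1 + N2)" "(f ^^ (N1 + N2)) y \<in> c (N1 + N2)"
    using in_c[of x "N1 + N2"] in_c[of y "N1 + N2"] xy(1,3) by simp_all
  then have "c (N1 + N2) = i" "c (N1 + N2) = j"
    using xy(2,4) c[of "N1 + N2"] \<I>_unique ij(1,2) by blast+
  then show False
    using ij by simp
qed

section \<open>The backward chain\<close>

definition preds :: "real set \<Rightarrow> real set set" where
  "preds j = {i \<in> \<I>. j \<subseteq> f ` i}"

abbreviation "M \<equiv> transition_matrix f"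
abbreviation "Q \<equiv> backward_matrix \<I> M"

lemma finite_preds: "j \<in> \<I> \<Longrightarrow> finite (preds j)"
  using fair summable_on_one_imp_finite[of "\<lambda>i. j \<subseteq> f ` i" \<I>]
  by (auto simp: fair_Markov_measure_def transition_matrix_def preds_def)

lemma column_sum_eq: "j \<in> \<I> \<Longrightarrow> column_sum \<I> M j = real (card (preds j))"
proof -
  assume "j \<in> \<I>"
  have "column_sum \<I> M j = (\<Sum>\<^sub>\<infinity>i\<in>preds j. 1)"
    unfolding column_sum_def by (rule infsum_cong_neutral) (auto simp: transition_matrix_def preds_def)
  then show ?thesis
    by simp
qed

lemma Q_eq: "j \<in> \<I> \<Longrightarrow> i \<in> \<I> \<Longrightarrow> Q j i = (if j \<subseteq> f ` i then 1 / card (preds j) else 0)"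
  by (simp add: backward_matrix_def column_sum_eq transition_matrix_def)

lemma Q_stochastic: "stochastic_matrix \<I> Q"
  and \<pi>_stationary: "stationary_distribution \<I> Q \<pi>"
  using fair unfolding fair_Markov_measure_def by blast+

lemma card_preds: "j \<in> \<I> \<Longrightarrow> card (preds j) \<ge> 1"
proof (rule ccontr)
  assume j: "j \<in> \<I>" and "\<not> card (preds j) \<ge> 1"
  then have "card (preds j) = 0" by simp
  then have "Q j i = 0" if "i \<in> \<I>" for i
    using Q_eq[OF j that] by simp
  then have "((\<lambda>i. Q j i) has_sum 0) \<I>"
    by (rule has_sum_0)
  then show False
    using Q_stochastic j has_sum_unique[of "Q j" \<I> 0 1] by (auto simp: stochastic_matrix_def)
qed

text \<open>
  Since \<open>f\<close> maps \<open>C\<close> into \<open>C\<close>, an orbit outside \<open>C\<close> at some time was outside \<open>C\<close> before. Its cells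
  therefore form a path in the transition graph.
\<close>
lemma orbit_step:
  assumes "t \<in> {0..1}" "f t \<notin> C"
  shows "t \<notin> C" "f t \<in> {0..1}" "cell t \<in> \<I>" "cell (f t) \<in> \<I>" "t \<in> cell t" "f t \<in> cell (f t)"
    "cell (f t) \<subseteq> f ` cell t" "cell t \<in> preds (cell (f t))"
proof -
  show t: "t \<notin> C" and ft: "f t \<in> {0..1}"
    using assms f_C f_unit by auto
  show c: "cell t \<in> \<I>" "cell (f t) \<in> \<I>" and i: "t \<in> cell t" "f t \<in> cell (f t)"
    using t ft assms cell_\<I> in_cell by auto
  show "cell (f t) \<subseteq> f ` cell t"
    using image_Markov[OF c, of "f t"] i by auto
  then show "cell t \<in> preds (cell (f t))"
    using c by (simp add: preds_def)
qed

lemma funpow_C_mono: "(f ^^ k) t \<in> C \<Longrightarrow> k \<le> n \<Longrightarrow> (f ^^ n) t \<in> C"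
  using funpow_C[of "(f ^^ k) t" "n - k"] by (metis comp_apply funpow_add le_add_diff_inverse2)

text \<open>
  Mixing provides an orbit from \<open>i\<close> to \<open>j\<close>, whose cells form a path of positive transition probabilities
  of the backward chain, read from its end.
\<close>
lemma irreducible:
  assumes "i \<in> \<I>" "j \<in> \<I>"
  shows "(i, j) \<in> {(i, j). i \<in> \<I> \<and> j \<in> \<I> \<and> Q j i > 0}\<^sup>*"
proof -
  obtain n x where x: "x \<in> i" "(f ^^ n) x \<in> j"
    using mixing_interval[OF \<I>_openin[OF assms(1)] _ assms(2)] \<I>_nonempty[OF assms(1)] by blast
  have x01: "x \<in> {0..1}" using \<I>_unit assms(1) x(1) .
  have "(cell x, cell ((f ^^ n) x)) \<in> {(i, j). i \<in> \<I> \<and> j \<in> \<I> \<and> Q j i > 0}\<^sup>*" if "(f ^^ n) x \<notin> C"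
    using that
  proof (induction n)
    case (Suc n)
    let ?t = "(f ^^ n) x"
    have *: "?t \<in> {0..1}" "f ?t \<notin> C"
      using funpow_unit[OF x01, of n] Suc.prems by auto
    have "Q (cell (f ?t)) (cell ?t) > 0"
      using orbit_step[OF *] card_preds[of "cell (f ?t)"] by (auto simp: Q_eq)
    moreover have "?t \<notin> C"
      using orbit_step(1)[OF *] .
    ultimately show ?case
      using Suc.IH orbit_step(3,4)[OF *] by (auto intro: rtrancl_into_rtrancl)
  qed simp
  then show ?thesis
    using x assms \<I>_not_C cell_eq by auto
qed

lemma \<pi>_pos: "i \<in> \<I> \<Longrightarrow> \<pi> i > 0"
  using stationary_distribution_positive[OF Q_stochastic irreducible \<pi>_stationary] .

lemma \<pi>_sum: "(\<pi> has_sum 1) \<I>"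
  using \<pi>_stationary by (simp add: stationary_distribution_def)

lemma \<pi>_summable: "S \<subseteq> \<I> \<Longrightarrow> \<pi> summable_on S"
  using summable_on_subset_banach[OF has_sum_imp_summable[OF \<pi>_sum]] .

lemma \<pi>_flow: "i \<in> \<I> \<Longrightarrow> ((\<lambda>l. \<pi> l / card (preds l)) has_sum \<pi> i) {l \<in> \<I>. l \<subseteq> f ` i}"
proof -
  assume i: "i \<in> \<I>"
  then have "((\<lambda>l. \<pi> l * Q l i) has_sum \<pi> i) \<I>"
    using \<pi>_stationary by (simp add: stationary_distribution_def)
  then show ?thesis
    by (rule has_sum_cong_neutral[THEN iffD1, rotated -1]) (auto simp: Q_eq i)
qed

section \<open>The target intervals\<close>

text \<open>
  The mass to the left of a set: the position of its image under the conjugacy. For points this is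
  \<open>lower\<close>, which is a lower bound for the conjugacy, while \<open>lower t + mass t\<close> is an upper bound. The two
  agree on \<open>C\<close>, and on a partition interval \<open>l\<close> they are the ends of \<open>J l\<close>.
\<close>
definition left :: "real set \<Rightarrow> real" where
  "left A = (\<Sum>\<^sub>\<infinity>l\<in>W_single X A. \<pi> l)"

definition lower :: "real \<Rightarrow> real" where
  "lower t = left {t}"

definition mass :: "real \<Rightarrow> real" where
  "mass t = (if t \<in> C then 0 else \<pi> (cell t))"

definition J :: "real set \<Rightarrow> real set" where
  "J l = {left l<..<left l + \<pi> l}"

lemma W_single_\<I>: "W_single X A \<subseteq> \<I>"
  by (auto simp: W_single_def)

lemma W_single_point: "W_single X {t} = {l \<in> \<I>. \<forall>a\<in>l. a < t}"
  by (auto simp: W_single_def lies_left_of_def)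

lemma left_eq_lower:
  assumes l: "l \<in> \<I>" and t: "t \<in> l"
  shows "left l = lower t"
proof -
  have "lies_left_of k l \<longleftrightarrow> (\<forall>a\<in>k. a < t)" if k: "k \<in> \<I>" for k
  proof
    assume *: "\<forall>a\<in>k. a < t"
    show "lies_left_of k l"
      unfolding lies_left_of_def
    proof (intro ballI, rule ccontr)
      fix a b assume ab: "a \<in> k" "b \<in> l" "\<not> a < b"
      then have "a \<in> l"
        using * \<I>_convex[OF l ab(2) t, of a] by auto
      then have "k = l"
        using \<I>_unique k l ab(1) by blast
      then show False using * t by blast
    qed
  qed (use t in \<open>auto simp: lies_left_of_def\<close>)
  then have "W_single X l = W_single X {t}"
    unfolding W_single_point by (auto simp: W_single_def)
  then show ?thesis
    by (simp add: left_def lower_def)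
qed

lemma mass_eq: "l \<in> \<I> \<Longrightarrow> t \<in> l \<Longrightarrow> mass t = \<pi> l"
  using \<I>_not_C cell_eq by (simp add: mass_def)

lemma mass_C: "c \<in> C \<Longrightarrow> mass c = 0"
  by (simp add: mass_def)

lemma mass_nonneg: "t \<in> {0..1} \<Longrightarrow> mass t \<ge> 0"
  using \<pi>_pos[of "cell t"] cell_\<I>[of t] by (auto simp: mass_def)

lemma infsum_\<pi>_mono: "S \<subseteq> T \<Longrightarrow> T \<subseteq> \<I> \<Longrightarrow> infsum \<pi> S \<le> infsum \<pi> T"
proof (rule infsum_mono2)
  assume ST: "S \<subseteq> T" "T \<subseteq> \<I>"
  show "\<pi> summable_on S" "\<pi> summable_on T"
    using \<pi>_summable ST by auto
  show "0 \<le> \<pi> x" if "x \<in> T - S" for x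
    using that ST \<pi>_pos[of x] by auto
qed

lemma lower_plus_mass:
  assumes "t \<in> {0..1}"
  shows "lower t + mass t = infsum \<pi> {l \<in> \<I>. (\<forall>a\<in>l. a < t) \<or> t \<in> l}"
proof (cases "t \<in> C")
  case True
  then have "{l \<in> \<I>. (\<forall>a\<in>l. a < t) \<or> t \<in> l} = W_single X {t}"
    unfolding W_single_point using \<I>_not_C by blast
  then show ?thesis
    using True by (simp add: lower_def left_def mass_def)
next
  case False
  define i where "i = cell t"
  have i: "i \<in> \<I>" "t \<in> i"
    using cell_\<I>[OF assms False] in_cell[OF assms False] by (auto simp: i_def)
  have "{l \<in> \<I>. (\<forall>a\<in>l. a < t) \<or> t \<in> l} = insert i (W_single X {t})"
    unfolding W_single_point using i \<I>_unique by blast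
  moreover have "i \<notin> W_single X {t}"
    unfolding W_single_point using i by blast
  ultimately show ?thesis
    using i mass_eq[OF i] \<pi>_summable[OF W_single_\<I>[of "{t}"]]
    by (simp add: infsum_insert lower_def left_def)
qed

text \<open>
  Partition intervals are convex, so one that contains \<open>s\<close> and not \<open>t\<close> lies left of \<open>t\<close> together with
  everything left of \<open>s\<close>.
\<close>
lemma lower_step:
  assumes "s \<in> {0..1}" "t \<in> {0..1}" "s < t" "\<And>i. i \<in> \<I> \<Longrightarrow> s \<in> i \<Longrightarrow> t \<notin> i"
  shows "lower s + mass s \<le> lower t"
  unfolding lower_plus_mass[OF assms(1)] unfolding lower_def left_def
proof (rule infsum_\<pi>_mono[OF _ W_single_\<I>], rule subsetI)
  fix l assume l: "l \<in> {l \<in> \<I>. (\<forall>a\<in>l. a < s) \<or> s \<in> l}"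
  then have "l \<in> \<I>" by simp
  have "a < t" if a: "a \<in> l" for a
  proof (rule ccontr)
    assume "\<not> a < t"
    then have "s \<in> l"
      using l a assms(3) by auto
    then have "t \<in> l"
      using \<I>_convex[OF \<open>l \<in> \<I>\<close> _ a, of s t] \<open>\<not> a < t\<close> assms(3) by auto
    then show False
      using assms(4) \<open>l \<in> \<I>\<close> \<open>s \<in> l\<close> by blast
  qed
  then show "l \<in> W_single X {t}"
    unfolding W_single_point using \<open>l \<in> \<I>\<close> by blast
qed

lemma lower_step_C:
  assumes "s \<in> {0..1}" "t \<in> {0..1}" "s < t" "s \<in> C \<or> t \<in> C"
  shows "lower s + mass s \<le> lower t"
  using lower_step[OF assms(1-3)] assms(4) \<I>_not_C by blast

lemma lower_nonneg: "0 \<le> left A"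
  unfolding left_def using \<pi>_pos W_single_\<I>[of A] by (intro infsum_nonneg) (auto intro: less_imp_le)

lemma infsum_\<pi>: "infsum \<pi> \<I> = 1"
  using \<pi>_sum by (rule infsumI)

lemma upper_le_1: "t \<in> {0..1} \<Longrightarrow> lower t + mass t \<le> 1"
  using infsum_\<pi>_mono[of "{l \<in> \<I>. (\<forall>a\<in>l. a < t) \<or> t \<in> l}" \<I>] by (simp add: lower_plus_mass infsum_\<pi>)

lemma lower_le_1: "t \<in> {0..1} \<Longrightarrow> lower t \<le> 1"
  using upper_le_1[of t] mass_nonneg[of t] by simp

lemma lower_unit: "t \<in> {0..1} \<Longrightarrow> lower t \<in> {0..1}"
  using lower_le_1 lower_nonneg by (simp add: lower_def)

lemma lower_0: "lower 0 = 0"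
proof -
  have "W_single X {0} = {}"
    unfolding W_single_point using \<I>_unit \<I>_nonempty by fastforce
  then show ?thesis by (simp add: lower_def left_def)
qed

lemma lower_1: "lower 1 = 1"
proof -
  have "a < 1" if "l \<in> \<I>" "a \<in> l" for a l
    using \<I>_unit[OF that] \<I>_not_C[OF that] one_C by (cases "a = 1") auto
  then have "W_single X {1} = \<I>"
    unfolding W_single_point by blast
  then show ?thesis by (simp add: lower_def left_def infsum_\<pi>)
qed

lemma J_ordered:
  assumes "k \<in> \<I>" "l \<in> \<I>" "s \<in> k" "t \<in> l" "s < t" "k \<noteq> l"
  shows "left k + \<pi> k \<le> left l"
  using lower_step[of s t] assms \<I>_unit \<I>_unique left_eq_lower mass_eq by metis

lemma J_separated:
  assumes "k \<in> \<I>" "l \<in> \<I>" "k \<noteq> l"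
  shows "left k + \<pi> k \<le> left l \<or> left l + \<pi> l \<le> left k"
proof -
  obtain s t where st: "s \<in> k" "t \<in> l"
    using \<I>_nonempty assms by meson
  then have "s \<noteq> t"
    using assms \<I>_unique by blast
  then show ?thesis
    using J_ordered[OF assms(1,2) st] J_ordered[OF assms(2,1) st(2,1)] assms(3)
    by (cases "s < t") auto
qed

lemma J_disjoint: "disjoint_family_on J \<I>"
proof -
  have "J k \<inter> J l = {}" if "k \<in> \<I>" "l \<in> \<I>" "k \<noteq> l" for k l
    using J_separated[OF that] \<pi>_pos that by (auto simp: J_def)
  then show ?thesis
    by (simp add: disjoint_family_on_def)
qed

lemma J_bounds:
  assumes "l \<in> \<I>"
  shows "0 \<le> left l" "left l + \<pi> l \<le> 1" "0 < \<pi> l"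
proof -
  obtain t where t: "t \<in> l" using \<I>_nonempty assms by blast
  show "0 \<le> left l" by (rule lower_nonneg)
  show "left l + \<pi> l \<le> 1"
    using upper_le_1[of t] \<I>_unit[OF assms t] left_eq_lower[OF assms t] mass_eq[OF assms t] by simp
  show "0 < \<pi> l" using \<pi>_pos assms .
qed

lemma measure_J: "l \<in> \<I> \<Longrightarrow> measure lborel (J l) = \<pi> l"
  using J_bounds[of l] by (simp add: J_def)

lemma J_unit: "l \<in> \<I> \<Longrightarrow> J l \<subseteq> {0..1}"
  using J_bounds[of l] by (auto simp: J_def)

lemma J_borel: "J l \<in> sets borel"
  by (simp add: J_def)

lemma J_UN_measure: "measure lborel (\<Union>l\<in>\<I>. J l) = 1"
proof -
  have "(\<Union>l\<in>\<I>. J l) \<subseteq> {0..1}"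
    using J_unit by blast
  then have "((\<lambda>l. measure lborel (J l)) has_sum measure lborel (\<Union>l\<in>\<I>. J l)) \<I>"
    using J_borel J_disjoint countable_\<I> by (intro has_sum_measure_UN emeasure_lborel_subset_unit_finite) auto
  moreover have "((\<lambda>l. measure lborel (J l)) has_sum 1) \<I>"
    using \<pi>_sum by (rule has_sum_cong[THEN iffD1, rotated]) (simp add: measure_J)
  ultimately show ?thesis
    using has_sum_unique by blast
qed

text \<open>
  The intervals \<open>J l\<close> are disjoint subintervals of \<open>{0..1}\<close>, and their lengths \<open>\<pi> l\<close> add up to \<open>1\<close>.
\<close>
lemma J_complement_null: "{0..1} - (\<Union>l\<in>\<I>. J l) \<in> null_sets lborel"
proof -
  let ?U = "\<Union>l\<in>\<I>. J l"
  have U: "?U \<subseteq> {0..1}" "?U \<in> sets borel"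
    using J_unit J_borel countable_\<I> by (blast, intro sets.countable_UN') auto
  have "emeasure lborel ({0..1} - ?U) = emeasure lborel {0..1::real} - emeasure lborel ?U"
    using U emeasure_lborel_subset_unit_finite[OF U(1)] by (intro emeasure_Diff) auto
  also have "emeasure lborel ?U = 1"
    using J_UN_measure emeasure_lborel_subset_unit_finite[OF U(1)] by (simp add: emeasure_eq_ennreal_measure)
  finally have "emeasure lborel ({0..1} - ?U) = 0"
    by simp
  then show ?thesis
    using U(2) by (auto simp: null_sets_def)
qed

lemma has_sum_measure_J:
  assumes B: "B \<in> sets borel" "B \<subseteq> {0..1}"
  shows "((\<lambda>l. measure lborel (B \<inter> J l)) has_sum measure lborel B) \<I>"
proof (rule has_sum_measure_cover_null[OF countable_\<I> J_disjoint J_borel B(1)])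
  show "emeasure lborel B \<noteq> \<infinity>"
    using B(2) by (rule emeasure_lborel_subset_unit_finite)
  show "B - (\<Union>l\<in>\<I>. J l) \<in> null_sets lborel"
    using J_borel countable_\<I> B
    by (intro null_sets_subset[OF J_complement_null]) (auto intro!: sets.Diff sets.countable_UN')
qed

text \<open>
  The length of the part of \<open>J l\<close> below \<open>v\<close>.
\<close>
definition clip :: "real set \<Rightarrow> real \<Rightarrow> real" where
  "clip l v = min (max (v - left l) 0) (\<pi> l)"

lemma clip_measure:
  assumes "l \<in> \<I>" "v \<ge> 0"
  shows "clip l v = measure lborel (J l \<inter> {0..v})"
proof -
  have 1: "J l \<inter> {0..v} = {}" if "v \<le> left l"
    using that by (auto simp: J_def)
  have 2: "J l \<inter> {0..v} = {left l<..v}" if "v < left l + \<pi> l"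
    using that J_bounds[OF assms(1)] by (auto simp: J_def)
  have 3: "J l \<inter> {0..v} = J l" if "left l + \<pi> l \<le> v"
    using that J_bounds[OF assms(1)] by (auto simp: J_def)
  consider "v \<le> left l" "J l \<inter> {0..v} = {}" | "left l < v" "v < left l + \<pi> l" "J l \<inter> {0..v} = {left l<..v}"
    | "left l + \<pi> l \<le> v" "J l \<inter> {0..v} = J l"
    using 1 2 3 by (meson not_le)
  then show ?thesis
    using J_bounds[OF assms(1)] measure_J[OF assms(1)] by cases (auto simp: clip_def)
qed

lemma clip_sum:
  assumes v: "v \<in> {0..1}"
  shows "((\<lambda>l. clip l v) has_sum v) \<I>"
proof -
  have "((\<lambda>l. measure lborel ({0..v} \<inter> J l)) has_sum measure lborel {0..v}) \<I>"
    using v by (intro has_sum_measure_J) auto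
  then have "((\<lambda>l. measure lborel ({0..v} \<inter> J l)) has_sum v) \<I>"
    using v by simp
  then show ?thesis
    by (rule has_sum_cong[THEN iffD1, rotated]) (use v in \<open>simp add: clip_measure Int_commute\<close>)
qed

section \<open>The branches of the inverse map\<close>

text \<open>
  The integral from \<open>0\<close> to \<open>v\<close> of the density that equals \<open>1 / card (preds l)\<close> on \<open>J l\<close>. For a Lebesgue
  fair map with these intervals, an injective piece has the length of its image weighted by this
  density.
\<close>
definition K :: "real \<Rightarrow> real" where
  "K v = (\<Sum>\<^sub>\<infinity>l\<in>\<I>. clip l v / card (preds l))"

lemma clip_nonneg: "l \<in> \<I> \<Longrightarrow> 0 \<le> clip l v" and clip_le: "clip l v \<le> \<pi> l"
  using \<pi>_pos[of l] by (auto simp: clip_def)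

lemma clip_mono: "v \<le> w \<Longrightarrow> clip l v \<le> clip l w"
  by (auto simp: clip_def)

lemma divide_card_preds_le: "l \<in> \<I> \<Longrightarrow> 0 \<le> (x :: real) \<Longrightarrow> x / card (preds l) \<le> x"
  using card_preds[of l] by (simp add: divide_le_eq mult_le_cancel_left1)

lemma K_has_sum: "((\<lambda>l. clip l v / card (preds l)) has_sum K v) \<I>"
  unfolding K_def
proof (rule has_sum_infsum, rule summable_on_comparison_test)
  show "\<pi> summable_on \<I>" using \<pi>_summable by simp
  show "clip l v / card (preds l) \<le> \<pi> l" "0 \<le> clip l v / card (preds l)" if "l \<in> \<I>" for l
    using clip_nonneg[OF that, of v] clip_le[of l v] divide_card_preds_le[OF that, of "clip l v"] by auto
qed

lemma K_mono:
  assumes "v \<le> w"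
  shows "K v \<le> K w"
  by (rule has_sum_mono[OF K_has_sum K_has_sum]) (auto intro!: divide_right_mono clip_mono assms)

lemma K_diff_le:
  assumes "v \<le> w" "v \<in> {0..1}" "w \<in> {0..1}"
  shows "K w - K v \<le> w - v"
proof (rule has_sum_mono[OF has_sum_diff_real[OF K_has_sum K_has_sum] has_sum_diff_real[OF clip_sum clip_sum]])
  fix l assume "l \<in> \<I>"
  then show "clip l w / card (preds l) - clip l v / card (preds l) \<le> clip l w - clip l v"
    using divide_card_preds_le[of l "clip l w - clip l v"] clip_mono[OF assms(1), of l]
    by (simp add: diff_divide_distrib)
qed (use assms in auto)

lemma K_diff_abs:
  assumes "v \<in> {0..1}" "w \<in> {0..1}"
  shows "\<bar>K w - K v\<bar> \<le> \<bar>w - v\<bar>"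
  using K_diff_le[of v w] K_diff_le[of w v] K_mono[of v w] K_mono[of w v] assms
  by (cases "v \<le> w") auto

lemma K_continuous: "continuous_on {0..1} K"
proof (rule continuous_on_iff[THEN iffD2], intro ballI allI impI)
  fix v e :: real assume "v \<in> {0..1}" "e > 0"
  then show "\<exists>d>0. \<forall>w\<in>{0..1}. dist w v < d \<longrightarrow> dist (K w) (K v) < e"
    using K_diff_abs[of v] unfolding dist_real_def by (intro exI[of _ e]) (meson le_less_trans)
qed

text \<open>
  All intervals other than \<open>J l\<close> lie entirely on one side of it, and their contributions cancel.
\<close>
lemma K_slope:
  assumes l: "l \<in> \<I>" and v: "v \<in> {left l..left l + \<pi> l}" and w: "w \<in> {left l..left l + \<pi> l}"
  shows "K w - K v = (w - v) / card (preds l)"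
proof -
  have "clip k w / card (preds k) - clip k v / card (preds k) = (if k = l then (w - v) / card (preds l) else 0)"
    if "k \<in> \<I>" for k
  proof (cases "k = l")
    case True
    then show ?thesis
      using v w by (auto simp: clip_def diff_divide_distrib min_def max_def)
  next
    case False
    then have "clip k w = clip k v"
      using J_separated[OF that l False] v w \<pi>_pos[OF l] \<pi>_pos[OF that] by (auto simp: clip_def)
    then show ?thesis
      using False by simp
  qed
  then have "((\<lambda>k. if k = l then (w - v) / card (preds l) else 0) has_sum K w - K v) \<I>"
    by (intro has_sum_cong[THEN iffD1, OF _ has_sum_diff_real[OF K_has_sum K_has_sum]]) blast
  moreover have "((\<lambda>k. if k = l then (w - v) / card (preds l) else 0) has_sum (w - v) / card (preds l)) \<I>"
    using l by (intro has_sum_finite_neutralI[of "{l}"]) auto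
  ultimately show ?thesis
    using has_sum_unique by blast
qed

lemma clip_lower:
  assumes c: "c \<in> C" and l: "l \<in> \<I>"
  shows "clip l (lower c) = (if \<forall>a\<in>l. a < c then \<pi> l else 0)"
proof -
  obtain t where t: "t \<in> l" using \<I>_nonempty l by blast
  have t01: "t \<in> {0..1}" and c01: "c \<in> {0..1}" using \<I>_unit l t C_unit c by auto
  show ?thesis
  proof (cases "\<forall>a\<in>l. a < c")
    case True
    then have "left l + \<pi> l \<le> lower c"
      using lower_step_C[OF t01 c01] c t left_eq_lower[OF l t] mass_eq[OF l t] by simp
    then show ?thesis
      using True by (simp add: clip_def)
  next
    case False
    then obtain s where s: "s \<in> l" "c < s"
      using \<I>_not_C[OF l] c by (metis linorder_neqE)
    then have "lower c \<le> left l"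
      using lower_step_C[OF c01, of s] \<I>_unit[OF l s(1)] c left_eq_lower[OF l s(1)] mass_C[OF c] by simp
    then show ?thesis
      using False \<pi>_pos[OF l] by (auto simp: clip_def)
  qed
qed

text \<open>
  This is stationarity of \<open>\<pi>\<close>. Between the images of \<open>lo i\<close> and \<open>hi i\<close> lie exactly the intervals \<open>J l\<close>
  with \<open>l \<subseteq> f ` i\<close>, and each adds \<open>\<pi> l / card (preds l)\<close>.
\<close>
lemma K_image:
  assumes i: "i \<in> \<I>"
  shows "K (lower (hi i)) - K (lower (lo i)) = \<pi> i"
proof -
  have "clip l (lower (hi i)) / card (preds l) - clip l (lower (lo i)) / card (preds l)
      = (if l \<subseteq> f ` i then \<pi> l / card (preds l) else 0)" if l: "l \<in> \<I>" for l
  proof -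
    obtain t where t: "t \<in> l" using \<I>_nonempty l by blast
    have "(\<forall>a\<in>l. a < hi i) \<and> \<not> (\<forall>a\<in>l. a < lo i) \<longleftrightarrow> l \<subseteq> f ` i"
    proof
      assume *: "(\<forall>a\<in>l. a < hi i) \<and> \<not> (\<forall>a\<in>l. a < lo i)"
      then obtain s where "s \<in> l" "lo i < s"
        using \<I>_not_C[OF l] lo_C[OF i] by (metis linorder_neqE)
      then have "s \<in> f ` i"
        unfolding image_interval[OF i] using * by simp
      then show "l \<subseteq> f ` i"
        using image_Markov[OF i l \<open>s \<in> l\<close>] by blast
    next
      assume "l \<subseteq> f ` i"
      then show "(\<forall>a\<in>l. a < hi i) \<and> \<not> (\<forall>a\<in>l. a < lo i)"
        unfolding image_interval[OF i] using t by fastforce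
    qed
    moreover have "(\<forall>a\<in>l. a < lo i) \<longrightarrow> (\<forall>a\<in>l. a < hi i)"
      using lo_less_hi[OF i] by auto
    ultimately show ?thesis
      using clip_lower[OF lo_C[OF i] l] clip_lower[OF hi_C[OF i] l] by auto
  qed
  then have "((\<lambda>l. if l \<subseteq> f ` i then \<pi> l / card (preds l) else 0) has_sum K (lower (hi i)) - K (lower (lo i))) \<I>"
    by (intro has_sum_cong[THEN iffD1, OF _ has_sum_diff_real[OF K_has_sum K_has_sum]]) blast
  moreover have "((\<lambda>l. if l \<subseteq> f ` i then \<pi> l / card (preds l) else 0) has_sum \<pi> i) \<I>"
    using \<pi>_flow[OF i] by (rule has_sum_cong_neutral[THEN iffD1, rotated -1]) auto
  ultimately show ?thesis
    using has_sum_unique by blast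
qed

text \<open>
  The functional equation of the conjugacy on a partition interval \<open>i\<close> reads \<open>\<phi> t = branch i (\<phi> (f t))\<close>.
  The constants place the values in \<open>J i\<close>; both ends of \<open>f ` i\<close> are partition points, where the conjugacy
  is known to be \<open>lower\<close>.
\<close>
definition branch :: "real set \<Rightarrow> real \<Rightarrow> real" where
  "branch i v = left i + (if increasing i then K v - K (lower (lo i)) else K (lower (hi i)) - K v)"

lemma branch_range:
  assumes "i \<in> \<I>" "lower (lo i) \<le> v" "v \<le> lower (hi i)"
  shows "branch i v \<in> {left i..left i + \<pi> i}"
  using K_mono[OF assms(2)] K_mono[OF assms(3)] K_image[OF assms(1)] by (auto simp: branch_def)

lemma branch_mono: "v \<le> w \<Longrightarrow> if increasing i then branch i v \<le> branch i w else branch i w \<le> branch i v"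
  using K_mono[of v w] by (simp add: branch_def)

lemma branch_slope:
  assumes "l \<in> \<I>" "v \<in> {left l..left l + \<pi> l}" "w \<in> {left l..left l + \<pi> l}"
  shows "branch i w - branch i v = (if increasing i then w - v else v - w) / card (preds l)"
  using K_slope[OF assms] by (auto simp: branch_def) (simp add: diff_divide_distrib)

lemma lower_image:
  assumes i: "i \<in> \<I>" and t: "t \<in> i"
  shows "lower (lo i) \<le> lower (f t)" "lower (f t) + mass (f t) \<le> lower (hi i)"
proof -
  have t: "f t \<in> {0..1}" "f t \<in> {lo i<..<hi i}"
    using f_unit \<I>_unit[OF i t] image_interval[OF i] t by blast+
  show "lower (lo i) \<le> lower (f t)"
    using lower_step_C[of "lo i" "f t"] t lo_C[OF i] C_unit[OF lo_C[OF i]] mass_C[OF lo_C[OF i]] by auto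
  show "lower (f t) + mass (f t) \<le> lower (hi i)"
    using lower_step_C[of "f t" "hi i"] t hi_C[OF i] C_unit[OF hi_C[OF i]] by auto
qed

section \<open>Lower and upper bounds for the conjugacy\<close>

text \<open>
  Lower bounds (\<open>s = False\<close>) and upper bounds (\<open>s = True\<close>). A branch of a decreasing piece reverses the
  order, so that \<open>s\<close> is flipped there: \<open>s = increasing (cell t)\<close> is \<open>s\<close> on increasing pieces and \<open>\<not> s\<close>
  on decreasing ones.
\<close>
primrec bound :: "nat \<Rightarrow> bool \<Rightarrow> real \<Rightarrow> real" where
  "bound 0 s t = lower t + (if s then mass t else 0)"
| "bound (Suc n) s t =
     (if t \<in> C then lower t else branch (cell t) (bound n (s = increasing (cell t)) (f t)))"

lemma bound_C: "t \<in> C \<Longrightarrow> bound n s t = lower t"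
  by (cases n) (simp_all add: mass_C)

lemma bound_within:
  assumes "t \<in> {0..1}"
  shows "lower t \<le> bound n s t" "bound n s t \<le> lower t + mass t"
proof -
  have "lower t \<le> bound n s t \<and> bound n s t \<le> lower t + mass t"
    using assms
  proof (induction n arbitrary: s t)
    case 0
    then show ?case using mass_nonneg[of t] by simp
  next
    case (Suc n)
    show ?case
    proof (cases "t \<in> C")
      case True
      then show ?thesis by (simp add: mass_C)
    next
      case False
      note i = cell_\<I>[OF Suc.prems False] in_cell[OF Suc.prems False]
      show ?thesis
        using Suc.IH[OF f_unit[OF Suc.prems], of "s = increasing (cell t)"] lower_image[OF i] False
          branch_range[OF i(1), of "bound n (s = increasing (cell t)) (f t)"] left_eq_lower[OF i] mass_eq[OF i]
        by simp
    qed
  qed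
  then show "lower t \<le> bound n s t" "bound n s t \<le> lower t + mass t" by auto
qed

lemma bound_unit: "t \<in> {0..1} \<Longrightarrow> bound n s t \<in> {0..1}"
  using bound_within[of t n s] lower_unit[of t] upper_le_1[of t] by auto

lemma bound_improves:
  assumes "t \<in> {0..1}"
  shows "bound n False t \<le> bound (Suc n) False t \<and> bound (Suc n) True t \<le> bound n True t"
  using assms
proof (induction n arbitrary: t)
  case 0
  then show ?case
    using bound_within[of t "Suc 0"] by (simp del: bound.simps(2))
next
  case (Suc n)
  let ?b = "\<lambda>n s. bound n s (f t)" and ?i = "cell t"
  show ?case
  proof (cases "t \<in> C")
    case False
    have IH: "?b n False \<le> ?b (Suc n) False" "?b (Suc n) True \<le> ?b n True"
      using Suc.IH[OF f_unit[OF Suc.prems]] by auto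
    have "bound (Suc m) s t = branch ?i (?b m (s = increasing ?i))" for m s
      using False by simp
    then show ?thesis
      using branch_mono[OF IH(1), of ?i] branch_mono[OF IH(2), of ?i]
      by (cases "increasing ?i") (simp_all del: bound.simps)
  qed simp
qed

lemma bound_ordered:
  assumes "t \<in> {0..1}"
  shows "bound n False t \<le> bound n True t"
  using assms
proof (induction n arbitrary: t)
  case 0
  then show ?case using mass_nonneg by simp
next
  case (Suc n)
  show ?case
    using Suc.IH[OF f_unit[OF Suc.prems]]
      branch_mono[of "bound n False (f t)" "bound n True (f t)" "cell t"]
    by (cases "increasing (cell t)") auto
qed

lemma bound_lower_mono: "t \<in> {0..1} \<Longrightarrow> m \<le> n \<Longrightarrow> bound m False t \<le> bound n False t"
  by (rule lift_Suc_mono_le[of "\<lambda>n. bound n False t"]) (use bound_improves in auto)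

lemma bound_upper_mono: "t \<in> {0..1} \<Longrightarrow> m \<le> n \<Longrightarrow> bound n True t \<le> bound m True t"
  by (rule lift_Suc_antimono_le[of "\<lambda>n. bound n True t"]) (use bound_improves in auto)

text \<open>
  The bounds of stage \<open>n\<close> know the first \<open>n\<close> iterates: points that have been in different partition
  intervals by then have non-overlapping ranges of admissible values. Starting from such a time, the
  order of the ranges is carried back along the monotone branches.
\<close>
lemma bound_separate:
  assumes "s \<in> {0..1}" "t \<in> {0..1}" "s < t"
    and "\<exists>k\<le>n. \<forall>i\<in>\<I>. \<not> ((f ^^ k) s \<in> i \<and> (f ^^ k) t \<in> i)"
  shows "bound n True s \<le> bound n False t"
  using assms
proof (induction n arbitrary: s t)
  case 0
  then show ?case
    using lower_step[of s t] by auto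
next
  case (Suc n)
  show ?case
  proof (cases "\<exists>i\<in>\<I>. s \<in> i \<and> t \<in> i")
    case False
    have "bound (Suc n) True s \<le> lower s + mass s" "lower t \<le> bound (Suc n) False t"
      using Suc.prems by (intro bound_within; simp)+
    then show ?thesis
      using lower_step[of s t] Suc.prems False by force
  next
    case True
    then obtain i where i: "i \<in> \<I>" "s \<in> i" "t \<in> i" by blast
    note [simp] = cell_eq[OF i(1,2)] cell_eq[OF i(1,3)] \<I>_not_C[OF i(1,2)] \<I>_not_C[OF i(1,3)]
    obtain k where k: "k \<le> Suc n" "\<forall>i\<in>\<I>. \<not> ((f ^^ k) s \<in> i \<and> (f ^^ k) t \<in> i)"
      using Suc.prems by blast
    have "k \<noteq> 0"
    proof
      assume "k = 0"
      then show False
        using k(2)[rule_format, OF i(1)] i(2,3) by simp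
    qed
    then obtain m where m: "k = Suc m"
      using not0_implies_Suc by blast
    have "m \<le> n"
      using k(1) m by simp
    have "\<forall>i\<in>\<I>. \<not> ((f ^^ m) (f s) \<in> i \<and> (f ^^ m) (f t) \<in> i)"
      using k(2) unfolding m funpow_Suc_right comp_apply .
    then have sep: "\<exists>k\<le>n. \<forall>i\<in>\<I>. \<not> ((f ^^ k) (f s) \<in> i \<and> (f ^^ k) (f t) \<in> i)"
      using \<open>m \<le> n\<close> by blast
    then have sep': "\<exists>k\<le>n. \<forall>i\<in>\<I>. \<not> ((f ^^ k) (f t) \<in> i \<and> (f ^^ k) (f s) \<in> i)"
      by blast
    show ?thesis
    proof (cases "increasing i")
      case True
      then have "bound n True (f s) \<le> bound n False (f t)"
        using increasing_less[OF i(1) True i(2,3)] Suc.prems f_unit sep by (intro Suc.IH) auto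
      then show ?thesis
        using branch_mono[of "bound n True (f s)" "bound n False (f t)" i] True by simp
    next
      case False
      then have "bound n True (f t) \<le> bound n False (f s)"
        using not_increasing_less[OF i(1) False i(3,2)] Suc.prems f_unit sep' by (intro Suc.IH) auto
      then show ?thesis
        using branch_mono[of "bound n True (f t)" "bound n False (f s)" i] False by simp
    qed
  qed
qed

section \<open>The bounds converge uniformly\<close>

definition gap :: "nat \<Rightarrow> real \<Rightarrow> real" where
  "gap n t = bound n True t - bound n False t"

lemma gap_C: "t \<in> C \<Longrightarrow> gap n t = 0"
  by (simp add: gap_def bound_C)

lemma gap_nonneg: "t \<in> {0..1} \<Longrightarrow> gap n t \<ge> 0"
  using bound_ordered by (simp add: gap_def)

lemma gap_antimono: "t \<in> {0..1} \<Longrightarrow> m \<le> n \<Longrightarrow> gap n t \<le> gap m t"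
  using bound_lower_mono[of t m n] bound_upper_mono[of t m n] by (simp add: gap_def)

lemma gap_0: "gap 0 t = mass t"
  by (simp add: gap_def)

lemma gap_Suc_C:
  assumes "t \<in> {0..1}" "f t \<in> C"
  shows "gap (Suc n) t = 0"
  using assms by (simp add: gap_def bound_C)

text \<open>
  Both bounds at \<open>f t\<close> lie in the closed interval \<open>J\<close> of the cell of \<open>f t\<close>, on which the branches have slope
  \<open>1 / card (preds (cell (f t)))\<close> up to sign.
\<close>
lemma gap_Suc:
  assumes "t \<in> {0..1}" "f t \<notin> C"
  shows "gap (Suc n) t = gap n (f t) / card (preds (cell (f t)))"
proof -
  note s = orbit_step[OF assms]
  have J: "bound n b (f t) \<in> {left (cell (f t))..left (cell (f t)) + \<pi> (cell (f t))}" for b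
    using bound_within[OF s(2), of n b] left_eq_lower[OF s(4,6)] mass_eq[OF s(4,6)] by simp
  show ?thesis
    using branch_slope[OF s(4) J[of False] J[of True], of "cell t"] s(1)
    by (cases "increasing (cell t)") (auto simp: gap_def diff_divide_distrib)
qed

lemma gap_add:
  assumes "t \<in> {0..1}" "(f ^^ N) t \<notin> C"
  shows "gap (m + N) t = gap m ((f ^^ N) t) / (\<Prod>k<N. card (preds (cell ((f ^^ Suc k) t))))"
  using assms
proof (induction N arbitrary: t)
  case (Suc N)
  have ft: "f t \<in> {0..1}" "(f ^^ N) (f t) \<notin> C"
    using Suc.prems f_unit by (auto simp: funpow_Suc_right simp del: funpow.simps)
  then have "f t \<notin> C"
    using funpow_C by blast
  then have "gap (m + Suc N) t = gap (m + N) (f t) / card (preds (cell (f t)))"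
    using gap_Suc[OF Suc.prems(1)] by simp
  also have "gap (m + N) (f t) = gap m ((f ^^ N) (f t)) / (\<Prod>k<N. card (preds (cell ((f ^^ Suc k) (f t)))))"
    by (rule Suc.IH[OF ft])
  finally show ?case
    by (simp only: prod.lessThan_Suc_shift funpow_Suc_right comp_apply of_nat_mult) (simp add: field_simps)
qed simp

lemma gap_add_C:
  assumes "t \<in> {0..1}" "(f ^^ N) t \<in> C"
  shows "gap (m + N) t = 0"
  using assms
proof (induction N arbitrary: t)
  case 0
  then show ?case by (simp add: gap_C)
next
  case (Suc N)
  show ?case
  proof (cases "f t \<in> C")
    case True
    then show ?thesis using gap_Suc_C[OF Suc.prems(1)] by simp
  next
    case False
    have "gap (m + N) (f t) = 0"
      using Suc.prems f_unit by (intro Suc.IH) (auto simp: funpow_Suc_right simp del: funpow.simps)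
    then show ?thesis using gap_Suc[OF Suc.prems(1) False] by simp
  qed
qed

lemma gap_pos:
  assumes "t \<in> {0..1}" "(f ^^ n) t \<notin> C"
  shows "gap n t > 0"
proof -
  have u: "(f ^^ n) t \<in> {0..1}"
    using funpow_unit assms by blast
  have "(\<Prod>k<n. card (preds (cell ((f ^^ Suc k) t)))) > 0"
  proof (rule prod_pos)
    fix k assume "k \<in> {..<n}"
    then have "(f ^^ Suc k) t \<notin> C"
      using funpow_C_mono[of "Suc k" t n] assms(2) by auto
    then have "cell ((f ^^ Suc k) t) \<in> \<I>"
      using cell_\<I> funpow_unit assms(1) by blast
    from card_preds[OF this] show "0 < card (preds (cell ((f ^^ Suc k) t)))"
      by simp
  qed
  moreover have "mass ((f ^^ n) t) > 0"
    using \<pi>_pos[OF cell_\<I>[OF u assms(2)]] assms(2) by (simp add: mass_def)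
  ultimately show ?thesis
    unfolding gap_add[OF assms, of 0, simplified] gap_0 of_nat_prod[symmetric]
    by (intro divide_pos_pos) (auto simp del: of_nat_prod)
qed

text \<open>
  If all of the \<open>N\<close> steps leading to the interval \<open>V\<close> have a unique predecessor, then only one
  partition interval reaches \<open>V\<close> in \<open>N\<close> steps. By mixing, two different intervals reach \<open>V\<close>, so the gap
  is halved in every block of \<open>N\<close> steps. A single \<open>N\<close> serves all intervals \<open>V\<close> of mass above \<open>\<epsilon>\<close>,
  since there are finitely many.
\<close>
lemma gap_halving:
  assumes "\<epsilon> > 0"
  shows "\<exists>N. \<forall>m. \<forall>t\<in>{0..1}. gap (m + N) t > \<epsilon> \<longrightarrow> gap (m + N) t \<le> gap m ((f ^^ N) t) / 2"
proof -
  obtain U1 U2 where U: "U1 \<in> \<I>" "U2 \<in> \<I>" "U1 \<noteq> U2"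
    using two_intervals by blast
  define S where "S = {V \<in> \<I>. \<pi> V > \<epsilon>}"
  have "finite S"
  proof -
    have "(\<lambda>l. if \<pi> l > \<epsilon> then 1 else 0 :: real) summable_on \<I>"
    proof (rule summable_on_comparison_test[where f = "\<lambda>l. \<pi> l / \<epsilon>"])
      show "(\<lambda>l. \<pi> l / \<epsilon>) summable_on \<I>"
        using summable_on_cmult_left[OF \<pi>_summable[of \<I>], of "1 / \<epsilon>"] by simp
    qed (use \<pi>_pos assms in \<open>auto simp: less_imp_le\<close>)
    then show ?thesis
      unfolding S_def by (rule summable_on_one_imp_finite)
  qed
  have "\<exists>N. \<forall>n\<ge>N. (\<exists>x\<in>U1. (f ^^ n) x \<in> V) \<and> (\<exists>x\<in>U2. (f ^^ n) x \<in> V)" if "V \<in> S" for V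
  proof -
    have V: "V \<in> \<I>" using that by (simp add: S_def)
    have ne: "U1 \<noteq> {}" "U2 \<noteq> {}"
      using \<I>_nonempty U by auto
    obtain N1 N2 where "\<forall>n\<ge>N1. \<exists>x\<in>U1. (f ^^ n) x \<in> V" "\<forall>n\<ge>N2. \<exists>x\<in>U2. (f ^^ n) x \<in> V"
      using mixing_interval[OF \<I>_openin[OF U(1)] ne(1) V] mixing_interval[OF \<I>_openin[OF U(2)] ne(2) V] by blast
    then show ?thesis
      by (intro exI[of _ "max N1 N2"]) auto
  qed
  then obtain N' where N': "\<And>V n. V \<in> S \<Longrightarrow> n \<ge> N' V \<Longrightarrow> (\<exists>x\<in>U1. (f ^^ n) x \<in> V) \<and> (\<exists>x\<in>U2. (f ^^ n) x \<in> V)"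
    by metis
  define N where "N = Max (insert 0 (N' ` S))"
  have N: "(\<exists>x\<in>U1. (f ^^ N) x \<in> V) \<and> (\<exists>x\<in>U2. (f ^^ N) x \<in> V)" if "V \<in> S" for V
    using \<open>finite S\<close> that by (intro N') (auto simp: N_def)
  show ?thesis
  proof (intro exI[of _ N] allI ballI impI)
    fix m t assume t: "t \<in> {0..1}" and g: "gap (m + N) t > \<epsilon>"
    let ?c = "\<lambda>x k. cell ((f ^^ k) x)"
    have nC: "(f ^^ N) t \<notin> C"
      using gap_add_C[OF t, of N m] g assms by auto
    have nCk: "(f ^^ k) t \<notin> C" if "k \<le> N" for k
      using funpow_C_mono nC that by blast
    have c\<I>: "?c t k \<in> \<I>" if "k \<le> N" for k
      using cell_\<I>[OF funpow_unit[OF t] nCk[OF that]] .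
    define p where "p = (\<Prod>k<N. card (preds (?c t (Suc k))))"
    have p0: "p > 0"
      unfolding p_def
    proof (rule prod_pos)
      fix k assume "k \<in> {..<N}"
      then show "0 < card (preds (?c t (Suc k)))"
        using card_preds[OF c\<I>[of "Suc k"]] by simp
    qed
    have eq: "gap (m + N) t = gap m ((f ^^ N) t) / p"
      using gap_add[OF t nC] by (simp add: p_def)
    have "p \<ge> 2"
    proof (rule ccontr)
      assume "\<not> p \<ge> 2"
      then have "p = 1" using p0 by simp
      then have one: "card (preds (?c t (Suc k))) = 1" if "k < N" for k
      proof -
        have "card (preds (?c t (Suc k))) dvd p"
          unfolding p_def using that by (intro dvd_prodI) auto
        then show ?thesis
          unfolding \<open>p = 1\<close> by simp
      qed
      have u: "(f ^^ N) t \<in> {0..1}"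
        using funpow_unit t by blast
      have "\<epsilon> < gap m ((f ^^ N) t)"
        using g eq \<open>p = 1\<close> by simp
      also have "\<dots> \<le> gap 0 ((f ^^ N) t)"
        using gap_antimono[OF u, of 0 m] by simp
      finally have "?c t N \<in> S"
        using nC c\<I>[of N] by (simp add: gap_0 mass_def S_def)
      (* Backwards from time N, unique predecessors force the itinerary of x onto that of t. *)
      have start: "cell x = cell t" if x: "x \<in> {0..1}" "(f ^^ N) x \<in> ?c t N" for x
      proof -
        have xC: "(f ^^ N) x \<notin> C"
          using \<I>_not_C[OF c\<I>[of N] x(2)] by simp
        have "?c x (N - k) = ?c t (N - k)" if "k \<le> N" for k
          using that
        proof (induction k)
          case 0
          then show ?case using cell_eq[OF c\<I>[of N] x(2)] by simp
        next
          case (Suc k)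
          define n where "n = N - Suc k"
          have n: "N - k = Suc n" "n < N" "Suc n \<le> N"
            using Suc.prems by (auto simp: n_def)
          have fx: "f ((f ^^ n) x) \<notin> C"
            using funpow_C_mono[of "Suc n" x N] xC n by auto
          have ft: "f ((f ^^ n) t) \<notin> C"
            using nCk[of "Suc n"] n by auto
          have "?c x (Suc n) = ?c t (Suc n)"
            using Suc.IH Suc.prems n by simp
          then have "?c x n \<in> preds (?c t (Suc n))" "?c t n \<in> preds (?c t (Suc n))"
            using orbit_step(8)[OF funpow_unit[OF x(1)] fx] orbit_step(8)[OF funpow_unit[OF t] ft] by simp_all
          then have "?c x n = ?c t n"
            using one[OF n(2)] by (metis card_1_singletonE singletonD)
          then show ?case by (simp add: n_def)
        qed
        from this[of N] show ?thesis by simp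
      qed
      obtain x1 x2 where x: "x1 \<in> U1" "(f ^^ N) x1 \<in> ?c t N" "x2 \<in> U2" "(f ^^ N) x2 \<in> ?c t N"
        using N[OF \<open>?c t N \<in> S\<close>] by blast
      have "cell x1 = cell t" "cell x2 = cell t"
        using start[OF \<I>_unit[OF U(1) x(1)] x(2)] start[OF \<I>_unit[OF U(2) x(3)] x(4)] .
      then show False
        using U cell_eq[OF U(1) x(1)] cell_eq[OF U(2) x(3)] by simp
    qed
    moreover have "gap m ((f ^^ N) t) \<ge> 0"
      using gap_nonneg funpow_unit t by blast
    ultimately show "gap (m + N) t \<le> gap m ((f ^^ N) t) / 2"
      unfolding eq by (intro divide_left_mono) auto
  qed
qed

text \<open>
  As long as a gap exceeds \<open>\<epsilon>\<close> it has been halved in every block of length \<open>N\<close>.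
\<close>
lemma gap_uniform:
  assumes "\<epsilon> > 0"
  shows "\<exists>n. \<forall>t\<in>{0..1}. gap n t \<le> \<epsilon>"
proof -
  obtain N where N: "\<And>m t. t \<in> {0..1} \<Longrightarrow> gap (m + N) t > \<epsilon> \<Longrightarrow> gap (m + N) t \<le> gap m ((f ^^ N) t) / 2"
    using gap_halving[OF assms] by blast
  have *: "gap (n * N) t \<le> max \<epsilon> ((1 / 2) ^ n)" if "t \<in> {0..1}" for n t
    using that
  proof (induction n arbitrary: t)
    case 0
    then show ?case
      using upper_le_1[of t] lower_nonneg[of "{t}"] by (simp add: gap_0 lower_def)
  next
    case (Suc n)
    show ?case
    proof (cases "gap (n * N + N) t > \<epsilon>")
      case True
      have "gap (n * N) ((f ^^ N) t) \<le> max \<epsilon> ((1 / 2) ^ n)"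
        using Suc.IH funpow_unit[OF Suc.prems] by blast
      then have "gap (n * N + N) t \<le> max \<epsilon> ((1 / 2) ^ n) / 2"
        using N[OF Suc.prems True] by simp
      also have "\<dots> \<le> max \<epsilon> ((1 / 2) ^ Suc n)"
        using assms by (simp add: max_def)
      finally show ?thesis by (simp add: add.commute)
    next
      case False
      then show ?thesis by (simp add: add.commute)
    qed
  qed
  obtain n where "(1 / 2) ^ n < \<epsilon>"
    using real_arch_pow_inv[OF assms, of "1/2"] by auto
  then have "gap (n * N) t \<le> \<epsilon>" if "t \<in> {0..1}" for t
    using *[OF that, of n] by simp
  then show ?thesis
    by blast
qed

section \<open>The conjugacy\<close>

definition \<phi> :: "real \<Rightarrow> real" where
  "\<phi> t = (SUP n. bound n False t)"

lemma \<phi>_between: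
  assumes "t \<in> {0..1}"
  shows "bound n False t \<le> \<phi> t" "\<phi> t \<le> bound n True t"
proof -
  have le: "bound m False t \<le> bound n True t" for m n
    using bound_lower_mono[OF assms, of m "max m n"] bound_ordered[OF assms, of "max m n"]
      bound_upper_mono[OF assms, of n "max m n"] by simp
  show "bound n False t \<le> \<phi> t"
    unfolding \<phi>_def using le by (intro cSUP_upper) (auto intro!: bdd_aboveI2)
  show "\<phi> t \<le> bound n True t"
    unfolding \<phi>_def using le by (intro cSUP_least) auto
qed

lemma \<phi>_eqI:
  assumes t: "t \<in> {0..1}" and v: "\<And>n. bound n False t \<le> v \<and> v \<le> bound n True t"
  shows "v = \<phi> t"
proof -
  have "\<bar>v - \<phi> t\<bar> \<le> \<epsilon>" if "\<epsilon> > 0" for \<epsilon>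
  proof -
    obtain n where "gap n t \<le> \<epsilon>"
      using gap_uniform[OF \<open>\<epsilon> > 0\<close>] t by blast
    then show ?thesis
      using v[of n] \<phi>_between[OF t, of n] by (auto simp: gap_def)
  qed
  then have "\<bar>v - \<phi> t\<bar> \<le> 0"
    by (rule field_le_epsilon) simp
  then show ?thesis by simp
qed

text \<open>
  The branches are monotone, so every solution of the functional equation stays between the bounds of
  every stage, and these pinch it to \<open>\<phi>\<close>.
\<close>
lemma fixed_point_unique:
  assumes within: "\<And>t. t \<in> {0..1} \<Longrightarrow> lower t \<le> F t \<and> F t \<le> lower t + mass t"
    and fixed: "\<And>t. t \<in> {0..1} \<Longrightarrow> t \<notin> C \<Longrightarrow> F t = branch (cell t) (F (f t))"
    and "t \<in> {0..1}"
  shows "F t = \<phi> t"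
proof -
  have "bound n False t \<le> F t \<and> F t \<le> bound n True t" if "t \<in> {0..1}" for n t
    using that
  proof (induction n arbitrary: t)
    case 0
    then show ?case using within by simp
  next
    case (Suc n)
    show ?case
    proof (cases "t \<in> C")
      case True
      then show ?thesis using within[OF Suc.prems] by (simp add: mass_C)
    next
      case False
      have IH: "bound n False (f t) \<le> F (f t)" "F (f t) \<le> bound n True (f t)"
        using Suc.IH[OF f_unit[OF Suc.prems]] by auto
      show ?thesis
        using branch_mono[OF IH(1), of "cell t"] branch_mono[OF IH(2), of "cell t"] False
          fixed[OF Suc.prems False] by (cases "increasing (cell t)") simp_all
    qed
  qed
  then show ?thesis
    using \<open>t \<in> {0..1}\<close> by (intro \<phi>_eqI) auto
qed

lemma \<phi>_within: "t \<in> {0..1} \<Longrightarrow> lower t \<le> \<phi> t \<and> \<phi> t \<le> lower t + mass t"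
  using \<phi>_between[of t 0] by simp

lemma \<phi>_C: "c \<in> C \<Longrightarrow> \<phi> c = lower c"
  using \<phi>_within[of c] C_unit mass_C by fastforce

lemma \<phi>_unit: "t \<in> {0..1} \<Longrightarrow> \<phi> t \<in> {0..1}"
  using \<phi>_between[of t 0] bound_unit[of t 0 False] bound_unit[of t 0 True] by auto

lemma \<phi>_branch:
  assumes t: "t \<in> {0..1}" "t \<notin> C"
  shows "\<phi> t = branch (cell t) (\<phi> (f t))"
proof -
  have "branch (cell t) (\<phi> (f t)) = \<phi> t"
  proof (rule \<phi>_eqI[OF t(1)])
    fix n
    have *: "bound (Suc n) False t \<le> branch (cell t) (\<phi> (f t)) \<and> branch (cell t) (\<phi> (f t)) \<le> bound (Suc n) True t"
      using branch_mono[OF \<phi>_between(1)[OF f_unit[OF t(1)], of n], of "cell t"]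
        branch_mono[OF \<phi>_between(2)[OF f_unit[OF t(1)], of n], of "cell t"] t(2)
      by (cases "increasing (cell t)") simp_all
    then show "bound n False t \<le> branch (cell t) (\<phi> (f t)) \<and> branch (cell t) (\<phi> (f t)) \<le> bound n True t"
      using bound_improves[OF t(1), of n] by linarith
  qed
  then show ?thesis by simp
qed

text \<open>
  Between two points there is one that never meets \<open>C\<close>. Some iterate separates it from both, and it
  keeps a positive gap at that stage.
\<close>
lemma \<phi>_less:
  assumes "s \<in> {0..1}" "t \<in> {0..1}" "s < t"
  shows "\<phi> s < \<phi> t"
proof -
  have "countable (\<Union>n. {x \<in> {0..1}. (f ^^ n) x \<in> C})"
    using countable_preimage_C by blast
  then have "\<not> {s<..<t} \<subseteq> (\<Union>n. {x \<in> {0..1}. (f ^^ n) x \<in> C})"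
    using uncountable_open_interval[of s t] assms(3) countable_subset by blast
  then obtain x where "x \<in> {s<..<t}" "x \<notin> (\<Union>n. {x \<in> {0..1}. (f ^^ n) x \<in> C})"
    by blast
  moreover from this have x01: "x \<in> {0..1}"
    using assms by auto
  ultimately have x: "s < x" "x < t" "\<And>n. (f ^^ n) x \<notin> C"
    by auto
  obtain k1 k2 where k: "\<forall>i\<in>\<I>. \<not> ((f ^^ k1) s \<in> i \<and> (f ^^ k1) x \<in> i)" "\<forall>i\<in>\<I>. \<not> ((f ^^ k2) x \<in> i \<and> (f ^^ k2) t \<in> i)"
    using orbits_separate[OF assms(1) x01 x(1)] orbits_separate[OF x01 assms(2) x(2)] by blast
  define n where "n = max k1 k2"
  have "\<exists>k\<le>n. \<forall>i\<in>\<I>. \<not> ((f ^^ k) s \<in> i \<and> (f ^^ k) x \<in> i)" "\<exists>k\<le>n. \<forall>i\<in>\<I>. \<not> ((f ^^ k) x \<in> i \<and> (f ^^ k) t \<in> i)"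
    using k by (auto simp: n_def intro: max.cobounded1 max.cobounded2)
  then have "bound n True s \<le> bound n False x" "bound n True x \<le> bound n False t"
    using bound_separate[OF assms(1) x01 x(1)] bound_separate[OF x01 assms(2) x(2)] by auto
  moreover have "bound n False x < bound n True x"
    using gap_pos[OF x01 x(3), of n] by (simp add: gap_def)
  ultimately show ?thesis
    using \<phi>_between(2)[OF assms(1), of n] \<phi>_between(1)[OF assms(2), of n] by linarith
qed

lemma \<phi>_strict_mono: "strict_mono_on {0..1} \<phi>"
  using \<phi>_less by (auto intro: strict_mono_onI)

lemma \<phi>_inj: "inj_on \<phi> {0..1}"
  using \<phi>_strict_mono by (rule strict_mono_on_imp_inj_on)

lemma \<phi>_less_iff: "s \<in> {0..1} \<Longrightarrow> t \<in> {0..1} \<Longrightarrow> \<phi> s < \<phi> t \<longleftrightarrow> s < t"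
  using \<phi>_strict_mono by (rule strict_mono_on_less)

lemma lower_endpoints:
  assumes ab: "i \<in> \<I>" "i = {a<..<b}" "a \<in> C" "b \<in> C"
  shows "lower a = left i" "lower b = left i + \<pi> i"
proof -
  obtain t where t: "t \<in> i" using \<I>_nonempty ab by blast
  note t01 = \<I>_unit[OF ab(1) t]
  have at: "a < t" "t < b" using t ab(2) by auto
  note lt = left_eq_lower[OF ab(1) t] mass_eq[OF ab(1) t]
  have "W_single X {t} \<subseteq> W_single X {a}"
  proof
    fix k assume "k \<in> W_single X {t}"
    then have k: "k \<in> \<I>" "\<And>x. x \<in> k \<Longrightarrow> x < t" unfolding W_single_point by auto
    have "x < a" if "x \<in> k" for x
    proof (rule ccontr)
      assume "\<not> x < a"
      then have "x \<in> i"
        using k(2)[OF that] \<I>_not_C[OF k(1) that] at ab(2,3) by (cases "x = a") auto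
      then show False
        using \<I>_unique[OF k(1) ab(1) that] k(2) t by blast
    qed
    then show "k \<in> W_single X {a}" unfolding W_single_point using k(1) by blast
  qed
  then have "lower t \<le> lower a"
    unfolding lower_def left_def by (rule infsum_\<pi>_mono[OF _ W_single_\<I>])
  then show "lower a = left i"
    using lower_step_C[OF C_unit[OF ab(3)] t01 at(1)] ab(3) mass_C[OF ab(3)] lt by simp
  have "W_single X {b} \<subseteq> {l \<in> \<I>. (\<forall>a\<in>l. a < t) \<or> t \<in> l}"
  proof
    fix k assume "k \<in> W_single X {b}"
    then have k: "k \<in> \<I>" "\<And>x. x \<in> k \<Longrightarrow> x < b" unfolding W_single_point by auto
    have "x < t" if "x \<in> k" "t \<notin> k" for x
    proof (rule ccontr)
      assume "\<not> x < t"
      then have "x \<in> i"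
        using k(2)[OF that(1)] at ab(2) by auto
      then show False
        using \<I>_unique[OF k(1) ab(1) that(1)] that(2) t by blast
    qed
    then show "k \<in> {l \<in> \<I>. (\<forall>a\<in>l. a < t) \<or> t \<in> l}" using k(1) by blast
  qed
  then have "lower b \<le> lower t + mass t"
    unfolding lower_plus_mass[OF t01] unfolding lower_def left_def by (rule infsum_\<pi>_mono) auto
  then show "lower b = left i + \<pi> i"
    using lower_step_C[OF t01 C_unit[OF ab(4)] at(2)] ab(4) lt by simp
qed

text \<open>
  A value outside all the closed intervals \<open>{left l..left l + \<pi> l}\<close> is the total length of the intervals
  \<open>J l\<close> below it, and it is attained at the supremum of these partition intervals.
\<close>
lemma lower_dense:
  assumes v: "v \<in> {0..1}"
  shows "\<exists>s\<in>{0..1}. lower s \<le> v \<and> v \<le> lower s + mass s"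
proof (cases "\<exists>l\<in>\<I>. v \<in> {left l..left l + \<pi> l}")
  case True
  then obtain l t where l: "l \<in> \<I>" "v \<in> {left l..left l + \<pi> l}" "t \<in> l"
    using \<I>_nonempty by blast
  then show ?thesis
    using left_eq_lower[OF l(1,3)] mass_eq[OF l(1,3)] \<I>_unit[OF l(1,3)] by (intro bexI[of _ t]) auto
next
  case False
  define S where "S = {l \<in> \<I>. left l + \<pi> l \<le> v}"
  define s where "s = Sup (insert 0 (\<Union>S))"
  have S01: "insert 0 (\<Union>S) \<subseteq> {0..1}"
    using \<I>_unit by (auto simp: S_def)
  have bdd: "bdd_above (insert 0 (\<Union>S))"
    using S01 by (rule bdd_above_mono[rotated]) simp
  have s01: "s \<in> {0..1}"
    unfolding s_def using S01 by (auto intro!: cSup_upper cSup_least bdd)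
  have "W_single X {s} = S"
  proof (intro equalityI subsetI)
    fix l assume "l \<in> S"
    then have l: "l \<in> \<I>" by (simp add: S_def)
    have "x < s" if x: "x \<in> l" for x
    proof -
      obtain a b where ab: "l = {a<..<b}"
        using \<I>_endpoints[OF l] by blast
      then obtain y where "x < y" "y \<in> l"
        using x dense[of x b] by auto
      moreover have "y \<le> s"
        unfolding s_def using \<open>y \<in> l\<close> \<open>l \<in> S\<close> by (intro cSup_upper bdd) blast
      ultimately show ?thesis by simp
    qed
    then show "l \<in> W_single X {s}"
      unfolding W_single_point using l by blast
  next
    fix l assume "l \<in> W_single X {s}"
    then have l: "l \<in> \<I>" "\<And>x. x \<in> l \<Longrightarrow> x < s" unfolding W_single_point by auto
    obtain x where x: "x \<in> l" using \<I>_nonempty l by blast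
    then have "x < Sup (insert 0 (\<Union>S))"
      using l(2) unfolding s_def by blast
    then obtain y where y: "y \<in> insert 0 (\<Union>S)" "x < y"
      using less_cSup_iff[OF _ bdd] by blast
    then obtain k where k: "k \<in> S" "y \<in> k"
      using \<I>_unit[OF l(1) x] by auto
    then have "k \<in> \<I>" "left k + \<pi> k \<le> v" by (auto simp: S_def)
    then have "left l + \<pi> l \<le> v"
      using J_ordered[OF l(1) \<open>k \<in> \<I>\<close> x k(2) y(2)] \<pi>_pos[of k] by (cases "l = k") auto
    then show "l \<in> S"
      using l(1) by (simp add: S_def)
  qed
  then have "lower s = infsum \<pi> S"
    by (simp add: lower_def left_def)
  also have "\<dots> = v"
  proof (rule infsumI)
    have "clip l v = (if l \<in> S then \<pi> l else 0)" if "l \<in> \<I>" for l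
      using False that \<pi>_pos[OF that] by (auto simp: clip_def S_def)
    then have "((\<lambda>l. if l \<in> S then \<pi> l else 0) has_sum v) \<I>"
      by (intro has_sum_cong[THEN iffD1, OF _ clip_sum[OF v]]) blast
    then show "(\<pi> has_sum v) S"
      by (rule has_sum_cong_neutral[THEN iffD1, rotated -1]) (auto simp: S_def)
  qed
  finally show ?thesis
    using s01 mass_nonneg[OF s01] by (intro bexI[of _ s]) auto
qed

text \<open>
  Every value is admissible for some point at every stage. A value in \<open>J i\<close> is \<open>branch i w\<close> for some \<open>w\<close>
  by the intermediate value theorem, and a point \<open>z\<close> for which \<open>w\<close> is admissible at the previous stage lies
  in \<open>f ` i\<close>, because \<open>w\<close> is strictly between the values at the two ends of \<open>f ` i\<close>.
\<close>
lemma bound_dense: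
  assumes "v \<in> {0..1}"
  shows "\<exists>s\<in>{0..1}. bound n False s \<le> v \<and> v \<le> bound n True s"
  using assms
proof (induction n arbitrary: v)
  case 0
  then show ?case using lower_dense by simp
next
  case (Suc n)
  have point: ?case if "c \<in> C" "v = lower c" for c
    using that bound_C[OF that(1)] C_unit[OF that(1)] by (intro bexI[of _ c]) (simp_all del: bound.simps)
  obtain s where s: "s \<in> {0..1}" "lower s \<le> v" "v \<le> lower s + mass s"
    using lower_dense Suc.prems by blast
  show ?case
  proof (cases "s \<in> C")
    case True
    then show ?thesis
      using point[of s] s mass_C by simp
  next
    case False
    define i where "i = cell s"
    have i: "i \<in> \<I>" "s \<in> i"
      using cell_\<I>[OF s(1) False] in_cell[OF s(1) False] by (auto simp: i_def)
    obtain a b where ab: "i = {a<..<b}" "a \<in> C" "b \<in> C"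
      using \<I>_endpoints[OF i(1)] by metis
    note ends = lower_endpoints[OF i(1) ab]
    have v: "left i \<le> v" "v \<le> left i + \<pi> i"
      using s left_eq_lower[OF i] mass_eq[OF i] by auto
    show ?thesis
    \<comment> \<open>At the ends of \<open>J i\<close> the value \<open>w\<close> would belong to an end of \<open>f ` i\<close>, which is not attained on \<open>i\<close>.\<close>
    proof (cases "v = left i \<or> v = left i + \<pi> i")
      case True
      then show ?thesis
        using point[OF ab(2)] point[OF ab(3)] ends by metis
    next
      case False
      let ?p = "lower (lo i)" and ?q = "lower (hi i)"
      have C: "lo i \<in> C" "hi i \<in> C" using lo_C hi_C i by auto
      note C01 = C_unit[OF C(1)] C_unit[OF C(2)]
      have pq: "?p \<le> ?q"
        using lower_step_C[OF C01 lo_less_hi[OF i(1)]] C mass_C by simp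
      have pq01: "{?p..?q} \<subseteq> {0..1}"
        using lower_unit[OF C01(1)] lower_unit[OF C01(2)] by auto
      have cont: "continuous_on {?p..?q} (branch i)"
        unfolding branch_def using continuous_on_subset[OF K_continuous pq01]
        by (cases "increasing i") (auto intro!: continuous_intros)
      have ep: "branch i ?p = (if increasing i then left i else left i + \<pi> i)"
        "branch i ?q = (if increasing i then left i + \<pi> i else left i)"
        using K_image[OF i(1)] by (auto simp: branch_def)
      obtain w where w: "?p \<le> w" "w \<le> ?q" "branch i w = v"
        using IVT'[of "branch i" ?p v ?q] IVT2'[of "branch i" ?q v ?p] cont ep v pq
        by (cases "increasing i") auto
      then have "?p < w" "w < ?q"
        using ep False by (cases "increasing i"; simp add: order_less_le; metis)+
      obtain z where z: "z \<in> {0..1}" "bound n False z \<le> w" "w \<le> bound n True z"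
        using Suc.IH[of w] w pq01 by auto
      have zz: "lower z \<le> w" "w \<le> lower z + mass z"
        using bound_within[OF z(1), of n False] bound_within[OF z(1), of n True] z by auto
      have "lo i < z"
      proof (rule ccontr)
        assume "\<not> lo i < z"
        then have "lower z + mass z \<le> ?p"
          using lower_step_C[OF z(1) C01(1)] C mass_C[OF C(1)] by (cases "z = lo i") auto
        then show False using zz \<open>?p < w\<close> by simp
      qed
      moreover have "z < hi i"
      proof (rule ccontr)
        assume "\<not> z < hi i"
        then have "?q \<le> lower z"
          using lower_step_C[OF C01(2) z(1)] C mass_C[OF C(2)] by (cases "z = hi i") auto
        then show False using zz \<open>w < ?q\<close> by simp
      qed
      ultimately have "z \<in> f ` i"
        unfolding image_interval[OF i(1)] by simp
      then obtain x where x: "x \<in> i" "z = f x" by blast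
      have "bound (Suc n) s x = branch i (bound n (s = increasing i) z)" for s
        using \<I>_not_C[OF i(1) x(1)] cell_eq[OF i(1) x(1)] x(2) by simp
      then have "bound (Suc n) False x \<le> v \<and> v \<le> bound (Suc n) True x"
        using branch_mono[OF z(2), of i] branch_mono[OF z(3), of i] w(3)
        by (cases "increasing i") (simp_all del: bound.simps)
      then show ?thesis
        using \<I>_unit[OF i(1) x(1)] by blast
    qed
  qed
qed

lemma \<phi>_0: "\<phi> 0 = 0" and \<phi>_1: "\<phi> 1 = 1"
  using \<phi>_C zero_C one_C lower_0 lower_1 by auto

lemma \<phi>_continuous: "continuous_on {0..1} \<phi>"
proof (rule continuous_on_mono_dense_image)
  show "mono_on {0..1} \<phi>"
    using \<phi>_strict_mono by (rule strict_mono_on_imp_mono_on)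
  show "\<phi> ` {0..1} \<subseteq> {0..1}"
    using \<phi>_unit by blast
  fix v e :: real assume v: "v \<in> {0..1}" and e: "e > 0"
  obtain n where n: "\<forall>t\<in>{0..1}. gap n t \<le> e"
    using gap_uniform[OF e] by blast
  obtain s where s: "s \<in> {0..1}" "bound n False s \<le> v" "v \<le> bound n True s"
    using bound_dense[OF v] by blast
  then have "\<bar>\<phi> s - v\<bar> \<le> gap n s"
    using \<phi>_between[OF s(1), of n] by (auto simp: gap_def)
  then show "\<exists>s\<in>{0..1}. \<bar>\<phi> s - v\<bar> \<le> e"
    using n s(1) by force
qed

lemma \<phi>_onto: "\<phi> ` {0..1} = {0..1}"
proof
  show "\<phi> ` {0..1} \<subseteq> {0..1}"
    using \<phi>_unit by blast
  show "{0..1} \<subseteq> \<phi> ` {0..1}"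
  proof
    fix v :: real assume "v \<in> {0..1}"
    then obtain t where "0 \<le> t" "t \<le> 1" "\<phi> t = v"
      using IVT'[of \<phi> 0 v 1] \<phi>_continuous \<phi>_0 \<phi>_1 by auto
    then show "v \<in> \<phi> ` {0..1}" by auto
  qed
qed

definition \<psi> :: "real \<Rightarrow> real" where
  "\<psi> = (SOME \<psi>. homeomorphism {0..1} {0..1} \<phi> \<psi>)"

lemma \<phi>_homeomorphism: "homeomorphism {0..1} {0..1} \<phi> \<psi>"
  unfolding \<psi>_def
  using homeomorphism_compact[OF compact_Icc \<phi>_continuous \<phi>_onto \<phi>_inj] by (rule someI_ex)

lemma \<psi>_\<phi>: "t \<in> {0..1} \<Longrightarrow> \<psi> (\<phi> t) = t"
  and \<psi>_unit: "v \<in> {0..1} \<Longrightarrow> \<psi> v \<in> {0..1}"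
  using \<phi>_homeomorphism unfolding homeomorphism_def by blast+

definition g :: "real \<Rightarrow> real" where
  "g v = \<phi> (f (\<psi> v))"

lemma g_\<phi>: "t \<in> {0..1} \<Longrightarrow> g (\<phi> t) = \<phi> (f t)"
  by (simp add: g_def \<psi>_\<phi>)

lemma g_unit: "v \<in> {0..1} \<Longrightarrow> g v \<in> {0..1}"
  unfolding g_def using \<psi>_unit f_unit \<phi>_unit by blast

lemma \<phi>_image_\<I>:
  assumes "i \<in> \<I>"
  shows "\<phi> ` i = J i"
proof -
  obtain a b where ab: "i = {a<..<b}" "a \<in> C" "b \<in> C"
    using \<I>_endpoints[OF assms] by metis
  have e: "\<phi> a = left i" "\<phi> b = left i + \<pi> i"
    using lower_endpoints[OF assms ab] \<phi>_C ab by auto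
  note 01 = C_unit[OF ab(2)] C_unit[OF ab(3)]
  show ?thesis
  proof (intro equalityI subsetI)
    fix v assume "v \<in> \<phi> ` i"
    then obtain t where t: "t \<in> i" "v = \<phi> t" by blast
    then show "v \<in> J i"
      using \<phi>_less_iff[OF 01(1) \<I>_unit[OF assms t(1)]] \<phi>_less_iff[OF \<I>_unit[OF assms t(1)] 01(2)] ab e
      by (simp add: J_def)
  next
    fix v assume v: "v \<in> J i"
    then have "v \<in> {0..1}" using J_unit[OF assms] by blast
    then obtain t where t: "t \<in> {0..1}" "v = \<phi> t" using \<phi>_onto by blast
    then have "t \<in> i"
      using v e \<phi>_less_iff[OF 01(1) t(1)] \<phi>_less_iff[OF t(1) 01(2)] ab(1) by (simp add: J_def)
    then show "v \<in> \<phi> ` i" using t by blast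
  qed
qed

end

section \<open>Fairness and injectivity partitions\<close>

text \<open>
  An element of the refinement chooses one side of each of the partitions \<open>{h ` Z, {0..1} - h ` Z}\<close>, and
  any of its points \<open>x\<close> reveals the choice.
\<close>
lemma image_refinement_eq:
  assumes A: "A \<in> image_refinement h \<Z>" "x \<in> A" and \<Z>: "\<Z> \<noteq> {}" "\<And>Z. Z \<in> \<Z> \<Longrightarrow> h ` Z \<subseteq> {0..1}"
  shows "A = {y \<in> {0..1}. \<forall>Z\<in>\<Z>. y \<in> h ` Z \<longleftrightarrow> x \<in> h ` Z}"
proof -
  let ?P = "\<lambda>Z. {h ` Z, {0..1} - h ` Z}"
  obtain F where F: "F \<in> (\<Pi> P\<in>?P ` \<Z>. P)" and A_eq: "A = \<Inter> (F ` (?P ` \<Z>))"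
    using A(1) unfolding image_refinement_def common_refinement by blast
  have mem: "y \<in> A \<longleftrightarrow> (\<forall>Z\<in>\<Z>. y \<in> F (?P Z))" for y
    unfolding A_eq by blast
  have FZ: "F (?P Z) = h ` Z \<or> F (?P Z) = {0..1} - h ` Z" if "Z \<in> \<Z>" for Z
    using Pi_mem[OF F imageI[OF that]] by blast
  have *: "y \<in> F (?P Z) \<longleftrightarrow> y \<in> {0..1} \<and> (y \<in> h ` Z \<longleftrightarrow> x \<in> h ` Z)" if Z: "Z \<in> \<Z>" for y Z
  proof -
    have "x \<in> F (?P Z)"
      using A(2) mem Z by blast
    then show ?thesis
      using FZ[OF Z] \<Z>(2)[OF Z] by blast
  qed
  show ?thesis
  proof (rule set_eqI)
    fix y
    have "y \<in> A \<longleftrightarrow> (\<forall>Z\<in>\<Z>. y \<in> {0..1} \<and> (y \<in> h ` Z \<longleftrightarrow> x \<in> h ` Z))"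
      unfolding mem by (rule ball_cong[OF refl *])
    then show "y \<in> A \<longleftrightarrow> y \<in> {y \<in> {0..1}. \<forall>Z\<in>\<Z>. y \<in> h ` Z \<longleftrightarrow> x \<in> h ` Z}"
      unfolding mem_Collect_eq using \<Z>(1) by blast
  qed
qed

lemma Union_image_refinement:
  assumes "\<Z> \<noteq> {}" "\<And>Z. Z \<in> \<Z> \<Longrightarrow> h ` Z \<subseteq> {0..1}"
  shows "\<Union> (image_refinement h \<Z>) = {0..1}"
  unfolding image_refinement_def Union_common_refinement using assms by (simp add: Un_absorb1)

lemma image_refinement_borel:
  assumes "A \<in> image_refinement h \<Z>" "\<Z> \<noteq> {}" "countable \<Z>"
    "\<And>Z. Z \<in> \<Z> \<Longrightarrow> h ` Z \<in> sets borel \<and> h ` Z \<subseteq> {0..1}"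
  shows "A \<in> sets borel"
proof -
  have "A \<noteq> {}"
    using assms(1) by (simp add: image_refinement_def common_refinement_def)
  then obtain x where x: "x \<in> A" by blast
  define B where "B Z = (if x \<in> h ` Z then h ` Z else {0..1} - h ` Z)" for Z
  have eq: "A = {y \<in> {0..1}. \<forall>Z\<in>\<Z>. y \<in> h ` Z \<longleftrightarrow> x \<in> h ` Z}"
    by (rule image_refinement_eq[OF assms(1) x assms(2)]) (use assms(4) in blast)
  have B: "y \<in> B Z \<longleftrightarrow> y \<in> {0..1} \<and> (y \<in> h ` Z \<longleftrightarrow> x \<in> h ` Z)" if "Z \<in> \<Z>" for y Z
    using assms(4)[OF that] unfolding B_def by auto
  have "y \<in> A \<longleftrightarrow> (\<forall>Z\<in>\<Z>. y \<in> B Z)" for y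
  proof -
    have "y \<in> A \<longleftrightarrow> y \<in> {0..1} \<and> (\<forall>Z\<in>\<Z>. y \<in> h ` Z \<longleftrightarrow> x \<in> h ` Z)"
      by (subst eq) (rule mem_Collect_eq)
    also have "\<dots> \<longleftrightarrow> (\<forall>Z\<in>\<Z>. y \<in> {0..1} \<and> (y \<in> h ` Z \<longleftrightarrow> x \<in> h ` Z))"
      using assms(2) by blast
    also have "\<dots> \<longleftrightarrow> (\<forall>Z\<in>\<Z>. y \<in> B Z)"
      by (rule ball_cong[OF refl B[symmetric]])
    finally show ?thesis .
  qed
  then have "A = (\<Inter>Z\<in>\<Z>. B Z)"
    by blast
  moreover have "(\<Inter>Z\<in>\<Z>. B Z) \<in> sets borel"
    using assms by (intro sets.countable_INT') (auto simp: B_def)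
  ultimately show ?thesis by simp
qed

text \<open>
  The image refinement is coarser than any cover whose members are not cut by the images \<open>h ` Z\<close>, so
  its elements can be labelled by members of the cover.
\<close>
lemma countable_image_refinement:
  assumes "\<Z> \<noteq> {}" "\<And>Z. Z \<in> \<Z> \<Longrightarrow> h ` Z \<subseteq> {0..1}" "countable \<Q>" "{0..1} \<subseteq> \<Union>\<Q>"
    and dich: "\<And>q Z. q \<in> \<Q> \<Longrightarrow> Z \<in> \<Z> \<Longrightarrow> q \<subseteq> {0..1} \<and> (q \<subseteq> h ` Z \<or> q \<inter> h ` Z = {})"
  shows "countable (image_refinement h \<Z>)"
proof -
  let ?R = "image_refinement h \<Z>"
  note eq = image_refinement_eq[OF _ _ assms(1,2)]
  have ex: "\<exists>q\<in>\<Q>. q \<noteq> {} \<and> q \<subseteq> A" if A: "A \<in> ?R" for A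
  proof -
    have "A \<noteq> {}"
      using A by (simp add: image_refinement_def common_refinement_def)
    then obtain x where x: "x \<in> A" by blast
    have "A \<subseteq> {0..1}"
      using Union_image_refinement[OF assms(1,2)] A by blast
    then obtain q where q: "q \<in> \<Q>" "x \<in> q"
      using x assms(4) by blast
    have "q \<subseteq> {y \<in> {0..1}. \<forall>Z\<in>\<Z>. y \<in> h ` Z \<longleftrightarrow> x \<in> h ` Z}"
      using dich[OF q(1)] q(2) assms(1) by blast
    then show ?thesis
      using eq[OF A x] q by blast
  qed
  then obtain c where c: "\<And>A. A \<in> ?R \<Longrightarrow> c A \<in> \<Q> \<and> c A \<noteq> {} \<and> c A \<subseteq> A"
    by metis
  have "inj_on c ?R"
  proof (rule inj_onI)
    fix A B assume AB: "A \<in> ?R" "B \<in> ?R" "c A = c B"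
    then obtain x where "x \<in> A" "x \<in> B"
      using c[OF AB(1)] c[OF AB(2)] by auto
    then show "A = B"
      using eq[OF AB(1), of x] eq[OF AB(2), of x] by simp
  qed
  moreover have "countable (c ` ?R)"
    using c by (intro countable_subset[OF _ assms(3)]) auto
  ultimately show ?thesis
    using countable_image_inj_on by blast
qed

lemma sets_restrict_unit: "A \<in> sets (restrict_space lborel {0..1::real}) \<longleftrightarrow> A \<subseteq> {0..1} \<and> A \<in> sets borel"
  by (simp add: sets_restrict_space_iff)

lemma measure_restrict_unit: "A \<subseteq> {0..1::real} \<Longrightarrow> measure (restrict_space lborel {0..1}) A = measure lborel A"
  by (rule measure_restrict_space) auto

text \<open>
  A fair Lebesgue measure is divided by the number \<open>n\<close> of preimages along every injective piece \<open>E\<close>,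
  whichever partition witnesses the fairness. Cutting \<open>E\<close> along the partition and its image refinement
  yields pieces of the form \<open>Z \<inter> h -` B\<close>, and the covering elements of \<open>B\<close> correspond to the preimages
  of any of its points.
\<close>
lemma fair_measure_injective_piece:
  assumes fair: "Lebesgue_fair h"
    and E: "E \<in> sets borel" "E \<subseteq> {0..1}" "inj_on h E"
    and n: "n \<ge> 1" "\<And>b. b \<in> h ` E \<Longrightarrow> card {x \<in> {0..1}. h x = b} = n"
  shows "measure lborel E = measure lborel (h ` E) / n"
proof -
  let ?\<mu> = "restrict_space lborel {0..1::real}"
  have h: "h \<in> ?\<mu> \<rightarrow>\<^sub>M ?\<mu>" and ex: "\<exists>\<Z>. injectivity_partition h \<Z> \<and>
      (\<forall>A\<in>image_refinement h \<Z>. \<forall>B\<in>sets borel. B \<subseteq> A \<longrightarrow> (\<forall>Z\<in>covering_elements h \<Z> B.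
        measure ?\<mu> (Z \<inter> h -` B) = (if finite (covering_elements h \<Z> B)
          then measure ?\<mu> B / real (card (covering_elements h \<Z> B)) else 0)))"
    using fair unfolding Lebesgue_fair_def fair_measure_def by - (elim conjE, assumption)+
  obtain \<Z> where \<Z>: "injectivity_partition h \<Z>"
    and F': "\<forall>A\<in>image_refinement h \<Z>. \<forall>B\<in>sets borel. B \<subseteq> A \<longrightarrow> (\<forall>Z\<in>covering_elements h \<Z> B.
        measure ?\<mu> (Z \<inter> h -` B) = (if finite (covering_elements h \<Z> B)
          then measure ?\<mu> B / real (card (covering_elements h \<Z> B)) else 0))"
    using ex by (elim exE conjE)
  note F = F'[rule_format]
  let ?R = "image_refinement h \<Z>"
  have cZ: "countable \<Z>" and part: "partition_on {0..1} \<Z>" and cR: "countable ?R"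
    and bor: "\<And>Z. Z \<in> \<Z> \<Longrightarrow> Z \<in> sets borel" "\<And>Z. Z \<in> \<Z> \<Longrightarrow> h ` Z \<in> sets borel"
    and iso: "\<And>Z. Z \<in> \<Z> \<Longrightarrow> borel_isomorphism_on h Z"
    using \<Z> unfolding injectivity_partition_def by blast+
  have UZ: "\<Union>\<Z> = {0..1}" using partition_onD1[OF part] by simp
  have Zdisj: "Z = Z'" if "Z \<in> \<Z>" "Z' \<in> \<Z>" "x \<in> Z" "x \<in> Z'" for Z Z' x
    using partition_onD2[OF part] that by (auto simp: disjoint_def)
  have h01: "h x \<in> {0..1}" if "x \<in> {0..1}" for x
    using measurable_space[OF h, of x] that by simp
  have Zne: "\<Z> \<noteq> {}"
    using UZ by auto
  have hZ: "h ` Z \<subseteq> {0..1}" if "Z \<in> \<Z>" for Z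
    using h01 that UZ by blast
  note R_eq = image_refinement_eq[OF _ _ Zne hZ]
  have UR: "\<Union>?R = {0..1}"
    by (rule Union_image_refinement[OF Zne hZ])
  have Rbor: "A \<in> sets borel" if "A \<in> ?R" for A
    by (rule image_refinement_borel[OF that Zne cZ]) (use bor hZ in blast)
  define T where "T = \<Z> \<times> ?R"
  \<comment> \<open>On the piece of \<open>E\<close> indexed by \<open>(Z, A)\<close> fairness applies to \<open>Z\<close> and to the image of the piece.\<close>
  define D where "D p = E \<inter> fst p \<inter> h -` snd p" for p
  have cT: "countable T"
    unfolding T_def using cZ cR by blast
  have UD: "(\<Union>p\<in>T. D p) = E"
  proof
    show "E \<subseteq> (\<Union>p\<in>T. D p)"
    proof
      fix x assume x: "x \<in> E"
      then have "x \<in> \<Union>\<Z>" "h x \<in> \<Union>?R"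
        unfolding UZ UR using E(2) h01 by blast+
      then obtain Z A where "Z \<in> \<Z>" "x \<in> Z" "A \<in> ?R" "h x \<in> A"
        by blast
      then show "x \<in> (\<Union>p\<in>T. D p)"
        unfolding T_def D_def using x by (intro UN_I[of "(Z, A)"]) auto
    qed
  qed (auto simp: D_def)
  have D_unique: "p = q" if "p \<in> T" "q \<in> T" "x \<in> D p" "x \<in> D q" for p q x
  proof (rule prod_eqI)
    show "fst p = fst q"
      using that Zdisj[of "fst p" "fst q" x] by (simp add: T_def D_def mem_Times_iff)
    have pq: "snd p \<in> ?R" "snd q \<in> ?R" "h x \<in> snd p" "h x \<in> snd q"
      using that by (auto simp: T_def D_def)
    then show "snd p = snd q"
      using R_eq[OF pq(1,3)] R_eq[OF pq(2,4)] by simp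
  qed
  have Dbor: "D p \<in> sets borel" if "p \<in> T" for p
  proof -
    have A: "snd p \<in> sets ?\<mu>"
      unfolding sets_restrict_unit using that Rbor UR by (auto simp: T_def)
    have "h -` snd p \<inter> {0..1} \<in> sets ?\<mu>"
      using measurable_sets[OF h A] by simp
    then have "h -` snd p \<inter> {0..1} \<in> sets borel"
      unfolding sets_restrict_unit by simp
    moreover have "D p = E \<inter> fst p \<inter> (h -` snd p \<inter> {0..1})"
      unfolding D_def using E(2) by blast
    ultimately show ?thesis
      using E(1) bor that by (auto simp: T_def)
  qed
  have hDbor: "h ` D p \<in> sets borel" if p: "p \<in> T" for p
  proof -
    let ?Z = "fst p"
    have Z: "?Z \<in> \<Z>" using p by (auto simp: T_def)
    have inj: "inj_on h ?Z" and m: "the_inv_into ?Z h \<in> restrict_space borel (h ` ?Z) \<rightarrow>\<^sub>M restrict_space borel ?Z"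
      using iso[OF Z] unfolding borel_isomorphism_on_def by blast+
    have "D p \<in> sets (restrict_space borel ?Z)"
      using Dbor[OF p] bor[OF Z] by (subst sets_restrict_space_iff) (auto simp: D_def)
    then have "the_inv_into ?Z h -` D p \<inter> h ` ?Z \<in> sets (restrict_space borel (h ` ?Z))"
      using measurable_sets[OF m] by (simp add: space_restrict_space)
    moreover have "the_inv_into ?Z h -` D p \<inter> h ` ?Z = h ` D p"
    proof (intro equalityI subsetI)
      fix y assume "y \<in> the_inv_into ?Z h -` D p \<inter> h ` ?Z"
      then show "y \<in> h ` D p"
        using f_the_inv_into_f[OF inj, of y] by (metis IntE imageI vimageE)
    next
      fix y assume "y \<in> h ` D p"
      then show "y \<in> the_inv_into ?Z h -` D p \<inter> h ` ?Z"
        using the_inv_into_f_f[OF inj] by (auto simp: D_def)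
    qed
    ultimately show ?thesis
      using bor(2)[OF Z] by (subst (asm) sets_restrict_space_iff) auto
  qed
  have piece: "measure lborel (D p) = measure lborel (h ` D p) / n" if p: "p \<in> T" for p
  proof (cases "D p = {}")
    case False
    obtain Z A where pe: "p = (Z, A)" by fastforce
    have Z: "Z \<in> \<Z>" and A: "A \<in> ?R" using p by (auto simp: T_def pe)
    have inj: "inj_on h Z"
      using iso[OF Z] unfolding borel_isomorphism_on_def by blast
    let ?B = "h ` D p"
    have BA: "?B \<subseteq> A" and BZ: "?B \<subseteq> h ` Z" and DZ: "D p \<subseteq> Z" and DE: "D p \<subseteq> E"
      by (auto simp: D_def pe)
    obtain b where b: "b \<in> ?B" using False by blast
    have cov: "covering_elements h \<Z> ?B = {Z' \<in> \<Z>. b \<in> h ` Z'}"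
    proof -
      have "?B \<subseteq> h ` Z'" if "Z' \<in> \<Z>" "b \<in> h ` Z'" for Z'
      proof -
        have "A \<subseteq> h ` Z'"
          using R_eq[OF A, of b] b BA that by blast
        then show ?thesis using BA by blast
      qed
      then show ?thesis
        unfolding covering_elements_def using b by blast
    qed
    define w where "w x = (THE Z'. Z' \<in> \<Z> \<and> x \<in> Z')" for x
    have w: "w x = Z'" if "Z' \<in> \<Z>" "x \<in> Z'" for x Z'
      unfolding w_def by (rule the_equality) (simp add: that, meson Zdisj that)
    let ?pre = "{x \<in> {0..1}. h x = b}"
    have im: "w ` ?pre = {Z' \<in> \<Z>. b \<in> h ` Z'}"
    proof (intro equalityI subsetI)
      fix Y assume "Y \<in> w ` ?pre"
      then obtain x where x: "x \<in> {0..1}" "h x = b" "Y = w x" by blast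
      then obtain Z' where "Z' \<in> \<Z>" "x \<in> Z'" using UZ by blast
      then show "Y \<in> {Z' \<in> \<Z>. b \<in> h ` Z'}"
        using w x by auto
    next
      fix Y assume "Y \<in> {Z' \<in> \<Z>. b \<in> h ` Z'}"
      then obtain x where x: "Y \<in> \<Z>" "x \<in> Y" "h x = b" by auto
      then have "x \<in> ?pre" using UZ by blast
      then show "Y \<in> w ` ?pre"
        using w[OF x(1,2)] by blast
    qed
    have inj_w: "inj_on w ?pre"
    proof (rule inj_onI)
      fix x y assume xy: "x \<in> ?pre" "y \<in> ?pre" "w x = w y"
      obtain Zx Zy where z: "Zx \<in> \<Z>" "x \<in> Zx" "Zy \<in> \<Z>" "y \<in> Zy"
        using xy(1,2) UZ by blast
      then have "Zx = Zy"
        using w xy(3) by simp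
      then show "x = y"
        using iso[OF z(1)] z xy(1,2) unfolding borel_isomorphism_on_def inj_on_def by simp
    qed
    have card_pre: "card ?pre = n"
      using n(2)[of b] b DE by blast
    then have "finite ?pre"
      using n(1) by (intro card_ge_0_finite) simp
    then have "finite (covering_elements h \<Z> ?B)"
      unfolding cov im[symmetric] by (rule finite_imageI)
    moreover have "card (covering_elements h \<Z> ?B) = n"
      unfolding cov im[symmetric] using card_image[OF inj_w] card_pre by simp
    moreover have "Z \<in> covering_elements h \<Z> ?B"
      unfolding covering_elements_def using Z BZ by blast
    moreover have "Z \<inter> h -` ?B = D p"
      using inj_onD[OF inj] DZ by blast
    ultimately have "measure ?\<mu> (D p) = measure ?\<mu> ?B / n"
      using F[OF A hDbor[OF p] BA] by fastforce
    moreover have "D p \<subseteq> {0..1}" "?B \<subseteq> {0..1}"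
      using DE E(2) h01 by blast+
    ultimately show ?thesis
      by (simp add: measure_restrict_unit)
  qed simp
  have hE: "h ` E \<subseteq> {0..1}"
    using h01 E(2) by blast
  have UhD: "(\<Union>p\<in>T. h ` D p) = h ` E"
    unfolding UD[symmetric] by blast
  have "((\<lambda>p. measure lborel (D p)) has_sum measure lborel (\<Union>p\<in>T. D p)) T"
  proof (intro has_sum_measure_UN emeasure_lborel_subset_unit_finite)
    show "disjoint_family_on D T"
      unfolding disjoint_family_on_def using D_unique by blast
  qed (use cT Dbor E(2) UD in auto)
  moreover have "((\<lambda>p. measure lborel (h ` D p)) has_sum measure lborel (\<Union>p\<in>T. h ` D p)) T"
  proof (intro has_sum_measure_UN emeasure_lborel_subset_unit_finite)
    show "disjoint_family_on (\<lambda>p. h ` D p) T"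
      unfolding disjoint_family_on_def
    proof (intro ballI impI, rule ccontr)
      fix p q assume pq: "p \<in> T" "q \<in> T" "p \<noteq> q" "h ` D p \<inter> h ` D q \<noteq> {}"
      then obtain x y where xy: "x \<in> D p" "y \<in> D q" "h x = h y" by blast
      then have "x = y"
        using inj_onD[OF E(3)] by (auto simp: D_def)
      then show False
        using D_unique[OF pq(1,2)] xy pq(3) by blast
    qed
  qed (use cT hDbor hE UhD in auto)
  then have "((\<lambda>p. measure lborel (D p)) has_sum measure lborel (h ` E) / n) T"
    unfolding UhD by (subst has_sum_cong[OF piece]) (simp, rule has_sum_divide_const)
  ultimately show ?thesis
    using has_sum_unique UD by metis
qed

section \<open>Uniqueness of the Lebesgue fair model\<close>

context fair_Markov_map
begin

text \<open>
  Points outside \<open>C\<close> have no preimages in \<open>C\<close>, and exactly one in every partition interval whose image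
  contains them.
\<close>
lemma card_fibre:
  assumes l: "l \<in> \<I>" "s \<in> l"
  shows "card {t \<in> {0..1}. f t = s} = card (preds l)"
proof -
  let ?S = "{t \<in> {0..1}. f t = s}"
  have step: "t \<in> cell t" "cell t \<in> preds l" if "t \<in> ?S" for t
  proof -
    have t: "t \<in> {0..1}" "f t \<notin> C" "cell (f t) = l"
      using that \<I>_not_C[OF l] cell_eq[OF l] by auto
    then show "t \<in> cell t" "cell t \<in> preds l"
      using orbit_step[OF t(1,2)] by simp_all
  qed
  have "bij_betw cell ?S (preds l)"
  proof (rule bij_betw_imageI)
    show "inj_on cell ?S"
    proof (rule inj_onI)
      fix t u assume tu: "t \<in> ?S" "u \<in> ?S" "cell t = cell u"
      have "cell t \<in> \<I>"
        using step(2)[OF tu(1)] by (simp add: preds_def)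
      then show "t = u"
        using f_inj[of "cell t"] step(1)[OF tu(1)] step(1)[OF tu(2)] tu by (auto simp: inj_on_def)
    qed
    show "cell ` ?S = preds l"
    proof (intro equalityI subsetI)
      fix i assume "i \<in> preds l"
      then have i: "i \<in> \<I>" "l \<subseteq> f ` i" by (auto simp: preds_def)
      then obtain t where t: "t \<in> i" "f t = s" using l(2) by blast
      then show "i \<in> cell ` ?S"
        using \<I>_unit[OF i(1) t(1)] cell_eq[OF i(1) t(1)] by blast
    qed (use step in auto)
  qed
  then show ?thesis
    by (rule bij_betw_same_card)
qed

lemma measure_J_between:
  assumes l: "l \<in> \<I>" and vw: "v \<in> {0..1}" "w \<in> {0..1}" "v \<le> w"
  shows "measure lborel (J l \<inter> {v<..<w}) = clip l w - clip l v"
proof -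
  have "J l \<inter> {v<..<w} = {max v (left l)<..<min w (left l + \<pi> l)}"
    by (auto simp: J_def)
  then show ?thesis
    using vw \<pi>_pos[OF l] by (auto simp: clip_def min_def max_def)
qed

text \<open>
  Let \<open>\<theta>\<close> conjugate \<open>f\<close> to \<open>h\<close>. Fairness along the injective pieces \<open>\<theta> ` (i \<inter> f -` l)\<close> shows first that the
  lengths of the intervals \<open>\<theta> ` l\<close> are stationary for the backward chain, hence equal to \<open>\<pi> l\<close>, which
  determines \<open>\<theta>\<close> on \<open>C\<close>. Applied to the part of \<open>i\<close> left of a point \<open>t\<close>, it then gives the functional
  equation for \<open>\<theta>\<close> at \<open>t\<close>.
\<close>
lemma fair_model_unique:
  assumes "Lebesgue_fair_model f h" "t \<in> {0..1}"
  shows "h t = g t"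
proof -
  have fair: "Lebesgue_fair h"
    using assms(1) by (simp add: Lebesgue_fair_model_def)
  obtain \<theta> \<theta>' where hom: "homeomorphism {0..1} {0..1} \<theta> \<theta>'" and mono: "strict_mono_on {0..1} \<theta>"
    and conj: "\<And>t. t \<in> {0..1} \<Longrightarrow> h (\<theta> t) = \<theta> (f t)"
    using assms(1) unfolding Lebesgue_fair_model_def by blast
  have onto: "\<theta> ` {0..1} = {0..1}" and inv: "\<And>t. t \<in> {0..1} \<Longrightarrow> \<theta>' (\<theta> t) = t" "\<And>v. v \<in> {0..1} \<Longrightarrow> \<theta> (\<theta>' v) = v"
    and cont': "continuous_on {0..1} \<theta>'"
    using hom unfolding homeomorphism_def by blast+
  have \<theta>01: "\<theta> t \<in> {0..1}" if "t \<in> {0..1}" for t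
    using onto that by blast
  have less: "\<theta> s < \<theta> t \<longleftrightarrow> s < t" if "s \<in> {0..1}" "t \<in> {0..1}" for s t
    using strict_mono_on_less[OF mono that] .
  have inj: "inj_on \<theta> {0..1}"
    using mono by (rule strict_mono_on_imp_inj_on)
  have bor: "\<theta> ` S \<in> sets borel" if S: "S \<in> sets borel" "S \<subseteq> {0..1}" for S
  proof -
    have "\<theta>' \<in> borel_measurable (restrict_space borel {0..1})"
      by (rule borel_measurable_continuous_on_restrict[OF cont'])
    then have "\<theta>' -` S \<inter> {0..1} \<in> sets (restrict_space borel {0..1})"
      using measurable_sets[OF _ S(1), of \<theta>' "restrict_space borel {0..1}"] by (simp add: space_restrict_space)
    then have "\<theta>' -` S \<inter> {0..1} \<in> sets borel"
      by (subst (asm) sets_restrict_space_iff) auto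
    moreover have "\<theta>' -` S \<inter> {0..1} = \<theta> ` S"
      using inv S(2) \<theta>01 by (auto intro!: image_eqI) 
    ultimately show ?thesis by simp
  qed
  have img: "\<theta> ` {a<..<b} = {\<theta> a<..<\<theta> b}" if ab: "a \<in> {0..1}" "b \<in> {0..1}" for a b
  proof (intro equalityI subsetI)
    fix v assume v: "v \<in> {\<theta> a<..<\<theta> b}"
    then have "v \<in> {0..1}" using \<theta>01[OF ab(1)] \<theta>01[OF ab(2)] by auto
    then obtain t where t: "t \<in> {0..1}" "v = \<theta> t" using onto by blast
    then show "v \<in> \<theta> ` {a<..<b}"
      using v less[OF ab(1) t(1)] less[OF t(1) ab(2)] by auto
  qed (use ab less in auto)
  have img_Int: "\<theta> ` (A \<inter> B) = \<theta> ` A \<inter> \<theta> ` B" if "A \<subseteq> {0..1}" "B \<subseteq> {0..1}" for A B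
    using inj that by (rule inj_on_image_Int)
  have \<I>01: "l \<subseteq> {0..1}" if "l \<in> \<I>" for l
    using \<I>_unit[OF that] by blast
  have \<I>bor: "l \<in> sets borel" if "l \<in> \<I>" for l
    using \<I>_open[OF that] by (rule borel_open)
  \<comment> \<open>The length of \<open>\<theta> ` G\<close> is the integral over \<open>\<theta> ` f ` G\<close> of the density \<open>1 / card (preds l)\<close>.\<close>
  have transfer: "((\<lambda>l. measure lborel (\<theta> ` (l \<inter> f ` G)) / card (preds l)) has_sum measure lborel (\<theta> ` G)) \<I>"
    if i: "i \<in> \<I>" and G: "open G" "G \<subseteq> i" for i G
  proof -
    define E where "E l = \<theta> ` (G \<inter> f -` l)" for l
    have G01: "G \<subseteq> {0..1}" using G \<I>01[OF i] by blast
    have sub: "G \<inter> f -` l \<subseteq> {0..1}" for l using G01 by blast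
    have contG: "continuous_on G f"
      using f_cont[OF i] G(2) by (rule continuous_on_subset)
    have op: "open (G \<inter> f -` l)" if "l \<in> \<I>" for l
      using continuous_open_preimage[OF contG G(1) \<I>_open[OF that]] .
    have Ebor: "E l \<in> sets borel" if "l \<in> \<I>" for l
      unfolding E_def using op[OF that] sub by (intro bor borel_open)
    have "((\<lambda>l. measure lborel (\<theta> ` G \<inter> E l)) has_sum measure lborel (\<theta> ` G)) \<I>"
    proof (rule has_sum_measure_cover[OF countable_\<I>])
      show "disjoint_family_on E \<I>"
        unfolding disjoint_family_on_def
      proof (intro ballI impI)
        fix k l assume kl: "k \<in> \<I>" "l \<in> \<I>" "k \<noteq> l"
        have "(G \<inter> f -` k) \<inter> (G \<inter> f -` l) = {}"
          using \<I>_unique[OF kl(1,2)] kl(3) by blast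
        then show "E k \<inter> E l = {}"
          unfolding E_def img_Int[OF sub sub, symmetric] by simp
      qed
      show "E l \<in> sets borel" if "l \<in> \<I>" for l
        using Ebor[OF that] .
      show "\<theta> ` G \<in> sets borel"
        using bor[OF borel_open[OF G(1)] G01] .
      show "emeasure lborel (\<theta> ` G) \<noteq> \<infinity>"
        using G01 \<theta>01 by (intro emeasure_lborel_subset_unit_finite) blast
      have "\<theta> ` G - (\<Union>l\<in>\<I>. E l) \<subseteq> \<theta> ` {t \<in> {0..1}. f t \<in> C}"
      proof
        fix v assume v: "v \<in> \<theta> ` G - (\<Union>l\<in>\<I>. E l)"
        then obtain x where x: "x \<in> G" "v = \<theta> x" by blast
        then have "x \<in> {0..1}" using G01 by blast
        moreover have "f x \<in> C"
          using unit_cases[OF f_unit[OF \<open>x \<in> {0..1}\<close>]] v x by (auto simp: E_def)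
        ultimately show "v \<in> \<theta> ` {t \<in> {0..1}. f t \<in> C}"
          using x by blast
      qed
      then show "countable (\<theta> ` G - (\<Union>l\<in>\<I>. E l))"
        using countable_preimage[OF countable_C] by (rule countable_subset[OF _ countable_image])
    qed
    moreover have "measure lborel (\<theta> ` G \<inter> E l) = measure lborel (\<theta> ` (l \<inter> f ` G)) / card (preds l)"
      if l: "l \<in> \<I>" for l
    proof -
      have hE: "h ` E l = \<theta> ` (l \<inter> f ` G)"
      proof -
        have "h ` E l = (\<lambda>x. \<theta> (f x)) ` (G \<inter> f -` l)"
          unfolding E_def image_image using conj sub by (intro image_cong) blast+
        also have "\<dots> = \<theta> ` (l \<inter> f ` G)"
          by blast
        finally show ?thesis .
      qed
      have "measure lborel (E l) = measure lborel (h ` E l) / card (preds l)"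
      proof (rule fair_measure_injective_piece[OF fair Ebor[OF l] _ _ card_preds[OF l]])
        show "E l \<subseteq> {0..1}"
          unfolding E_def using sub \<theta>01 by blast
        show "inj_on h (E l)"
        proof (rule inj_onI)
          fix u v assume uv: "u \<in> E l" "v \<in> E l" "h u = h v"
          then obtain x y where xy: "x \<in> G" "y \<in> G" "u = \<theta> x" "v = \<theta> y"
            unfolding E_def by blast
          then have "\<theta> (f x) = \<theta> (f y)"
            using uv(3) conj G01 by (metis subsetD)
          then have "f x = f y"
            using inj_onD[OF inj] f_unit xy G01 by (meson subsetD)
          then show "u = v"
            using inj_onD[OF f_inj[OF i]] xy G(2) by blast
        qed
        fix b assume "b \<in> h ` E l"
        then obtain s where s: "s \<in> l" "b = \<theta> s"
          unfolding hE by blast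
        have "{x \<in> {0..1}. h x = b} = \<theta> ` {t \<in> {0..1}. f t = s}"
        proof (intro equalityI subsetI)
          fix x assume x: "x \<in> {x \<in> {0..1}. h x = b}"
          then obtain t where t: "t \<in> {0..1}" "x = \<theta> t" using onto by blast
          then have "\<theta> (f t) = \<theta> s"
            using x s conj by simp
          then have "f t = s"
            using inj_onD[OF inj] f_unit[OF t(1)] \<I>_unit[OF l s(1)] by blast
          then show "x \<in> \<theta> ` {t \<in> {0..1}. f t = s}"
            using t by blast
        qed (use conj \<theta>01 s in auto)
        then have "card {x \<in> {0..1}. h x = b} = card {t \<in> {0..1}. f t = s}"
          using card_image[OF inj_on_subset[OF inj Collect_restrict, of "\<lambda>t. f t = s"]] by simp
        then show "card {x \<in> {0..1}. h x = b} = card (preds l)"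
          using card_fibre[OF l s(1)] by simp
      qed
      moreover have "\<theta> ` G \<inter> E l = E l"
        unfolding E_def by blast
      ultimately show ?thesis
        unfolding hE by simp
    qed
    ultimately show ?thesis
      by (simp cong: has_sum_cong)
  qed
  define \<nu> where "\<nu> l = measure lborel (\<theta> ` l)" for l
  have cover: "((\<lambda>l. measure lborel (D \<inter> \<theta> ` l)) has_sum measure lborel D) \<I>"
    if D: "D \<in> sets borel" "D \<subseteq> {0..1}" for D
  proof (rule has_sum_measure_cover[OF countable_\<I>])
    show "disjoint_family_on (\<lambda>l. \<theta> ` l) \<I>"
      unfolding disjoint_family_on_def
    proof (intro ballI impI)
      fix k l assume kl: "k \<in> \<I>" "l \<in> \<I>" "k \<noteq> l"
      then have "k \<inter> l = {}" using \<I>_unique[OF kl(1,2)] by blast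
      then show "\<theta> ` k \<inter> \<theta> ` l = {}"
        using img_Int[OF \<I>01[OF kl(1)] \<I>01[OF kl(2)]] by simp
    qed
    show "\<theta> ` l \<in> sets borel" if "l \<in> \<I>" for l
      using bor \<I>bor \<I>01 that by blast
    have "D - (\<Union>l\<in>\<I>. \<theta> ` l) \<subseteq> \<theta> ` C"
    proof
      fix v assume v: "v \<in> D - (\<Union>l\<in>\<I>. \<theta> ` l)"
      then have "v \<in> \<theta> ` {0..1}" unfolding onto using D(2) by blast
      then obtain t where "t \<in> {0..1}" "v = \<theta> t" by blast
      then show "v \<in> \<theta> ` C" using unit_cases[of t] v by blast
    qed
    then show "countable (D - (\<Union>l\<in>\<I>. \<theta> ` l))"
      using countable_C by (rule countable_subset[OF _ countable_image])
  qed (use D emeasure_lborel_subset_unit_finite in auto)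
  have "stationary_distribution \<I> Q \<nu>"
    unfolding stationary_distribution_def
  proof (intro conjI ballI)
    show "0 \<le> \<nu> i" for i by (simp add: \<nu>_def)
    have "((\<lambda>l. measure lborel ({0..1} \<inter> \<theta> ` l)) has_sum 1) \<I>"
      using cover[of "{0..1}"] by simp
    moreover have "{0..1} \<inter> \<theta> ` l = \<theta> ` l" if "l \<in> \<I>" for l
      using \<I>01[OF that] \<theta>01 by blast
    ultimately show "(\<nu> has_sum 1) \<I>"
      unfolding \<nu>_def by (simp cong: has_sum_cong)
    fix i assume i: "i \<in> \<I>"
    have "measure lborel (\<theta> ` (l \<inter> f ` i)) / card (preds l) = \<nu> l * Q l i" if l: "l \<in> \<I>" for l
    proof (cases "l \<subseteq> f ` i")
      case True
      then have "l \<inter> f ` i = l" by blast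
      then show ?thesis using True by (simp add: Q_eq[OF l i] \<nu>_def)
    next
      case False
      then have "l \<inter> f ` i = {}" using image_Markov[OF i l] by blast
      then show ?thesis using False by (simp add: Q_eq[OF l i])
    qed
    then show "((\<lambda>l. \<nu> l * Q l i) has_sum \<nu> i) \<I>"
      using transfer[OF i \<I>_open[OF i]] unfolding \<nu>_def by (simp cong: has_sum_cong)
  qed
  then have \<nu>\<pi>: "\<nu> l = \<pi> l" if "l \<in> \<I>" for l
    using stationary_distribution_unique[OF Q_stochastic irreducible _ \<pi>_stationary that] by blast
  have within: "lower t \<le> \<theta> t \<and> \<theta> t \<le> lower t + mass t" if t: "t \<in> {0..1}" for t
  proof -
    have D: "{0..\<theta> t} \<in> sets borel" "{0..\<theta> t} \<subseteq> {0..1}"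
      using \<theta>01[OF t] by auto
    have eq: "((\<lambda>l. measure lborel ({0..\<theta> t} \<inter> \<theta> ` l)) has_sum \<theta> t) \<I>"
      using cover[OF D] \<theta>01[OF t] by simp
    have below: "{0..\<theta> t} \<inter> \<theta> ` l = \<theta> ` l" if l: "l \<in> W_single X {t}" for l
    proof -
      have "l \<in> \<I>" "\<And>x. x \<in> l \<Longrightarrow> x < t" using l unfolding W_single_point by auto
      then show ?thesis
        using less[OF _ t] \<theta>01 \<I>_unit by (fastforce intro: less_imp_le)
    qed
    have above: "{0..\<theta> t} \<inter> \<theta> ` l = {}" if l: "l \<in> \<I>" "\<not> (\<forall>a\<in>l. a < t)" "t \<notin> l" for l
    proof -
      have "t < x" if x: "x \<in> l" for x
      proof (rule ccontr)
        assume "\<not> t < x"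
        moreover obtain y where "y \<in> l" "t \<le> y" using l(2) by force
        ultimately show False
          using \<I>_convex[OF l(1) x, of y t] l(3) by auto
      qed
      then show ?thesis
        using less[OF t] \<I>_unit[OF l(1)] by fastforce
    qed
    have "measure lborel ({0..\<theta> t} \<inter> \<theta> ` l) \<le> \<pi> l" if l: "l \<in> \<I>" for l
    proof -
      have "\<theta> ` l \<subseteq> {0..1}"
        using \<I>01[OF l] \<theta>01 by blast
      then have "measure lborel ({0..\<theta> t} \<inter> \<theta> ` l) \<le> measure lborel (\<theta> ` l)"
        using bor[OF \<I>bor[OF l] \<I>01[OF l]] emeasure_lborel_subset_unit_finite[of "\<theta> ` l"]
        by (intro measure_mono_fmeasurable) (auto simp: fmeasurable_def less_top)
      then show ?thesis
        using \<nu>\<pi>[OF l] by (simp add: \<nu>_def)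
    qed
    then have "\<theta> t \<le> infsum \<pi> {l \<in> \<I>. (\<forall>a\<in>l. a < t) \<or> t \<in> l}"
      using above \<pi>_summable
      by (intro has_sum_mono_neutral[OF eq has_sum_infsum]) auto
    moreover have "infsum \<pi> (W_single X {t}) \<le> \<theta> t"
      using W_single_\<I>[of "{t}"] \<pi>_summable below \<nu>\<pi>
      by (intro has_sum_mono_neutral[OF has_sum_infsum eq]) (auto simp: \<nu>_def)
    ultimately show ?thesis
      using lower_plus_mass[OF t] by (simp add: lower_def left_def)
  qed
  have \<theta>C: "\<theta> c = lower c" if "c \<in> C" for c
    using within[OF C_unit[OF that]] mass_C[OF that] by simp
  have \<theta>J: "\<theta> ` l = J l" if l: "l \<in> \<I>" for l
  proof -
    obtain a b where ab: "l = {a<..<b}" "a \<in> C" "b \<in> C"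
      using \<I>_endpoints[OF l] by metis
    have "\<theta> ` {a<..<b} = {\<theta> a<..<\<theta> b}"
      using img[OF C_unit[OF ab(2)] C_unit[OF ab(3)]] .
    then show ?thesis
      using lower_endpoints[OF l ab] \<theta>C ab by (simp add: J_def)
  qed
  have "\<theta> t = branch (cell t) (\<theta> (f t))" if t: "t \<in> {0..1}" "t \<notin> C" for t
  proof -
    define i where "i = cell t"
    have i: "i \<in> \<I>" "t \<in> i"
      using cell_\<I>[OF t] in_cell[OF t] by (auto simp: i_def)
    obtain a b where ab: "i = {a<..<b}" "a \<in> C" "b \<in> C"
      using \<I>_endpoints[OF i(1)] by metis
    note a01 = C_unit[OF ab(2)]
    let ?G = "{a<..<t}"
    \<comment> \<open>The ends of the image of \<open>{a<..<t}\<close>.\<close>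
    define p where "p = (if increasing i then lo i else f t)"
    define q where "q = (if increasing i then f t else hi i)"
    have ft: "f t \<in> {lo i<..<hi i}"
      using image_interval[OF i(1)] i(2) by blast
    have pq01: "p \<in> {0..1}" "q \<in> {0..1}"
      using C_unit[OF lo_C[OF i(1)]] C_unit[OF hi_C[OF i(1)]] f_unit[OF t(1)] by (auto simp: p_def q_def)
    have pq: "p \<le> q" using ft by (auto simp: p_def q_def)
    have Gi: "?G \<subseteq> i" using ab(1) i(2) by auto
    have fG: "f ` ?G = {p<..<q}"
    proof (intro equalityI subsetI)
      fix y assume "y \<in> f ` ?G"
      then obtain x where x: "x \<in> i" "x < t" "y = f x" using Gi by auto
      have "f x \<in> {lo i<..<hi i}"
        using image_interval[OF i(1)] x(1) by blast
      then show "y \<in> {p<..<q}"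
        using increasing_less[OF i(1) _ x(1) i(2)] not_increasing_less[OF i(1) _ i(2) x(1)] x
        by (auto simp: p_def q_def)
    next
      fix y assume y: "y \<in> {p<..<q}"
      then have "y \<in> {lo i<..<hi i}"
        using ft by (auto simp: p_def q_def split: if_splits)
      then obtain x where x: "x \<in> i" "y = f x"
        using image_interval[OF i(1)] by blast
      then have "x < t"
        using y increasing_less[OF i(1) _ x(1) i(2)] not_increasing_less[OF i(1) _ i(2) x(1)]
        by (auto simp: p_def q_def split: if_splits)
      then show "y \<in> f ` ?G"
        using x ab(1) by auto
    qed
    have \<theta>pq: "\<theta> p \<in> {0..1}" "\<theta> q \<in> {0..1}" "\<theta> p \<le> \<theta> q"
      using \<theta>01[OF pq01(1)] \<theta>01[OF pq01(2)] less[OF pq01] pq by (auto simp: le_less)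
    have "measure lborel (\<theta> ` (l \<inter> f ` ?G)) = clip l (\<theta> q) - clip l (\<theta> p)" if l: "l \<in> \<I>" for l
    proof -
      have "{p<..<q} \<subseteq> {0..1}" using pq01 by auto
      then have "\<theta> ` (l \<inter> f ` ?G) = J l \<inter> {\<theta> p<..<\<theta> q}"
        unfolding fG using img_Int[OF \<I>01[OF l]] \<theta>J[OF l] img[OF pq01] by simp
      then show ?thesis
        using measure_J_between[OF l \<theta>pq] by simp
    qed
    then have "((\<lambda>l. clip l (\<theta> q) / card (preds l) - clip l (\<theta> p) / card (preds l)) has_sum measure lborel (\<theta> ` ?G)) \<I>"
      using transfer[OF i(1) _ Gi] by (simp add: diff_divide_distrib cong: has_sum_cong)
    then have "measure lborel (\<theta> ` ?G) = K (\<theta> q) - K (\<theta> p)"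
      using has_sum_unique has_sum_diff_real[OF K_has_sum K_has_sum] by blast
    moreover have "measure lborel (\<theta> ` ?G) = \<theta> t - \<theta> a"
      using img[OF a01 t(1)] less[OF a01 t(1)] ab(1) i(2) by (simp add: less_imp_le)
    moreover have "\<theta> a = left i"
      using lower_endpoints(1)[OF i(1) ab] \<theta>C[OF ab(2)] by simp
    ultimately show ?thesis
      using \<theta>C[OF lo_C[OF i(1)]] \<theta>C[OF hi_C[OF i(1)]]
      unfolding i_def[symmetric] branch_def p_def q_def by auto
  qed
  then have \<theta>\<phi>: "\<theta> t = \<phi> t" if "t \<in> {0..1}" for t
    using fixed_point_unique[of \<theta>] within that by blast
  obtain s where s: "s \<in> {0..1}" "t = \<theta> s"
    using onto assms(2) by blast
  then show ?thesis
    using conj[OF s(1)] g_\<phi>[OF s(1)] \<theta>\<phi>[OF s(1)] \<theta>\<phi>[OF f_unit[OF s(1)]] by simp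
qed

end

section \<open>The model is Lebesgue fair\<close>

lemma affine_image_borel:
  fixes B :: "real set"
  assumes "m \<noteq> 0" "B \<in> sets borel"
  shows "(\<lambda>x. m * x + d) ` B \<in> sets borel"
    "measure lborel ((\<lambda>x. m * x + d) ` B) = \<bar>m\<bar> * measure lborel B"
proof -
  have "(\<lambda>x. m * x + d) ` B = (\<lambda>y. (y - d) / m) -` B"
  proof (intro equalityI subsetI)
    fix y assume "y \<in> (\<lambda>y. (y - d) / m) -` B"
    then show "y \<in> (\<lambda>x. m * x + d) ` B"
      using assms(1) by (intro image_eqI[of _ _ "(y - d) / m"]) auto
  qed (use assms(1) in auto)
  moreover have "(\<lambda>y. (y - d) / m) -` B \<in> sets borel"
    using measurable_sets[of "\<lambda>y. (y - d) / m" borel borel B] assms(2) by simp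
  ultimately show bor: "(\<lambda>x. m * x + d) ` B \<in> sets borel"
    by simp
  show "measure lborel ((\<lambda>x. m * x + d) ` B) = \<bar>m\<bar> * measure lborel B"
    using measure_lebesgue_affine[of m d B] bor assms(2) by (simp add: measure_completion)
qed

lemma borel_isomorphism_onI:
  assumes F: "F \<in> borel_measurable borel" "\<And>x. x \<in> Z \<Longrightarrow> h x = F x"
    and G: "G \<in> borel_measurable borel" "\<And>x. x \<in> Z \<Longrightarrow> G (h x) = x"
  shows "borel_isomorphism_on h Z"
  unfolding borel_isomorphism_on_def
proof (intro conjI)
  show inj: "inj_on h Z"
    using G(2) by (rule inj_on_inverseI)
  have "F \<in> restrict_space borel Z \<rightarrow>\<^sub>M restrict_space borel (h ` Z)"
    using F by (intro measurable_restrict_space3) auto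
  then show "h \<in> restrict_space borel Z \<rightarrow>\<^sub>M restrict_space borel (h ` Z)"
    by (rule measurable_cong[THEN iffD1, rotated]) (use F(2) in \<open>simp add: space_restrict_space\<close>)
  have "G \<in> restrict_space borel (h ` Z) \<rightarrow>\<^sub>M restrict_space borel Z"
    using G by (intro measurable_restrict_space3) auto
  then show "the_inv_into Z h \<in> restrict_space borel (h ` Z) \<rightarrow>\<^sub>M restrict_space borel Z"
    by (rule measurable_cong[THEN iffD1, rotated])
       (use G(2) the_inv_into_f_f[OF inj] in \<open>auto simp: space_restrict_space\<close>)
qed

lemma countable_borel: "countable (A :: real set) \<Longrightarrow> A \<in> sets borel"
  using countable_imp_null_set_lborel[of A] by (auto simp: null_sets_def)

lemma measure_countable: "countable (A :: real set) \<Longrightarrow> measure lborel A = 0"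
  using countable_imp_null_set_lborel[of A] by (simp add: measure_eq_0_null_sets)

context fair_Markov_map
begin

definition inv_slope :: "real set \<Rightarrow> real set \<Rightarrow> real" where
  "inv_slope i j = (if increasing i then 1 else - 1) / card (preds j)"

text \<open>
  The inverse of the affine piece of the model that maps \<open>Z i j\<close> onto \<open>J j\<close>: the restriction of
  \<open>branch i\<close> to \<open>J j\<close>, extended to an affine map of the line.
\<close>
definition inv_branch :: "real set \<Rightarrow> real set \<Rightarrow> real \<Rightarrow> real" where
  "inv_branch i j w = inv_slope i j * w + (branch i (left j) - inv_slope i j * left j)"

definition Z :: "real set \<Rightarrow> real set \<Rightarrow> real set" where
  "Z i j = \<phi> ` (i \<inter> f -` j)"

text \<open>
  The pairs \<open>(j, i)\<close> with \<open>j \<subseteq> f ` i\<close>, target first, so that sums over edges split into the finite sums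
  over the predecessors of each \<open>j\<close>.
\<close>
definition edges :: "(real set \<times> real set) set" where
  "edges = (SIGMA j:\<I>. preds j)"

lemma edgesD:
  assumes "(j, i) \<in> edges"
  shows "j \<in> \<I>" "i \<in> \<I>" "j \<subseteq> f ` i"
  using assms by (auto simp: edges_def preds_def)

lemma countable_edges: "countable edges"
proof -
  have "edges \<subseteq> \<I> \<times> \<I>" using edgesD by auto
  then show ?thesis using countable_\<I> by (metis countable_SIGMA countable_subset)
qed

lemma inv_slope_nonzero: "j \<in> \<I> \<Longrightarrow> inv_slope i j \<noteq> 0"
  and inv_slope_abs: "j \<in> \<I> \<Longrightarrow> \<bar>inv_slope i j\<bar> = 1 / card (preds j)"
  using card_preds[of j] by (auto simp: inv_slope_def)

lemma \<phi>_piece: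
  assumes e: "(j, i) \<in> edges" and t: "t \<in> i" "f t \<in> j"
  shows "\<phi> t = inv_branch i j (\<phi> (f t))"
proof -
  note ij = edgesD[OF e]
  have "\<phi> (f t) \<in> J j"
    using \<phi>_image_\<I>[OF ij(1)] t(2) by blast
  then have "branch i (\<phi> (f t)) - branch i (left j) = (if increasing i then \<phi> (f t) - left j else left j - \<phi> (f t)) / card (preds j)"
    using \<pi>_pos[OF ij(1)] by (intro branch_slope[OF ij(1)]) (auto simp: J_def)
  moreover have "\<phi> t = branch i (\<phi> (f t))"
    using \<phi>_branch[OF \<I>_unit[OF ij(2) t(1)] \<I>_not_C[OF ij(2) t(1)]] cell_eq[OF ij(2) t(1)] by simp
  ultimately show ?thesis
    by (auto simp: inv_branch_def inv_slope_def diff_divide_distrib)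
qed

lemma Z_eq:
  assumes e: "(j, i) \<in> edges"
  shows "Z i j = inv_branch i j ` J j"
proof -
  note ij = edgesD[OF e]
  show ?thesis
    unfolding Z_def \<phi>_image_\<I>[OF ij(1), symmetric]
  proof (intro equalityI subsetI)
    fix v assume "v \<in> \<phi> ` (i \<inter> f -` j)"
    then show "v \<in> inv_branch i j ` \<phi> ` j"
      using \<phi>_piece[OF e] by blast
  next
    fix v assume "v \<in> inv_branch i j ` \<phi> ` j"
    then obtain s where s: "s \<in> j" "v = inv_branch i j (\<phi> s)" by blast
    then obtain t where "t \<in> i" "s = f t" using ij(3) by blast
    then show "v \<in> \<phi> ` (i \<inter> f -` j)"
      using \<phi>_piece[OF e, of t] s by (intro image_eqI[of _ _ t]) auto
  qed
qed

lemma g_inv_branch: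
  assumes e: "(j, i) \<in> edges" and w: "w \<in> J j"
  shows "g (inv_branch i j w) = w" "inv_branch i j w \<in> {0..1}"
proof -
  note ij = edgesD[OF e]
  obtain s where s: "s \<in> j" "w = \<phi> s"
    using w unfolding \<phi>_image_\<I>[OF ij(1), symmetric] by blast
  then obtain t where t: "t \<in> i" "s = f t" using ij(3) by blast
  have "inv_branch i j w = \<phi> t"
    using \<phi>_piece[OF e t(1)] s t by simp
  then show "g (inv_branch i j w) = w" "inv_branch i j w \<in> {0..1}"
    using g_\<phi>[OF \<I>_unit[OF ij(2) t(1)]] \<phi>_unit[OF \<I>_unit[OF ij(2) t(1)]] s t by simp_all
qed

lemma Z_preimage:
  assumes e: "(j, i) \<in> edges" and B: "B \<subseteq> J j"
  shows "Z i j \<inter> g -` B = inv_branch i j ` B"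
  unfolding Z_eq[OF e] using g_inv_branch(1)[OF e] B by (auto intro!: image_eqI)

lemma inv_branch_measure:
  assumes "j \<in> \<I>" "B \<in> sets borel"
  shows "inv_branch i j ` B \<in> sets borel" "measure lborel (inv_branch i j ` B) = measure lborel B / card (preds j)"
  using affine_image_borel[OF inv_slope_nonzero[OF assms(1)] assms(2), of i "branch i (left j) - inv_slope i j * left j"]
    inv_slope_abs[OF assms(1), of i]
  unfolding inv_branch_def by simp_all

lemma Z_borel: "(j, i) \<in> edges \<Longrightarrow> Z i j \<in> sets borel"
  using inv_branch_measure(1)[OF edgesD(1) J_borel] by (simp add: Z_eq)

lemma Z_unit: "(j, i) \<in> edges \<Longrightarrow> Z i j \<subseteq> {0..1}"
  unfolding Z_eq using g_inv_branch(2) by blast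

lemma g_image_Z: "(j, i) \<in> edges \<Longrightarrow> g ` Z i j = J j"
  unfolding Z_eq image_image using g_inv_branch(1) by simp

lemma Z_nonempty: "(j, i) \<in> edges \<Longrightarrow> Z i j \<noteq> {}"
  unfolding Z_eq using J_bounds(3)[OF edgesD(1), of j i] by (simp add: J_def)

lemma in_Z_iff: "t \<in> {0..1} \<Longrightarrow> (j, i) \<in> edges \<Longrightarrow> \<phi> t \<in> Z i j \<longleftrightarrow> t \<in> i \<and> f t \<in> j"
  unfolding Z_def using inj_onD[OF \<phi>_inj] \<I>_unit[OF edgesD(2)] by blast

lemma orbit_edge: "t \<in> {0..1} \<Longrightarrow> f t \<notin> C \<Longrightarrow> (cell (f t), cell t) \<in> edges \<and> \<phi> t \<in> Z (cell t) (cell (f t))"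
  using orbit_step[of t] unfolding edges_def Z_def by blast

lemma Z_cell: "t \<in> {0..1} \<Longrightarrow> (j, i) \<in> edges \<Longrightarrow> \<phi> t \<in> Z i j \<Longrightarrow> f t \<notin> C \<and> i = cell t \<and> j = cell (f t)"
  using in_Z_iff[of t j i] cell_eq[of i t] cell_eq[of j "f t"] \<I>_not_C[of j "f t"] edgesD[of j i] by auto

lemma Z_disjoint: "disjoint_family_on (\<lambda>(j, i). Z i j) edges"
proof -
  have "Z i j \<inter> Z i' j' = {}" if e: "(j, i) \<in> edges" "(j', i') \<in> edges" "(j, i) \<noteq> (j', i')" for i j i' j'
  proof (rule ccontr)
    assume "\<not> ?thesis"
    then obtain v where v: "v \<in> Z i j" "v \<in> Z i' j'" by blast
    then have "v \<in> \<phi> ` {0..1}" unfolding \<phi>_onto using Z_unit[OF e(1)] by blast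
    then obtain t where "t \<in> {0..1}" "v = \<phi> t" by blast
    then show False
      using Z_cell[OF _ e(1), of t] Z_cell[OF _ e(2), of t] v e(3) by auto
  qed
  then show ?thesis
    unfolding disjoint_family_on_def by (clarsimp simp del: disjoint_iff) metis
qed

lemma countable_exceptional: "countable (\<phi> ` {t \<in> {0..1}. f t \<in> C})"
  using countable_preimage[OF countable_C] by (rule countable_image)

lemma Z_cover: "{0..1} - (\<Union>(j, i)\<in>edges. Z i j) \<subseteq> \<phi> ` {t \<in> {0..1}. f t \<in> C}"
proof
  fix v assume v: "v \<in> {0..1} - (\<Union>(j, i)\<in>edges. Z i j)"
  then have "v \<in> \<phi> ` {0..1}" unfolding \<phi>_onto by blast
  then obtain t where t: "t \<in> {0..1}" "v = \<phi> t" by blast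
  then have "f t \<in> C"
    using orbit_edge[OF t(1)] v by blast
  then show "v \<in> \<phi> ` {t \<in> {0..1}. f t \<in> C}" using t by blast
qed

lemma g_preimage_borel:
  assumes B: "B \<in> sets borel" "B \<subseteq> {0..1}"
  shows "g -` B \<inter> {0..1} \<in> sets borel"
proof -
  let ?N = "\<phi> ` {t \<in> {0..1}. f t \<in> C}"
  let ?U = "\<Union>(j, i)\<in>edges. inv_branch i j ` (B \<inter> J j)"
  have piece: "Z i j \<inter> g -` B = inv_branch i j ` (B \<inter> J j)" if e: "(j, i) \<in> edges" for i j
  proof -
    have "Z i j \<inter> g -` B = Z i j \<inter> g -` (B \<inter> J j)"
      using g_image_Z[OF e] by blast
    then show ?thesis using Z_preimage[OF e, of "B \<inter> J j"] by simp
  qed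
  have "g -` B \<inter> {0..1} = ?U \<union> (?N \<inter> g -` B)"
  proof (intro equalityI subsetI)
    fix v assume v: "v \<in> g -` B \<inter> {0..1}"
    show "v \<in> ?U \<union> (?N \<inter> g -` B)"
    proof (cases "v \<in> ?N")
      case False
      then obtain i j where e: "(j, i) \<in> edges" "v \<in> Z i j"
        using Z_cover v by blast
      then have "v \<in> inv_branch i j ` (B \<inter> J j)"
        using piece v by blast
      then show ?thesis using e(1) by blast
    qed (use v in blast)
  next
    fix v assume "v \<in> ?U \<union> (?N \<inter> g -` B)"
    then show "v \<in> g -` B \<inter> {0..1}"
    proof
      assume "v \<in> ?U"
      then obtain i j where e: "(j, i) \<in> edges" "v \<in> inv_branch i j ` (B \<inter> J j)" by blast
      then show ?thesis
        using piece[OF e(1)] Z_unit[OF e(1)] by blast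
    qed (use \<phi>_unit in blast)
  qed
  moreover have "?U \<in> sets borel"
    using countable_edges inv_branch_measure(1) edgesD(1) B(1) J_borel
    by (intro sets.countable_UN') auto
  moreover have "?N \<inter> g -` B \<in> sets borel"
    using countable_exceptional by (intro countable_borel countable_Int1)
  ultimately show ?thesis by simp
qed

text \<open>
  The preimage of \<open>B \<inter> J j\<close> consists of \<open>card (preds j)\<close> affine copies, each of them shorter by the
  factor \<open>card (preds j)\<close>.
\<close>
lemma g_measure_preserving:
  assumes B: "B \<in> sets borel" "B \<subseteq> {0..1}"
  shows "measure lborel (g -` B \<inter> {0..1}) = measure lborel B"
proof -
  let ?E = "g -` B \<inter> {0..1}"
  have "((\<lambda>p. measure lborel (?E \<inter> (case p of (j, i) \<Rightarrow> Z i j))) has_sum measure lborel ?E) edges"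
  proof (rule has_sum_measure_cover[OF countable_edges Z_disjoint _ g_preimage_borel[OF B]])
    show "(case p of (j, i) \<Rightarrow> Z i j) \<in> sets borel" if "p \<in> edges" for p
      using Z_borel that by (cases p) simp
    show "emeasure lborel ?E \<noteq> \<infinity>"
      by (rule emeasure_lborel_subset_unit_finite) blast
    have "?E - (\<Union>p\<in>edges. case p of (j, i) \<Rightarrow> Z i j) \<subseteq> {0..1} - (\<Union>(j, i)\<in>edges. Z i j)"
      by blast
    then show "countable (?E - (\<Union>p\<in>edges. case p of (j, i) \<Rightarrow> Z i j))"
      using Z_cover countable_exceptional by (meson countable_subset)
  qed
  moreover have "measure lborel (?E \<inter> (case p of (j, i) \<Rightarrow> Z i j)) = (case p of (j, i) \<Rightarrow> measure lborel (J j \<inter> B) / card (preds j))"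
    if "p \<in> edges" for p
  proof -
    obtain i j where p: "p = (j, i)" by fastforce
    have e: "(j, i) \<in> edges" using that p by simp
    have "?E \<inter> Z i j = Z i j \<inter> g -` (J j \<inter> B)"
      using g_image_Z[OF e] Z_unit[OF e] by blast
    also have "\<dots> = inv_branch i j ` (J j \<inter> B)"
      by (rule Z_preimage[OF e]) blast
    finally show ?thesis
      using inv_branch_measure(2)[OF edgesD(1)[OF e], of "J j \<inter> B" i] B(1) J_borel[of j] by (simp add: p)
  qed
  ultimately have "((\<lambda>(j, i). measure lborel (J j \<inter> B) / card (preds j)) has_sum measure lborel ?E) edges"
    by (rule has_sum_cong[THEN iffD1, rotated])
  then have "((\<lambda>j. measure lborel (J j \<inter> B)) has_sum measure lborel ?E) \<I>"
    unfolding edges_def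
  proof (rule has_sum_SigmaD)
    fix j assume j: "j \<in> \<I>"
    show "((\<lambda>i. case (j, i) of (j, i) \<Rightarrow> measure lborel (J j \<inter> B) / card (preds j)) has_sum measure lborel (J j \<inter> B)) (preds j)"
      using finite_preds[OF j] card_preds[OF j] by (auto intro!: has_sum_finiteI)
  qed
  moreover note has_sum_measure_J[OF B]
  ultimately show ?thesis
    using has_sum_unique by (simp add: Int_commute) blast
qed

text \<open>
  Cutting the unit interval into the pieces \<open>Z i j\<close>, and not just into the intervals \<open>J i\<close>, makes every
  element map onto some \<open>J j\<close> or onto a point, so that images are disjoint or equal.
\<close>
definition \<Z> :: "real set set" where
  "\<Z> = (\<lambda>(j, i). Z i j) ` edges \<union> (\<lambda>t. {\<phi> t}) ` {t \<in> {0..1}. f t \<in> C}"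

lemma \<Z>_cases:
  assumes "A \<in> \<Z>"
  obtains (edge) i j where "(j, i) \<in> edges" "A = Z i j" | (point) t where "t \<in> {0..1}" "f t \<in> C" "A = {\<phi> t}"
  using assms unfolding \<Z>_def by auto

lemma g_image_\<Z>:
  assumes "A \<in> \<Z>"
  shows "g ` A \<in> (J ` \<I>) \<union> ((\<lambda>c. {\<phi> c}) ` C)"
  using assms
proof (cases rule: \<Z>_cases)
  case (edge i j)
  then show ?thesis using g_image_Z edgesD(1) by blast
next
  case (point t)
  then show ?thesis using g_\<phi> by simp
qed

lemma partition_\<Z>: "partition_on {0..1} \<Z>"
proof (rule partition_onI)
  show "\<Union>\<Z> = {0..1}"
  proof
    show "\<Union>\<Z> \<subseteq> {0..1}"
      unfolding \<Z>_def using Z_unit \<phi>_unit by blast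
    show "{0..1} \<subseteq> \<Union>\<Z>"
    proof
      fix v :: real assume v: "v \<in> {0..1}"
      show "v \<in> \<Union>\<Z>"
      proof (cases "v \<in> (\<Union>(j, i)\<in>edges. Z i j)")
        case False
        then have "v \<in> \<phi> ` {t \<in> {0..1}. f t \<in> C}"
          using Z_cover v by blast
        then show ?thesis unfolding \<Z>_def by blast
      qed (auto simp: \<Z>_def)
    qed
  qed
  have unique: "A = (if f t \<in> C then {\<phi> t} else Z (cell t) (cell (f t)))" if "A \<in> \<Z>" "t \<in> {0..1}" "\<phi> t \<in> A" for A t
    using that(1)
  proof (cases rule: \<Z>_cases)
    case (edge i j)
    then show ?thesis using Z_cell[OF that(2) edge(1)] that(3) by auto
  next
    case (point s)
    then have "s = t" using inj_onD[OF \<phi>_inj] that by auto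
    then show ?thesis using point by simp
  qed
  show "disjnt A B" if AB: "A \<in> \<Z>" "B \<in> \<Z>" "A \<noteq> B" for A B
  proof (rule ccontr)
    assume "\<not> disjnt A B"
    then obtain v where v: "v \<in> A" "v \<in> B" unfolding disjnt_def by blast
    then have "v \<in> \<phi> ` {0..1}" unfolding \<phi>_onto using \<open>\<Union>\<Z> = {0..1}\<close> AB(1) by blast
    then obtain t where t: "t \<in> {0..1}" "v = \<phi> t" by blast
    show False
      using unique[OF AB(1) t(1)] unique[OF AB(2) t(1)] v t AB(3) by simp
  qed
  show "{} \<notin> \<Z>"
  proof
    assume "{} \<in> \<Z>"
    then show False
    proof (cases rule: \<Z>_cases)
      case (edge i j)
      then show ?thesis using Z_nonempty[OF edge(1)] by simp
    qed simp
  qed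
qed

lemma J_\<phi>C: "j \<in> \<I> \<Longrightarrow> c \<in> C \<Longrightarrow> \<phi> c \<notin> J j"
proof
  assume j: "j \<in> \<I>" and c: "c \<in> C" and "\<phi> c \<in> J j"
  then obtain t where t: "t \<in> j" "\<phi> c = \<phi> t"
    unfolding \<phi>_image_\<I>[OF j, symmetric] by blast
  have "c = t"
    using inj_onD[OF \<phi>_inj t(2) C_unit[OF c] \<I>_unit[OF j t(1)]] .
  then show False
    using \<I>_not_C[OF j t(1)] c by simp
qed

lemma injectivity_partition_\<Z>: "injectivity_partition g \<Z>"
  unfolding injectivity_partition_def
proof (intro conjI ballI)
  show "countable \<Z>"
    unfolding \<Z>_def using countable_edges countable_preimage[OF countable_C] by blast
  show "partition_on {0..1} \<Z>" by (rule partition_\<Z>)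
  fix A assume A: "A \<in> \<Z>"
  show "A \<in> sets borel"
    using A by (cases rule: \<Z>_cases) (use Z_borel in auto)
  show "g ` A \<in> sets borel"
    using g_image_\<Z>[OF A] J_borel by auto
  show "borel_isomorphism_on g A"
    using A
  proof (cases rule: \<Z>_cases)
    case (edge i j)
    note j = edgesD(1)[OF edge(1)]
    let ?F = "\<lambda>v. (v - (branch i (left j) - inv_slope i j * left j)) / inv_slope i j"
    have F: "?F (inv_branch i j w) = w" for w
      using inv_slope_nonzero[OF j, of i] by (simp add: inv_branch_def)
    show ?thesis
    proof (rule borel_isomorphism_onI[where F = ?F and G = "inv_branch i j"])
      fix v assume "v \<in> A"
      then obtain w where "w \<in> J j" "v = inv_branch i j w"
        unfolding edge(2) Z_eq[OF edge(1)] by blast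
      then show "g v = ?F v" "inv_branch i j (g v) = v"
        using g_inv_branch(1)[OF edge(1)] F by simp_all
    next
      show "inv_branch i j \<in> borel_measurable borel"
      proof -
        have "inv_branch i j = (\<lambda>w. inv_slope i j * w + (branch i (left j) - inv_slope i j * left j))"
          by (rule ext) (rule inv_branch_def)
        then show ?thesis by simp
      qed
    qed simp
  next
    case (point t)
    then show ?thesis
      by (intro borel_isomorphism_onI[where F = "\<lambda>_. g (\<phi> t)" and G = "\<lambda>_. \<phi> t"]) auto
  qed
next
  let ?\<Q> = "(J ` \<I>) \<union> ((\<lambda>c. {\<phi> c}) ` C)"
  have disj: "p = q \<or> p \<inter> q = {}" if pq: "p \<in> ?\<Q>" "q \<in> ?\<Q>" for p q
  proof -
    have JC: "J k \<inter> {\<phi> c} = {}" if "k \<in> \<I>" "c \<in> C" for k c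
      using J_\<phi>C[OF that] by simp
    have JJ: "J k = J l \<or> J k \<inter> J l = {}" if "k \<in> \<I>" "l \<in> \<I>" for k l
      using disjoint_family_onD[OF J_disjoint that] by (cases "k = l") auto
    from pq consider k l where "k \<in> \<I>" "l \<in> \<I>" "p = J k" "q = J l"
      | k c where "k \<in> \<I>" "c \<in> C" "p = J k" "q = {\<phi> c}"
      | k c where "k \<in> \<I>" "c \<in> C" "p = {\<phi> c}" "q = J k"
      | b c where "p = {\<phi> b}" "q = {\<phi> c}"
      by (elim UnE imageE) simp_all
    then show ?thesis
    proof cases
      case (1 k l)
      then show ?thesis using JJ by simp
    next
      case (2 k c)
      then show ?thesis using JC by simp
    next
      case (3 k c)
      then show ?thesis using JC[of k c] by (simp add: Int_commute)
    next
      case (4 b c)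
      then show ?thesis by auto
    qed
  qed
  have unit: "q \<subseteq> {0..1}" if "q \<in> ?\<Q>" for q
    using that J_unit \<phi>_unit C_unit by blast
  show "countable (image_refinement g \<Z>)"
  proof (rule countable_image_refinement)
    show "\<Z> \<noteq> {}"
      using partition_onD1[OF partition_\<Z>] by auto
    show "g ` A \<subseteq> {0..1}" if "A \<in> \<Z>" for A
      using unit g_image_\<Z>[OF that] by blast
    show "countable ?\<Q>"
      using countable_\<I> countable_C by blast
    show "{0..1} \<subseteq> \<Union>?\<Q>"
    proof
      fix v :: real assume "v \<in> {0..1}"
      then have "v \<in> \<phi> ` {0..1}" unfolding \<phi>_onto .
      then obtain t where t: "t \<in> {0..1}" "v = \<phi> t" by blast
      show "v \<in> \<Union>?\<Q>"
        using unit_cases[OF t(1)] t(2) \<phi>_image_\<I> by blast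
    qed
    fix q A assume q: "q \<in> ?\<Q>" and A: "A \<in> \<Z>"
    show "q \<subseteq> {0..1} \<and> (q \<subseteq> g ` A \<or> q \<inter> g ` A = {})"
      using unit[OF q] disj[OF q g_image_\<Z>[OF A]] by blast
  qed
qed

text \<open>
  A nonempty set \<open>B\<close> inside \<open>J j\<close> is covered exactly by the pieces \<open>Z i j\<close> with \<open>i\<close> a predecessor of \<open>j\<close>;
  a set covered by a singleton is a point, and all measures vanish.
\<close>
lemma g_fair_pieces:
  assumes B: "B \<in> sets borel" "B \<subseteq> {0..1}" and A: "A \<in> covering_elements g \<Z> B"
  shows "measure lborel (A \<inter> g -` B) =
    (if finite (covering_elements g \<Z> B) then measure lborel B / card (covering_elements g \<Z> B) else 0)"
proof (cases "B = {}")
  case False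
  have A: "A \<in> \<Z>" "B \<subseteq> g ` A"
    using A by (auto simp: covering_elements_def)
  from A(1) show ?thesis
  proof (cases rule: \<Z>_cases)
    case (edge i j)
    note j = edgesD(1)[OF edge(1)]
    have BJ: "B \<subseteq> J j"
      using A(2) g_image_Z[OF edge(1)] edge(2) by simp
    have "covering_elements g \<Z> B = (\<lambda>i. Z i j) ` preds j"
    proof (intro equalityI subsetI)
      fix Y assume "Y \<in> covering_elements g \<Z> B"
      then have Y: "Y \<in> \<Z>" "B \<subseteq> g ` Y" by (auto simp: covering_elements_def)
      from Y(1) show "Y \<in> (\<lambda>i. Z i j) ` preds j"
      proof (cases rule: \<Z>_cases)
        case (edge i' j')
        then have "B \<subseteq> J j'" using Y(2) g_image_Z by simp
        then have "j' = j"
          using BJ False J_disjoint j edgesD(1)[OF edge(1)] unfolding disjoint_family_on_def by blast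
        then show ?thesis using edge by (auto simp: edges_def)
      next
        case (point t)
        then have "B \<subseteq> {\<phi> (f t)}" using Y(2) g_\<phi> by simp
        then show ?thesis using BJ False J_\<phi>C[OF j point(2)] by blast
      qed
    next
      fix Y assume "Y \<in> (\<lambda>i. Z i j) ` preds j"
      then obtain k where k: "k \<in> preds j" "Y = Z k j" by blast
      then have e: "(j, k) \<in> edges" using j by (simp add: edges_def)
      then show "Y \<in> covering_elements g \<Z> B"
        using k BJ g_image_Z[OF e] unfolding covering_elements_def \<Z>_def by auto
    qed
    moreover have "inj_on (\<lambda>i. Z i j) (preds j)"
    proof (rule inj_onI)
      fix k k' assume k: "k \<in> preds j" "k' \<in> preds j" "Z k j = Z k' j"
      then have e: "(j, k) \<in> edges" "(j, k') \<in> edges" using j by (auto simp: edges_def)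
      then show "k = k'"
        using Z_disjoint Z_nonempty[OF e(1)] k(3) unfolding disjoint_family_on_def by fastforce
    qed
    ultimately have "finite (covering_elements g \<Z> B)" "card (covering_elements g \<Z> B) = card (preds j)"
      using finite_preds[OF j] by (simp_all add: card_image)
    moreover have "measure lborel (A \<inter> g -` B) = measure lborel B / card (preds j)"
      using Z_preimage[OF edge(1) BJ] inv_branch_measure(2)[OF j B(1)] edge(2) by simp
    ultimately show ?thesis by simp
  next
    case (point t)
    then have "B \<subseteq> {\<phi> (f t)}" using A(2) g_\<phi> by simp
    then have "countable B" by (rule countable_subset) simp
    moreover have "countable (A \<inter> g -` B)" using point(3) by (intro countable_Int1) simp
    ultimately show ?thesis by (simp add: measure_countable)
  qed
qed simp

lemma g_Lebesgue_fair: "Lebesgue_fair g"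
proof -
  let ?\<mu> = "restrict_space lborel {0..1::real}"
  have ps: "prob_space ?\<mu>"
    by (rule prob_space_restrict_space) auto
  have meas: "g \<in> ?\<mu> \<rightarrow>\<^sub>M ?\<mu>"
  proof (rule measurableI)
    fix B assume "B \<in> sets ?\<mu>"
    then have "g -` B \<inter> {0..1} \<in> sets borel"
      using g_preimage_borel unfolding sets_restrict_unit by blast
    then show "g -` B \<inter> space ?\<mu> \<in> sets ?\<mu>"
      by (simp add: sets_restrict_unit del: atLeastAtMost_iff)
  qed (use g_unit in auto)
  interpret prob_space ?\<mu> by (rule ps)
  interpret D: prob_space "distr ?\<mu> ?\<mu> g" by (rule prob_space_distr[OF meas])
  have "distr ?\<mu> ?\<mu> g = ?\<mu>"
  proof (rule measure_eqI)
    fix B assume "B \<in> sets (distr ?\<mu> ?\<mu> g)"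
    then have B: "B \<in> sets ?\<mu>" "B \<in> sets borel" "B \<subseteq> {0..1}"
      using sets_restrict_unit by auto
    have "measure (distr ?\<mu> ?\<mu> g) B = measure ?\<mu> (g -` B \<inter> {0..1})"
      using measure_distr[OF meas B(1)] by simp
    also have "\<dots> = measure ?\<mu> B"
      using g_measure_preserving[OF B(2,3)] B(3) by (simp add: measure_restrict_unit)
    finally show "emeasure (distr ?\<mu> ?\<mu> g) B = emeasure ?\<mu> B"
      by (simp add: emeasure_eq_measure D.emeasure_eq_measure)
  qed simp
  moreover have "measure ?\<mu> (A \<inter> g -` B) =
      (if finite (covering_elements g \<Z> B) then measure ?\<mu> B / real (card (covering_elements g \<Z> B)) else 0)"
    if R: "R \<in> image_refinement g \<Z>" and B: "B \<in> sets borel" "B \<subseteq> R" and A: "A \<in> covering_elements g \<Z> B" for R A B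
  proof -
    have A01: "A \<subseteq> {0..1}"
      using A partition_onD1[OF partition_\<Z>] by (auto simp: covering_elements_def)
    have "B \<subseteq> g ` A"
      using A by (simp add: covering_elements_def)
    then have "B \<subseteq> {0..1}"
      using g_unit A01 by blast
    then show ?thesis
      using g_fair_pieces[OF B(1) _ A] A01 by (simp add: measure_restrict_unit le_infI1)
  qed
  ultimately show ?thesis
    unfolding Lebesgue_fair_def fair_measure_def
    using meas ps injectivity_partition_\<Z> by (intro conjI exI[of _ \<Z>]) (auto simp: sets_restrict_space)
qed

lemma g_Lebesgue_fair_model: "Lebesgue_fair_model f g"
  unfolding Lebesgue_fair_model_def
  using g_unit g_Lebesgue_fair \<phi>_homeomorphism \<phi>_strict_mono g_\<phi> by blast

end

section \<open>The model is the piecewise affine map\<close>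

lemma affine_image_Ioo:
  fixes a b m d :: real
  assumes "a < b" "m \<noteq> 0"
  shows "(\<lambda>x. m * x + d) ` {a<..<b} = {min (m * a + d) (m * b + d)<..<max (m * a + d) (m * b + d)}"
proof (intro equalityI subsetI)
  fix y assume "y \<in> (\<lambda>x. m * x + d) ` {a<..<b}"
  then obtain x where x: "a < x" "x < b" "y = m * x + d" by auto
  then show "y \<in> {min (m * a + d) (m * b + d)<..<max (m * a + d) (m * b + d)}"
    using assms(2) by (cases "m > 0") (auto simp: min_less_iff_disj less_max_iff_disj)
next
  fix y assume y: "y \<in> {min (m * a + d) (m * b + d)<..<max (m * a + d) (m * b + d)}"
  let ?x = "(y - d) / m"
  have "a < ?x \<and> ?x < b"
  proof (cases "m > 0")
    case True
    then have "m * a < m * b" using assms(1) by simp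
    then show ?thesis
      using y True by (simp add: field_simps min_def max_def)
  next
    case False
    then have m: "m < 0" using assms(2) by simp
    then have "m * b < m * a" using assms(1) by simp
    then show ?thesis
      using y m by (simp add: field_simps min_def max_def)
  qed
  then show "y \<in> (\<lambda>x. m * x + d) ` {a<..<b}"
    using assms(2) by (intro image_eqI[of _ _ ?x]) auto
qed

text \<open>
  The image determines the limits at the two ends up to their order, and the orientation determines
  the order.
\<close>
lemma affine_onto_formula:
  assumes g: "affine_onto g x x' y y'" and x: "x < x'" and y: "y < y'"
    and mono: "if up then strict_mono_on {x<..<x'} g else strict_antimono_on {x<..<x'} g"
    and t: "t \<in> {x<..<x'}"
  shows "g t = (if up then y + (t - x) * (y' - y) / (x' - x) else y' + (t - x) * (y - y') / (x' - x))"
proof -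
  obtain a b where ab: "\<And>t. t \<in> {x<..<x'} \<Longrightarrow> g t = a * t + b" and im: "g ` {x<..<x'} = {y<..<y'}"
    using g unfolding affine_onto_def by blast
  obtain p where p: "x < p" "p < x'" using dense x by blast
  obtain q where q: "p < q" "q < x'" using dense p by blast
  have gpq: "g p = a * p + b" "g q = a * q + b" using p q ab by auto
  have sgn: "if up then a > 0 else a < 0"
  proof (cases up)
    case True
    then have "strict_mono_on {x<..<x'} g" using mono by simp
    then have "g p < g q" using p q by (auto intro: strict_mono_onD)
    then have "0 < a * (q - p)" by (simp add: gpq algebra_simps)
    then show ?thesis using q True by (simp add: zero_less_mult_iff)
  next
    case False
    then have "strict_antimono_on {x<..<x'} g" using mono by simp
    then have "g q < g p" using p q by (auto intro: monotone_onD)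
    then have "a * (q - p) < 0" by (simp add: gpq algebra_simps)
    then show ?thesis using q False by (simp add: mult_less_0_iff)
  qed
  then have "a \<noteq> 0" by (auto split: if_splits)
  have "{y<..<y'} = (\<lambda>t. a * t + b) ` {x<..<x'}"
    unfolding im[symmetric] using ab by (intro image_cong) auto
  then have "{y<..<y'} = {min (a * x + b) (a * x' + b)<..<max (a * x + b) (a * x' + b)}"
    unfolding affine_image_Ioo[OF x \<open>a \<noteq> 0\<close>] .
  then have yy: "y = min (a * x + b) (a * x' + b)" "y' = max (a * x + b) (a * x' + b)"
    using y by (auto simp: greaterThanLessThan_eq_iff)
  show ?thesis
  proof (cases up)
    case True
    then have "a * x < a * x'" using sgn x by simp
    then have *: "y = a * x + b" "y' = a * x' + b" using yy by auto
    have "y' - y = a * (x' - x)" by (simp add: * algebra_simps)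
    then have "(t - x) * (y' - y) / (x' - x) = (t - x) * a" using x by simp
    then show ?thesis using True ab[OF t] by (simp add: * algebra_simps)
  next
    case False
    then have "a * x' < a * x" using sgn x by simp
    then have *: "y = a * x' + b" "y' = a * x + b" using yy by auto
    have "y - y' = a * (x' - x)" by (simp add: * algebra_simps)
    then have "(t - x) * (y - y') / (x' - x) = (t - x) * a" using x by simp
    then show ?thesis using False ab[OF t] by (simp add: * algebra_simps)
  qed
qed

context fair_Markov_map
begin

lemma X_convex: "i \<in> X \<Longrightarrow> a \<in> i \<Longrightarrow> b \<in> i \<Longrightarrow> a \<le> x \<Longrightarrow> x \<le> b \<Longrightarrow> x \<in> i"
  using X_cases[of i] \<I>_convex[of i a b x] by auto

lemma piece_convex:
  assumes i: "i \<in> X" and j: "j \<in> X" and p: "p \<in> i" "f p \<in> j" and q: "q \<in> i" "f q \<in> j" and a: "p \<le> a" "a \<le> q"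
  shows "a \<in> i \<and> f a \<in> j"
proof
  show ai: "a \<in> i"
    using X_convex[OF i p(1) q(1) a] .
  show "f a \<in> j"
  proof (cases "i \<in> \<I>")
    case True
    show ?thesis
    proof (cases "increasing i")
      case inc: True
      have "f p \<le> f a" "f a \<le> f q"
        using increasing_less[OF True inc] ai p q a by (meson not_le)+
      then show ?thesis using X_convex[OF j p(2) q(2)] by blast
    next
      case dec: False
      have "f q \<le> f a" "f a \<le> f p"
        using not_increasing_less[OF True dec] ai p q a by (meson not_le)+
      then show ?thesis using X_convex[OF j q(2) p(2)] by blast
    qed
  next
    case False
    then obtain c where "i = {c}" using X_cases[OF i] by blast
    then show ?thesis using ai p by simp
  qed
qed

lemma X_unit: "i \<in> X \<Longrightarrow> t \<in> i \<Longrightarrow> t \<in> {0..1}"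
  using partition_onD1[OF partition_X] by blast

lemma edge_of_piece:
  assumes "i \<in> \<I>" "j \<in> \<I>" "i \<inter> f -` j \<noteq> {}"
  shows "(j, i) \<in> edges"
proof -
  obtain t where "t \<in> i" "f t \<in> j" using assms(3) by blast
  then have "j \<subseteq> f ` i" using image_Markov[OF assms(1,2)] by blast
  then show ?thesis using assms by (simp add: edges_def preds_def)
qed

lemma edge_weight:
  assumes "(j, i) \<in> edges"
  shows "\<pi> i * P i j = \<pi> j / card (preds j)" "measure lborel (Z i j) = \<pi> i * P i j"
proof -
  note e = edgesD[OF assms]
  have "\<forall>i\<in>\<I>. \<forall>j\<in>\<I>. \<pi> i * P i j = \<pi> j * Q j i"
    using fair unfolding fair_Markov_measure_def by - (elim conjE, assumption)
  then show w: "\<pi> i * P i j = \<pi> j / card (preds j)"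
    using e by (simp add: Q_eq)
  show "measure lborel (Z i j) = \<pi> i * P i j"
    unfolding Z_eq[OF assms] inv_branch_measure(2)[OF e(1) J_borel] measure_J[OF e(1)] w ..
qed

text \<open>
  The pieces left of a given one fill, up to countably many points, the part of the unit interval below
  its image under \<open>\<phi>\<close>. A piece with a point left of the given one lies entirely left of
  it, as pieces are convex.
\<close>
lemma W_pair_sum:
  assumes i: "i \<in> X" and j: "j \<in> X" and ne: "i \<inter> f -` j \<noteq> {}"
  shows "(\<Sum>\<^sub>\<infinity>(k, l)\<in>W_pair f X i j. \<pi> k * P k l) = Inf (\<phi> ` (i \<inter> f -` j))"
proof -
  let ?A = "i \<inter> f -` j" and ?W = "W_pair f X i j"
  define x where "x = Inf (\<phi> ` ?A)"
  have A01: "\<phi> ` ?A \<subseteq> {0..1}"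
    using X_unit[OF i] \<phi>_unit by blast
  have bdd: "bdd_below (\<phi> ` ?A)"
    using A01 by (rule bdd_below_mono[rotated]) simp
  have lowr: "x \<le> v" if "v \<in> \<phi> ` ?A" for v
    unfolding x_def using that bdd by (rule cInf_lower)
  have great: "v \<le> x" if "\<And>w. w \<in> \<phi> ` ?A \<Longrightarrow> v \<le> w" for v
    unfolding x_def using ne that by (intro cInf_greatest) auto
  have x01: "0 \<le> x" "x \<le> 1"
  proof -
    show "0 \<le> x"
      using A01 by (intro great) (meson atLeastAtMost_iff subsetD)
    obtain a where "a \<in> ?A" using ne by blast
    then have "x \<le> \<phi> a" "\<phi> a \<in> {0..1}"
      using lowr A01 by blast+
    then show "x \<le> 1" by simp
  qed
  have We: "(l, k) \<in> edges" "lies_left_of (k \<inter> f -` l) ?A" if "(k, l) \<in> ?W" for k l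
    using that edge_of_piece unfolding W_pair_def by auto
  have cW: "countable ?W"
  proof -
    have "?W \<subseteq> prod.swap ` edges"
      using We(1) by (auto intro!: image_eqI[where x = "prod.swap _"])
    then show ?thesis using countable_edges by (meson countable_image countable_subset)
  qed
  have "((\<lambda>p. measure lborel ({0..x} \<inter> (case p of (k, l) \<Rightarrow> Z k l))) has_sum measure lborel {0..x}) ?W"
  proof (rule has_sum_measure_cover[OF cW])
    show "disjoint_family_on (\<lambda>p. case p of (k, l) \<Rightarrow> Z k l) ?W"
      unfolding disjoint_family_on_def
    proof (intro ballI impI)
      fix p q assume pq: "p \<in> ?W" "q \<in> ?W" "p \<noteq> q"
      obtain k l k' l' where e: "p = (k, l)" "q = (k', l')" by fastforce
      then show "(case p of (k, l) \<Rightarrow> Z k l) \<inter> (case q of (k, l) \<Rightarrow> Z k l) = {}"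
        using disjoint_family_onD[OF Z_disjoint, of "(l, k)" "(l', k')"] We(1) pq by auto
    qed
    show "(case p of (k, l) \<Rightarrow> Z k l) \<in> sets borel" if "p \<in> ?W" for p
      using Z_borel We(1) that by (cases p) auto
    show "emeasure lborel {0..x} \<noteq> \<infinity>"
      using x01 by (intro emeasure_lborel_subset_unit_finite) auto
    have "{0..x} - (\<Union>p\<in>?W. case p of (k, l) \<Rightarrow> Z k l) \<subseteq> insert x (\<phi> ` {t \<in> {0..1}. f t \<in> C})"
    proof
      fix v assume v: "v \<in> {0..x} - (\<Union>p\<in>?W. case p of (k, l) \<Rightarrow> Z k l)"
      then have "v \<in> \<phi> ` {0..1}" unfolding \<phi>_onto using x01 by auto
      then obtain t where t: "t \<in> {0..1}" "v = \<phi> t" by blast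
      show "v \<in> insert x (\<phi> ` {t \<in> {0..1}. f t \<in> C})"
      proof (rule ccontr)
        assume "\<not> ?thesis"
        then have vx: "v < x" and ft: "f t \<notin> C"
          using v t by auto
        let ?k = "cell t" and ?l = "cell (f t)"
        note o = orbit_step[OF t(1) ft]
        have t_less: "t < a" if "a \<in> ?A" for a
          using lowr[of "\<phi> a"] that vx t(2) \<phi>_less_iff[OF t(1) X_unit[OF i], of a] by auto
        have "lies_left_of (?k \<inter> f -` ?l) ?A"
          unfolding lies_left_of_def
        proof (intro ballI, rule ccontr)
          fix q a assume q: "q \<in> ?k \<inter> f -` ?l" and a: "a \<in> ?A" and "\<not> q < a"
          then have "a \<in> ?k \<and> f a \<in> ?l"
            using piece_convex[OF \<I>_X[OF o(3)] \<I>_X[OF o(4)] o(5,6), of q a] t_less[OF a] by auto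
          then have "?k = i" "?l = j"
            using X_unique[OF \<I>_X[OF o(3)] i, of a] X_unique[OF \<I>_X[OF o(4)] j, of "f a"] a by auto
          then have "t \<in> ?A" using o(5,6) by simp
          then show False using t_less by blast
        qed
        then have "(?k, ?l) \<in> ?W"
          using o(3-6) unfolding W_pair_def by blast
        moreover have "v \<in> Z ?k ?l"
          using orbit_edge[OF t(1) ft] t(2) by simp
        ultimately show False using v by blast
      qed
    qed
    then show "countable ({0..x} - (\<Union>p\<in>?W. case p of (k, l) \<Rightarrow> Z k l))"
      using countable_exceptional by (meson countable_insert countable_subset)
  qed simp
  moreover have "measure lborel ({0..x} \<inter> (case p of (k, l) \<Rightarrow> Z k l)) = (case p of (k, l) \<Rightarrow> \<pi> k * P k l)" if "p \<in> ?W" for p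
  proof -
    obtain k l where p: "p = (k, l)" by fastforce
    note e = We[OF that[unfolded p]]
    have "Z k l \<subseteq> {0..x}"
    proof
      fix v assume v: "v \<in> Z k l"
      then obtain t where t: "t \<in> k" "f t \<in> l" "v = \<phi> t" unfolding Z_def by blast
      have "v \<le> w" if w: "w \<in> \<phi> ` ?A" for w
      proof -
        obtain a where a: "a \<in> ?A" "w = \<phi> a" using w by blast
        then have "t < a" using e(2) t unfolding lies_left_of_def by blast
        then show ?thesis
          using \<phi>_less_iff[OF \<I>_unit[OF edgesD(2)[OF e(1)] t(1)] X_unit[OF i]] a t(3) by (simp add: less_imp_le)
      qed
      then show "v \<in> {0..x}"
        using great Z_unit[OF e(1)] v by auto
    qed
    then show ?thesis
      using edge_weight(2)[OF e(1)] by (simp add: p Int_absorb1)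
  qed
  ultimately have "((\<lambda>(k, l). \<pi> k * P k l) has_sum measure lborel {0..x}) ?W"
    by (rule has_sum_cong[THEN iffD1, rotated])
  then show ?thesis
    using x01 by (simp add: x_def[symmetric] infsumI)
qed

lemma Z_interval:
  assumes e: "(j, i) \<in> edges"
  shows "Z i j = {Inf (Z i j)<..<Inf (Z i j) + \<pi> i * P i j}" "0 < \<pi> i * P i j"
proof -
  note j = edgesD(1)[OF e]
  let ?m = "inv_slope i j" and ?d = "branch i (left j) - inv_slope i j * left j"
  let ?a = "?m * left j + ?d" and ?b = "?m * (left j + \<pi> j) + ?d"
  have m: "?m \<noteq> 0" using inv_slope_nonzero[OF j] .
  have Zi: "Z i j = {min ?a ?b<..<max ?a ?b}"
    unfolding Z_eq[OF e] J_def inv_branch_def using \<pi>_pos[OF j] m by (intro affine_image_Ioo) auto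
  have w: "max ?a ?b - min ?a ?b = \<pi> i * P i j"
  proof -
    have "max ?a ?b - min ?a ?b = \<bar>?b - ?a\<bar>" by (simp add: max_def min_def)
    also have "?b - ?a = ?m * \<pi> j" by (simp add: algebra_simps)
    also have "\<bar>?m * \<pi> j\<bar> = \<pi> j / card (preds j)"
      using inv_slope_abs[OF j, of i] \<pi>_pos[OF j] by (simp add: abs_mult)
    finally show ?thesis using edge_weight(1)[OF e] by simp
  qed
  show pos: "0 < \<pi> i * P i j"
    using edge_weight(1)[OF e] \<pi>_pos[OF j] card_preds[OF j] by simp
  then have "min ?a ?b < max ?a ?b" using w by linarith
  then have "Inf (Z i j) = min ?a ?b"
    unfolding Zi by (rule cInf_greaterThanLessThan)
  then show "Z i j = {Inf (Z i j)<..<Inf (Z i j) + \<pi> i * P i j}"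
    using Zi w by (metis add.commute diff_add_cancel)
qed

lemma piece_point:
  assumes i: "i \<in> X" and c: "{c} \<in> X" and t: "t \<in> i" "f t = c"
  shows "i \<inter> f -` {c} = {t}"
proof (cases "i \<in> \<I>")
  case True
  then show ?thesis using f_inj[OF True] t by (auto simp: inj_on_def)
next
  case False
  then obtain d where "i = {d}" using X_cases[OF i] by blast
  then show ?thesis using t by auto
qed

lemma g_piecewise_affine: "piecewise_affine_map f X \<pi> P g"
  unfolding piecewise_affine_map_def Let_def
proof (intro conjI ballI impI)
  show "g \<in> {0..1} \<rightarrow> {0..1}" using g_unit by blast
  fix i j assume ij: "i \<in> X" "j \<in> X" "i \<inter> f -` j \<noteq> {}"
  let ?x = "\<Sum>\<^sub>\<infinity>(k, l)\<in>W_pair f X i j. \<pi> k * P k l" and ?y = "\<Sum>\<^sub>\<infinity>l\<in>W_single X j. \<pi> l"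
  note x_eq = W_pair_sum[OF ij]
  have y_eq: "?y = left j" by (simp add: left_def)
  {
    assume I: "i \<in> \<I> \<and> j \<in> \<I>"
    have e: "(j, i) \<in> edges" using edge_of_piece I ij(3) by blast
    note j = edgesD(1)[OF e]
    have x: "?x = Inf (Z i j)" unfolding x_eq Z_def ..
    have Zx: "{?x<..<?x + \<pi> i * P i j} = Z i j"
      unfolding x using Z_interval(1)[OF e] by simp
    have mono: "g u < g v \<longleftrightarrow> f s < f t"
      if "u = \<phi> s" "v = \<phi> t" "s \<in> i" "t \<in> i" for u v s t
      using that g_\<phi> \<phi>_less_iff f_unit X_unit[OF ij(1)] by simp
    have pts: "\<exists>s t. u = \<phi> s \<and> v = \<phi> t \<and> s \<in> i \<and> t \<in> i \<and> s < t" if uv: "u \<in> Z i j" "v \<in> Z i j" "u < v" for u v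
    proof -
      obtain s t where st: "u = \<phi> s" "v = \<phi> t" "s \<in> i" "t \<in> i"
        using uv(1,2) unfolding Z_def by blast
      then have "s < t"
        using \<phi>_less_iff[OF X_unit[OF ij(1)] X_unit[OF ij(1)]] uv(3) by simp
      then show ?thesis using st by blast
    qed
    show "?x < ?x + \<pi> i * P i j" using Z_interval(2)[OF e] by simp
    show "?y < ?y + \<pi> j"
      using \<pi>_pos[OF j] by simp
    show "affine_onto g ?x (?x + \<pi> i * P i j) ?y (?y + \<pi> j)"
      unfolding affine_onto_def Zx y_eq
    proof
      show "g ` Z i j = {left j<..<left j + \<pi> j}"
        using g_image_Z[OF e] by (simp add: J_def)
      let ?m = "inv_slope i j" and ?d = "branch i (left j) - inv_slope i j * left j"
      have "g v = 1 / ?m * v + - ?d / ?m" if v: "v \<in> Z i j" for v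
      proof -
        obtain w where w: "w \<in> J j" "v = inv_branch i j w"
          using v unfolding Z_eq[OF e] by blast
        have "v = ?m * w + ?d" using w(2) by (simp add: inv_branch_def)
        then have "w = 1 / ?m * v + - ?d / ?m"
          using inv_slope_nonzero[OF j, of i] by (simp add: field_simps)
        then show ?thesis using g_inv_branch(1)[OF e w(1)] w(2) by simp
      qed
      then show "\<exists>a b. \<forall>t\<in>Z i j. g t = a * t + b" by blast
    qed
    show "strict_mono_on {?x<..<?x + \<pi> i * P i j} g" if "strict_mono_on i f"
      unfolding Zx
    proof (rule strict_mono_onI)
      fix u v assume "u \<in> Z i j" "v \<in> Z i j" "u < v"
      then obtain s t where st: "u = \<phi> s" "v = \<phi> t" "s \<in> i" "t \<in> i" "s < t"
        using pts by blast
      then show "g u < g v"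
        using mono[OF st(1-4)] strict_mono_onD[OF that] by blast
    qed
    show "strict_antimono_on {?x<..<?x + \<pi> i * P i j} g" if "strict_antimono_on i f"
      unfolding Zx
    proof (rule monotone_onI)
      fix u v assume "u \<in> Z i j" "v \<in> Z i j" "u < v"
      then obtain s t where st: "u = \<phi> s" "v = \<phi> t" "s \<in> i" "t \<in> i" "s < t"
        using pts by blast
      then show "g v < g u"
        using mono[OF st(2,1,4,3)] monotone_onD[OF that] by blast
    qed
  }
  {
    assume "\<exists>c. j = {c}"
    then obtain c where c: "j = {c}" by blast
    obtain t where t: "t \<in> i" "f t = c" using ij(3) c by blast
    have "i \<inter> f -` j = {t}"
      using piece_point[OF ij(1) ij(2)[unfolded c] t] c by simp
    then have "?x = \<phi> t"
      unfolding x_eq by simp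
    moreover have "c \<in> C" using ij(2) c C_X by simp
    ultimately show "g ?x = ?y"
      using g_\<phi>[OF X_unit[OF ij(1) t(1)]] t(2) \<phi>_C by (simp add: c lower_def left_def)
  }
qed

lemma piecewise_affine_unique:
  assumes h: "piecewise_affine_map f X \<pi> P h" and v: "v \<in> {0..1}"
  shows "h v = g v"
proof -
  obtain t where t: "t \<in> {0..1}" "v = \<phi> t"
    using v \<phi>_onto by (metis imageE)
  obtain i where i: "i \<in> X" "t \<in> i"
    using partition_onD1[OF partition_X] t(1) by blast
  obtain j where j: "j \<in> X" "f t \<in> j"
    using partition_onD1[OF partition_X] f_unit[OF t(1)] by blast
  have ne: "i \<inter> f -` j \<noteq> {}" using i j by blast
  let ?x = "\<Sum>\<^sub>\<infinity>(k, l)\<in>W_pair f X i j. \<pi> k * P k l" and ?y = "\<Sum>\<^sub>\<infinity>l\<in>W_single X j. \<pi> l"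
  let ?u = "?x + \<pi> i * P i j"
  have *: "(i \<in> \<I> \<and> j \<in> \<I> \<longrightarrow> ?x < ?u \<and> ?y < ?y + \<pi> j \<and>
       affine_onto q ?x ?u ?y (?y + \<pi> j) \<and>
       (strict_mono_on i f \<longrightarrow> strict_mono_on {?x<..<?u} q) \<and>
       (strict_antimono_on i f \<longrightarrow> strict_antimono_on {?x<..<?u} q)) \<and>
       ((\<exists>c. j = {c}) \<longrightarrow> q ?x = ?y)"
    if "piecewise_affine_map f X \<pi> P q" for q
    using that i(1) j(1) ne unfolding piecewise_affine_map_def Let_def by blast
  note H = *[OF h] and G = *[OF g_piecewise_affine]
  show ?thesis
  proof (cases "j \<in> \<I>")
    case True
    have I: "i \<in> \<I>"
    proof (rule ccontr)
      assume "i \<notin> \<I>"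
      then have "t \<in> C" using X_cases[OF i(1)] i(2) by auto
      then show False using f_C \<I>_not_C[OF True j(2)] by blast
    qed
    have e: "(j, i) \<in> edges" using edge_of_piece[OF I True ne] .
    have "{?x<..<?u} = Z i j"
      unfolding W_pair_sum[OF i(1) j(1) ne] Z_def[symmetric] using Z_interval(1)[OF e] by simp
    then have vx: "v \<in> {?x<..<?u}"
      using t(2) i(2) j(2) unfolding Z_def by blast
    have dir: "if strict_mono_on i f then strict_mono_on {?x<..<?u} q
        else strict_antimono_on {?x<..<?u} q"
      if "piecewise_affine_map f X \<pi> P q" for q
      using *[OF that] I True f_mono_cases[OF I] by auto
    have ao: "affine_onto h ?x ?u ?y (?y + \<pi> j)" "affine_onto g ?x ?u ?y (?y + \<pi> j)"
      "?x < ?u" "?y < ?y + \<pi> j"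
      using H G I True by blast+
    show ?thesis
      using affine_onto_formula[OF ao(1,3,4) dir[OF h] vx]
        affine_onto_formula[OF ao(2,3,4) dir[OF g_piecewise_affine] vx] by (rule trans[OF _ sym])
  next
    case False
    then obtain c where c: "j = {c}" using X_cases[OF j(1)] by blast
    have "i \<inter> f -` j = {t}"
      using piece_point[OF i(1) j(1)[unfolded c] i(2)] j(2) c by simp
    then have "?x = v"
      unfolding W_pair_sum[OF i(1) j(1) ne] using t(2) by simp
    then show ?thesis
      using H G c by metis
  qed
qed

end

section \<open>The Lebesgue fair model\<close>

theorem theorem7p4:
  fixes f :: "real \<Rightarrow> real" and X :: "real set set"
    and \<pi> :: "real set \<Rightarrow> real" and P :: "real set \<Rightarrow> real set \<Rightarrow> real"
  assumes "countably_Markov_mixing f X"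
    and "fair_Markov_measure (partition_intervals X) (transition_matrix f) \<pi> P"
  shows "\<exists>g. Lebesgue_fair_model f g \<and> piecewise_affine_map f X \<pi> P g \<and>
             (\<forall>h. Lebesgue_fair_model f h \<longrightarrow> (\<forall>t\<in>{0..1}. h t = g t)) \<and>
             (\<forall>h. piecewise_affine_map f X \<pi> P h \<longrightarrow> (\<forall>t\<in>{0..1}. h t = g t))"
proof -
  interpret fair_Markov_map f X \<pi> P
    using assms by unfold_locales
  show ?thesis
    using g_Lebesgue_fair_model g_piecewise_affine fair_model_unique piecewise_affine_unique
    by (intro exI[of _ g]) blast
qed

end
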